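(* Let $n\ge1$ and $m=\mathrm{DD}(n)+3$, where $\mathrm{DD}(n)$ is the derivation-division number defined in the context. Let $$U=\{(a,r)\in\mathbb{R}^{2n}: I(a,r)\neq\emptyset\},\qquad V=\{(a,r,x)\in\mathbb{R}^{2n}\times\mathbb{R}:(a,r)\in U,\ x\in I(a,r)\},$$ and for $(a,r)\in U$ let $\varphi_{a,r}:I(a,r)\to\mathbb{R}$, $\varphi_{a,r}(x)=a_n+(a_{n-1}+\cdots(a_1+x^{r_1})^{r_2}\cdots)^{r_n}-x$. There exist $m$ analytic functions $\omega_0,\ldots,\omega_{m-1}$ on $V$ such that: (i) for each fixed $(a,r)\in U$, the functions $x\mapsto\omega_k(a,r,x)$, $0\le k\le m-1$, form a Chebyshev system on $I(a,r)$; (ii) for all $(a,r)\in U$ and $x\in I(a,r)$, $$\varphi_{a,r}(x)=\sum_{k=0}^{m-1}\lambda_k(a,r)\,\omega_k(a,r,x),$$ where the coefficients $\lambda_k$ are analytic functions on $U$.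
   Context: For $(a,r)\in\mathbb{R}^n\times\mathbb{R}^n$, $I(a,r)\subset\mathbb{R}$ is the (possibly empty) open interval of all real $x$ for which the functions $g_0(x)=x$, $g_{i+1}(x)=a_{i+1}+g_i(x)^{r_{i+1}}$ ($0\le i\le n-1$) are all defined and strictly positive. The sets $U$ and $V$ are open. Functions $u_0,\ldots,u_{m-1}$ on an interval $I$ form a Chebyshev system if every nontrivial real linear combination $\sum_k c_ku_k$ has at most $m-1$ zeros on $I$. Definition of $\mathrm{DD}(n)$. Fix $n\ge 1$ and let $R=\mathbb{Z}[R_1,\ldots,R_n]$ (polynomial ring). For $0\le j\le n$ let $\mathbb{L}_j=R[x_1^{\pm},y_1^{\pm},\ldots,x_j^{\pm},y_j^{\pm}]$ be the ring of Laurent polynomials in $x_1,y_1,\ldots,x_j,y_j$ over $R$ ($\mathbb{L}_0=R$). The degree of a monomial $c\,x^ky^l$ ($c\in R\setminus\{0\}$, $k,l\in\mathbb{Z}^j$) is the vector $k+l\in\mathbb{Z}^j$. A nonzero element of $\mathbb{L}_j$ is homogeneous if all its monomials have the same degree, denoted $\mathrm{pdeg}(p)=(\mathrm{pdeg}_1(p),\ldots,\mathrm{pdeg}_j(p))$. Put $\Delta_0=1$, $\Delta_i=R_1\cdots R_i$. The derivation $\partial:\mathbb{L}_n\to\mathbb{L}_n$ vanishes on $R$ and satisfies $$\partial(x_1)=\partial(y_1)=\Delta_1x_1,\qquad \partial(x_j)=\partial(y_j)=\Delta_j\,x_j\,\frac{x_1\cdots x_{j-1}}{y_1\cdots y_{j-1}}\quad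 (j\ge 2).$$ It maps each $\mathbb{L}_j$ to itself, and it maps a homogeneous element either to $0$ or to a homogeneous element of the same degree. Regularization monomial $\mathrm{reg}(p)$ of a nonzero homogeneous $p\in\mathbb{L}_j$, defined by induction on $j$: for $j=0$, $\mathrm{reg}(p)=1$; for $j\ge1$, put $d=\mathrm{pdeg}_j(p)$ and write $p=\sum_{i=n_0}^{n_1}q_i\,x_j^{i}y_j^{d-i}$ with integers $n_0\le n_1$ (possibly negative), $q_i\in\mathbb{L}_{j-1}$ zero or homogeneous, $q_{n_0}\ne0$, $q_{n_1}\neq 0$; then $\mathrm{reg}(p)=x_j^{n_0}y_j^{d-n_1}\,\mathrm{reg}(q_{n_0})$. Derivation-division sequence: for a nonzero homogeneous $p$, set $p^{(0)}=p$ and $p^{(k+1)}=\partial p^{(k)}/\mathrm{reg}(\partial p^{(k)})$ if $\partial p^{(k)}\ne0$, and $p^{(k+1)}=0$ if $\partial p^{(k)}=0$. $\mathrm{DD}(p)$ is the smallest integer $k\ge0$ with $p^{(k)}\in R$. Finally $\mathrm{DD}(n):=\mathrm{DD}(p)$ for the polynomial (for which such a $k$ exists) $$p=\Delta_n\sum_{j=1}^{n}(\Delta_j-\Delta_{j-1})\Big(\prod_{i=1}^{j-1}x_i\Big)\Big(\prod_{i=j}^{n-1}y_i\Big)\in\mathbb{L}_{n-1}.$$ *)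

theory Defs
  imports "HOL-Analysis.Analysis" "HOL-Library.Poly_Mapping"
begin

section \<open>Laurent polynomials over \<open>\<int>[R\<^sub>1, \<dots>, R\<^sub>n]\<close>\<close>

text \<open>
  All the rings \<open>\<L>\<^sub>j\<close> are subrings (\<open>laurent n j\<close> below) of one ring of Laurent polynomials in
  variables with arbitrary index. The coefficient ring is the polynomial ring over \<open>\<int>\<close> in the
  \<open>R\<^sub>i\<close>; exponents of \<open>R\<^sub>i\<close> are natural numbers, exponents of \<open>x\<^sub>j\<close> and \<open>y\<^sub>j\<close> are integers.
  Indices start at 1.
\<close>

datatype var = XVar nat | YVar nat

type_synonym coeff = "(nat \<Rightarrow>\<^sub>0 nat) \<Rightarrow>\<^sub>0 int"
type_synonym expo = "var \<Rightarrow>\<^sub>0 int"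
type_synonym lpoly = "expo \<Rightarrow>\<^sub>0 coeff"

definition Rvar :: "nat \<Rightarrow> coeff" where
  "Rvar i = Poly_Mapping.single (Poly_Mapping.single i 1) 1"

definition const :: "coeff \<Rightarrow> lpoly" where
  "const c = Poly_Mapping.single 0 c"

definition monom :: "expo \<Rightarrow> lpoly" where
  "monom m = Poly_Mapping.single m 1"

definition varpow :: "var \<Rightarrow> int \<Rightarrow> lpoly" where
  "varpow v k = monom (Poly_Mapping.single v k)"

definition laurent :: "nat \<Rightarrow> nat \<Rightarrow> lpoly set" where
  "laurent n j = {p. \<forall>m \<in> Poly_Mapping.keys p.
     Poly_Mapping.keys m \<subseteq> XVar ` {1..j} \<union> YVar ` {1..j} \<and>
     (\<forall>b \<in> Poly_Mapping.keys (Poly_Mapping.lookup p m). Poly_Mapping.keys b \<subseteq> {1..n})}"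

definition Delta :: "nat \<Rightarrow> coeff" where
  "Delta i = (\<Prod>k = 1..i. Rvar k)"

section \<open>The derivation\<close>

definition partial :: "var \<Rightarrow> lpoly \<Rightarrow> lpoly" where
  "partial v p = (\<Sum>m \<in> Poly_Mapping.keys p.
     Poly_Mapping.single (m - Poly_Mapping.single v 1)
       (of_int (Poly_Mapping.lookup m v) * Poly_Mapping.lookup p m))"

text \<open>The common value of \<open>\<partial>(x\<^sub>j)\<close> and \<open>\<partial>(y\<^sub>j)\<close>; for \<open>j = 1\<close> the products are empty.\<close>

definition dvar :: "nat \<Rightarrow> lpoly" where
  "dvar j = const (Delta j) * varpow (XVar j) 1 *
     ((\<Prod>i = 1..<j. varpow (XVar i) 1) * (\<Prod>i = 1..<j. varpow (YVar i) (- 1)))"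

definition deriv_op :: "nat \<Rightarrow> lpoly \<Rightarrow> lpoly" where
  "deriv_op n p = (\<Sum>j = 1..n. partial (XVar j) p * dvar j + partial (YVar j) p * dvar j)"

text \<open>
  The lemmas \<open>deriv_op_add\<close>, \<open>deriv_op_mult\<close>, \<open>deriv_op_const\<close>, \<open>deriv_op_X\<close> and \<open>deriv_op_Y\<close>
  show that this is the derivation with the prescribed values.
\<close>

lemma partial_superset:
  assumes "finite A" "Poly_Mapping.keys p \<subseteq> A"
  shows "partial v p = (\<Sum>m \<in> A. Poly_Mapping.single (m - Poly_Mapping.single v 1)
       (of_int (Poly_Mapping.lookup m v) * Poly_Mapping.lookup p m))"
  unfolding partial_def
  by (rule sum.mono_neutral_left) (use assms in \<open>auto simp: in_keys_iff\<close>)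

lemma partial_add: "partial v (p + q) = partial v p + partial v q"
proof -
  let ?A = "Poly_Mapping.keys p \<union> Poly_Mapping.keys q"
  have "Poly_Mapping.keys (p + q) \<subseteq> ?A"
    by (rule Poly_Mapping.keys_add)
  then show ?thesis
    by (simp add: partial_superset[of ?A] lookup_add algebra_simps single_add sum.distrib)
qed

lemma partial_single:
  "partial v (Poly_Mapping.single m c) =
     Poly_Mapping.single (m - Poly_Mapping.single v 1) (of_int (Poly_Mapping.lookup m v) * c)"
  by (cases "c = 0") (simp_all add: partial_def)

lemma partial_mult_single:
  "partial v (Poly_Mapping.single m c * Poly_Mapping.single m' c') =
     partial v (Poly_Mapping.single m c) * Poly_Mapping.single m' c' +
     Poly_Mapping.single m c * partial v (Poly_Mapping.single m' c')"
  by (simp add: partial_single mult_single lookup_add algebra_simps flip: single_add)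

lemma lpoly_induct [case_names zero add]:
  fixes p :: lpoly
  assumes "P 0" "\<And>m c q. P q \<Longrightarrow> P (Poly_Mapping.single m c + q)"
  shows "P p"
proof -
  have "P (\<Sum>m\<in>A. Poly_Mapping.single m (Poly_Mapping.lookup p m))" if "finite A" for A
    using that by induction (auto intro: assms)
  moreover have "(\<Sum>m\<in>Poly_Mapping.keys p. Poly_Mapping.single m (Poly_Mapping.lookup p m)) = p"
    by (rule poly_mapping_eqI)
      (auto simp: lookup_sum lookup_single when_def in_keys_iff sum.delta)
  ultimately show ?thesis
    using finite_keys by metis
qed

lemma partial_zero: "partial v 0 = 0"
  by (simp add: partial_def)

lemma partial_mult: "partial v (p * q) = partial v p * q + p * partial v q"
proof (induction p rule: lpoly_induct)
  case (add m c p)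
  have "partial v (Poly_Mapping.single m c * q) =
      partial v (Poly_Mapping.single m c) * q + Poly_Mapping.single m c * partial v q"
  proof (induction q rule: lpoly_induct)
    case (add m' c' q)
    then show ?case
      by (simp add: distrib_left partial_add partial_mult_single add_ac)
  qed (simp add: partial_zero)
  with add show ?case
    by (simp add: distrib_right partial_add add_ac)
qed (simp add: partial_zero)

lemma deriv_op_add: "deriv_op n (p + q) = deriv_op n p + deriv_op n q"
  by (simp add: deriv_op_def partial_add distrib_right sum.distrib add_ac)

lemma deriv_op_mult: "deriv_op n (p * q) = deriv_op n p * q + p * deriv_op n q"
  by (simp add: deriv_op_def partial_mult distrib_left distrib_right sum.distrib
      sum_distrib_left sum_distrib_right mult_ac add_ac)

lemma deriv_op_const: "deriv_op n (const c) = 0"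
  by (simp add: deriv_op_def const_def partial_single)

lemma partial_varpow: "partial v (varpow w 1) = (if v = w then 1 else 0)"
  by (auto simp: varpow_def monom_def partial_single lookup_single when_def)

lemma deriv_op_X: "1 \<le> j \<Longrightarrow> j \<le> n \<Longrightarrow> deriv_op n (varpow (XVar j) 1) = dvar j"
  by (simp add: deriv_op_def partial_varpow if_distrib[of "\<lambda>t. t * _"] cong: if_cong)

lemma deriv_op_Y: "1 \<le> j \<Longrightarrow> j \<le> n \<Longrightarrow> deriv_op n (varpow (YVar j) 1) = dvar j"
  by (simp add: deriv_op_def partial_varpow if_distrib[of "\<lambda>t. t * _"] cong: if_cong)

section \<open>Regularization and the derivation-division number\<close>

definition expo_deg :: "expo \<Rightarrow> nat \<Rightarrow> int" where
  "expo_deg m j = Poly_Mapping.lookup m (XVar j) + Poly_Mapping.lookup m (YVar j)"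

text \<open>Used for nonzero homogeneous \<open>p\<close> only, where the common degree is unique.\<close>

definition pdeg :: "lpoly \<Rightarrow> nat \<Rightarrow> int" where
  "pdeg p = (THE d. \<forall>m \<in> Poly_Mapping.keys p. expo_deg m = d)"

text \<open>The coefficient of \<open>x\<^sub>j\<^sup>i y\<^sub>j\<^sup>l\<close> in \<open>p\<close>, a Laurent polynomial in the other variables.\<close>

definition xy_coeff :: "nat \<Rightarrow> int \<Rightarrow> int \<Rightarrow> lpoly \<Rightarrow> lpoly" where
  "xy_coeff j i l p =
     (\<Sum>m | m \<in> Poly_Mapping.keys p \<and>
            Poly_Mapping.lookup m (XVar j) = i \<and> Poly_Mapping.lookup m (YVar j) = l.
        Poly_Mapping.single
          (m - Poly_Mapping.single (XVar j) i - Poly_Mapping.single (YVar j) l)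
          (Poly_Mapping.lookup p m))"

text \<open>
  The exponent vector of \<open>reg(p)\<close> for homogeneous \<open>p\<close> in \<open>\<L>\<^sub>j\<close>. If \<open>p\<close> already lies in
  \<open>\<L>\<^sub>j\<close>, the steps for larger indices contribute exponent 0, so the result does not depend on
  which of the rings containing \<open>p\<close> is used.
\<close>

primrec reg_expo :: "nat \<Rightarrow> lpoly \<Rightarrow> expo" where
  "reg_expo 0 p = 0"
| "reg_expo (Suc j) p =
     (let d = pdeg p (Suc j);
          q = (\<lambda>i. xy_coeff (Suc j) i (d - i) p);
          n0 = Min {i. q i \<noteq> 0};
          n1 = Max {i. q i \<noteq> 0}
      in Poly_Mapping.single (XVar (Suc j)) n0 + Poly_Mapping.single (YVar (Suc j)) (d - n1)
         + reg_expo j (q n0))"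

definition reg :: "nat \<Rightarrow> lpoly \<Rightarrow> lpoly" where
  "reg j p = monom (reg_expo j p)"

text \<open>\<open>reg(p)\<close> is a unit; division by it is multiplication with the inverse monomial.\<close>

definition div_reg :: "nat \<Rightarrow> lpoly \<Rightarrow> lpoly" where
  "div_reg j p = p * monom (- reg_expo j p)"

lemma div_reg_times_reg: "div_reg j p * reg j p = p"
  by (simp add: div_reg_def reg_def monom_def mult.assoc mult_single)

primrec dd_seq :: "nat \<Rightarrow> lpoly \<Rightarrow> nat \<Rightarrow> lpoly" where
  "dd_seq n p 0 = p"
| "dd_seq n p (Suc k) =
     (if deriv_op n (dd_seq n p k) = 0 then 0 else div_reg n (deriv_op n (dd_seq n p k)))"

definition DD_of :: "nat \<Rightarrow> lpoly \<Rightarrow> nat" where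
  "DD_of n p = (LEAST k. dd_seq n p k \<in> laurent n 0)"

definition dd_start :: "nat \<Rightarrow> lpoly" where
  "dd_start n = const (Delta n) *
     (\<Sum>j = 1..n. const (Delta j - Delta (j - 1)) *
        (\<Prod>i = 1..<j. varpow (XVar i) 1) * (\<Prod>i = j..<n. varpow (YVar i) 1))"

definition DD :: "nat \<Rightarrow> nat" where
  "DD n = DD_of n (dd_start n)"

section \<open>Real-analytic functions and Chebyshev systems\<close>

text \<open>
  Multi-indices are extensional functions on the orthonormal basis \<open>Basis\<close>; \<open>has_sum\<close> is
  unconditional (equivalently, for real series, absolute) convergence of the power series.
  As for the library's \<open>analytic_on\<close>, \<open>f\<close> is a total function of which only the values near
  points of \<open>S\<close> matter; for open \<open>S\<close> only the values on \<open>S\<close> matter.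
\<close>

definition real_analytic_on :: "('a::euclidean_space \<Rightarrow> real) \<Rightarrow> 'a set \<Rightarrow> bool"
  (infixl \<open>real'_analytic'_on\<close> 50) where
  "f real_analytic_on S \<longleftrightarrow>
     (\<forall>p\<in>S. \<exists>(c :: ('a \<Rightarrow> nat) \<Rightarrow> real) \<epsilon>. 0 < \<epsilon> \<and>
        (\<forall>x \<in> ball p \<epsilon>.
           ((\<lambda>\<alpha>. c \<alpha> * (\<Prod>b\<in>Basis. ((x - p) \<bullet> b) ^ \<alpha> b)) has_sum f x)
             (Basis \<rightarrow>\<^sub>E UNIV)))"

definition chebyshev_system :: "nat \<Rightarrow> (nat \<Rightarrow> real \<Rightarrow> real) \<Rightarrow> real set \<Rightarrow> bool" where
  "chebyshev_system m u I \<longleftrightarrow>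
     (\<forall>c :: nat \<Rightarrow> real. (\<exists>k<m. c k \<noteq> 0) \<longrightarrow>
        finite {x \<in> I. (\<Sum>k<m. c k * u k x) = 0} \<and>
        card {x \<in> I. (\<Sum>k<m. c k * u k x) = 0} \<le> m - 1)"

section \<open>Compositions of translated powers\<close>

text \<open>
  A point of \<open>\<real>\<^sup>n\<close> is a vector in \<open>real ^ 'n\<close> together with an enumeration \<open>e\<close> of the index type:
  the \<open>i\<close>-th coordinate of \<open>a\<close>, for \<open>1 \<le> i \<le> n\<close>, is \<open>a $ e i\<close>.

  Real powers are only used with their usual meaning: \<open>g_iter e a r x (Suc i)\<close> is considered only
  where \<open>g_iter e a r x i\<close> is positive, which is also what makes it defined.
\<close>

primrec g_iter ::
  "(nat \<Rightarrow> 'n::finite) \<Rightarrow> real ^ 'n \<Rightarrow> real ^ 'n \<Rightarrow> real \<Rightarrow> nat \<Rightarrow> real" where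
  "g_iter e a r x 0 = x"
| "g_iter e a r x (Suc i) = a $ e (Suc i) + g_iter e a r x i powr (r $ e (Suc i))"

definition dom_I :: "(nat \<Rightarrow> 'n::finite) \<Rightarrow> real ^ 'n \<Rightarrow> real ^ 'n \<Rightarrow> real set" where
  "dom_I e a r = {x. \<forall>i \<le> CARD('n). 0 < g_iter e a r x i}"

definition phi :: "(nat \<Rightarrow> 'n::finite) \<Rightarrow> real ^ 'n \<Rightarrow> real ^ 'n \<Rightarrow> real \<Rightarrow> real" where
  "phi e a r x = g_iter e a r x CARD('n) - x"

definition U_set :: "(nat \<Rightarrow> 'n::finite) \<Rightarrow> ((real ^ 'n) \<times> (real ^ 'n)) set" where
  "U_set e = {(a, r). dom_I e a r \<noteq> {}}"

definition V_set :: "(nat \<Rightarrow> 'n::finite) \<Rightarrow> ((real ^ 'n) \<times> (real ^ 'n) \<times> real) set" where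
  "V_set e = {(a, r, x). (a, r) \<in> U_set e \<and> x \<in> dom_I e a r}"

end

theory Submission
  imports Defs "HOL-Complex_Analysis.Complex_Analysis"
begin

text \<open>
  Substituting \<open>g\<^sub>j - a\<^sub>j\<close> for \<open>x\<^sub>j\<close>, \<open>g\<^sub>j\<close> for \<open>y\<^sub>j\<close> and \<open>r\<^sub>i\<close> for \<open>R\<^sub>i\<close> turns \<open>\<partial>\<close> into \<open>x d/dx\<close>,
  and \<open>\<phi>''\<close> into a positive monomial times the starting polynomial of the derivation-division
  sequence. Hence \<open>\<phi>\<close> is reduced to a function of \<open>r\<close> alone by \<open>DD(n) + 2\<close> differentiations, each
  followed by division by a positive analytic weight. Undoing these steps by iterated integration
  from an analytic base point expresses \<open>\<phi>\<close> through iterated integrals of positive weights, which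
  form a Chebyshev system by Rolle's theorem. The base point is the zero of
  \<open>\<Sum>\<^sub>i \<Delta>\<^sub>i(r) ln g\<^sub>i\<close>, which increases from \<open>-\<infinity>\<close> to \<open>\<infinity>\<close> on \<open>I(a,r)\<close>. The derivation-division sequence ends
  because the multidegree of its regularized terms decreases lexicographically.

  Analyticity is handled through bounded complex extensions that are holomorphic along every
  holomorphic curve: this property is stable under composition and uniform limits, and
  implies the expansion in a power series.
\<close>

section \<open>Functions holomorphic along all holomorphic curves\<close>

text \<open>The coefficients must be analytic on all of U at once, so the integrations need a base
  point that is a global analytic section of the intervals I(a,r); local choices would have to be
  patched. The zero of \<open>balance\<close> is canonical: it is unique in each interval, and since
  the derivative does not vanish there, an implicit function theorem makes it analytic in (a,r).
  Complex extensions enter because uniform limits, such as series of primitives or fixed-point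
  iterations, preserve holomorphy, whereas uniform limits of real analytic functions need not be
  analytic. The count m = DD(n) + 3: phi, phi' and the terms p^(0), ..., p^(DD(n)) of the
  derivation-division sequence are DD(n) + 3 functions. The last one is free of x, so the expansion
  has no remainder, and the values of all of them at the base point are the coefficients.\<close>

definition polydisc :: "'b set \<Rightarrow> ('b \<Rightarrow> complex) \<Rightarrow> real \<Rightarrow> ('b \<Rightarrow> complex) set" where
  "polydisc B p R = {z. \<forall>b\<in>B. norm (z b - p b) < R}"

text \<open>Holomorphy is tested on curves only, so that composing extensions amounts to composing
  curves. The coordinates of \<open>\<gamma>\<close> outside \<open>B\<close> are unrestricted,
  which forces \<open>h\<close> to ignore them.\<close>

definition curve_hol ::
  "'b set \<Rightarrow> ('b \<Rightarrow> complex) \<Rightarrow> real \<Rightarrow> (('b \<Rightarrow> complex) \<Rightarrow> complex) \<Rightarrow> bool" where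
  "curve_hol B p R h \<longleftrightarrow>
     (\<forall>\<gamma> S. open S \<longrightarrow> (\<forall>b\<in>B. (\<lambda>t. \<gamma> t b) holomorphic_on S) \<longrightarrow>
        (\<forall>t\<in>S. \<gamma> t \<in> polydisc B p R) \<longrightarrow> (\<lambda>t. h (\<gamma> t)) holomorphic_on S)"

lemma curve_holD:
  assumes "curve_hol B p R h" "open S" "\<And>b. b \<in> B \<Longrightarrow> (\<lambda>t. \<gamma> t b) holomorphic_on S"
    "\<And>t. t \<in> S \<Longrightarrow> \<gamma> t \<in> polydisc B p R"
  shows "(\<lambda>t. h (\<gamma> t)) holomorphic_on S"
  using assms unfolding curve_hol_def by blast

lemma curve_holI:
  assumes "\<And>\<gamma> S. open S \<Longrightarrow> (\<And>b. b \<in> B \<Longrightarrow> (\<lambda>t. \<gamma> t b) holomorphic_on S) \<Longrightarrow>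
    (\<And>t. t \<in> S \<Longrightarrow> \<gamma> t \<in> polydisc B p R) \<Longrightarrow> (\<lambda>t. h (\<gamma> t)) holomorphic_on S"
  shows "curve_hol B p R h"
  using assms unfolding curve_hol_def by blast

lemma curve_hol_subset:
  assumes "curve_hol B p R h" "polydisc B q \<sigma> \<subseteq> polydisc B p R"
  shows "curve_hol B q \<sigma> h"
  using assms unfolding curve_hol_def by blast

lemma polydisc_mono: "\<sigma> \<le> R \<Longrightarrow> polydisc B p \<sigma> \<subseteq> polydisc B p R"
  unfolding polydisc_def by force

lemma holomorphic_uniform_limit_open:
  assumes "open S" "\<And>n. f n holomorphic_on S" "uniform_limit S f g sequentially"
  shows "g holomorphic_on S"
proof (rule holomorphic_uniform_sequence[OF assms(1,2)])
  fix x assume "x \<in> S"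
  then obtain d where "d > 0" "cball x d \<subseteq> S"
    using assms(1) open_contains_cball by blast
  then show "\<exists>d>0. cball x d \<subseteq> S \<and> uniform_limit (cball x d) f g sequentially"
    using uniform_limit_on_subset[OF assms(3)] by blast
qed

lemma curve_hol_uniform_limit:
  assumes "\<And>n::nat. curve_hol B p R (f n)"
    "uniform_limit (polydisc B p R) f g sequentially"
  shows "curve_hol B p R g"
proof (rule curve_holI)
  fix \<gamma> S assume S: "open S" "\<And>b. b \<in> B \<Longrightarrow> (\<lambda>t. \<gamma> t b) holomorphic_on S"
    "\<And>t. t \<in> S \<Longrightarrow> \<gamma> t \<in> polydisc B p R"
  have "uniform_limit S (\<lambda>n t. f n (\<gamma> t)) (\<lambda>t. g (\<gamma> t)) sequentially"
    using assms(2) S(3) unfolding uniform_limit_iff by (fast elim: eventually_mono)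
  then show "(\<lambda>t. g (\<gamma> t)) holomorphic_on S"
    by (rule holomorphic_uniform_limit_open[OF S(1), rotated]) (rule curve_holD[OF assms(1) S])
qed

lemma curve_hol_slice:
  assumes "curve_hol B p R h" "z \<in> polydisc B p R"
  shows "(\<lambda>s. h (z(b := s))) holomorphic_on ball (p b) R"
proof (rule curve_holD[OF assms(1) open_ball])
  show "(\<lambda>s. (z(b := s)) c) holomorphic_on ball (p b) R" for c
    by (cases "c = b") auto
qed (use assms(2) in \<open>auto simp: polydisc_def dist_norm norm_minus_commute\<close>)

section \<open>Cauchy estimates whose constants depend only on the bound and the radius\<close>

lemma bounded_deriv_bound:
  fixes f :: "complex \<Rightarrow> complex"
  assumes "f holomorphic_on ball a R" "\<And>t. t \<in> ball a R \<Longrightarrow> norm (f t) \<le> M" "0 < R"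
    "s \<in> ball a (R/2)"
  shows "norm (deriv f s) \<le> 4 * M / R"
proof -
  have sub: "cball s (R/4) \<subseteq> ball a R"
  proof
    fix x assume "x \<in> cball s (R/4)"
    then have "dist a x \<le> dist a s + dist s x" "dist s x \<le> R/4"
      by (auto intro: dist_triangle)
    then show "x \<in> ball a R" using assms(3,4) by auto
  qed
  have "norm ((deriv ^^ 1) f s) \<le> fact 1 * M / (R/4)^1"
  proof (rule Cauchy_inequality)
    show "f holomorphic_on ball s (R/4)"
      using assms(1) sub ball_subset_cball holomorphic_on_subset by blast
    show "continuous_on (cball s (R/4)) f"
      using assms(1) sub holomorphic_on_imp_continuous_on continuous_on_subset by blast
    show "norm (f x) \<le> M" if "norm (s - x) = R/4" for x
      by (rule assms(2)) (use sub that in \<open>auto simp: dist_norm subset_iff\<close>)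
  qed (use assms in auto)
  then show ?thesis by (simp add: field_simps)
qed

lemma bounded_holomorphic_lipschitz:
  fixes f :: "complex \<Rightarrow> complex"
  assumes "f holomorphic_on ball a R" "\<And>t. t \<in> ball a R \<Longrightarrow> norm (f t) \<le> M" "0 < R"
    "s \<in> ball a (R/2)" "t \<in> ball a (R/2)"
  shows "norm (f s - f t) \<le> 4 * M / R * norm (s - t)"
proof (rule field_differentiable_bound[where S = "ball a (R/2)" and f' = "deriv f"])
  show "(f has_field_derivative deriv f z) (at z within ball a (R/2))" if "z \<in> ball a (R/2)" for z
  proof -
    have "z \<in> ball a R" using that assms(3) by auto
    then show ?thesis
      using assms(1) has_field_derivative_at_within holomorphic_derivI open_ball by blast
  qed
  show "norm (deriv f z) \<le> 4 * M / R" if "z \<in> ball a (R/2)" for z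
    using bounded_deriv_bound[OF assms(1,2,3) that] by simp
qed (use assms in auto)

text \<open>Cauchy's estimate makes \<open>deriv f\<close> Lipschitz near 0 with constant
  \<open>4 * (4 * M / R) / (R/2)\<close>, and the mean value inequality for \<open>f\<close> minus
  its linear part carries this over to the quotient. Only \<open>M\<close> and \<open>R\<close>
  enter, so difference quotients converge uniformly over a family of functions with a common
  bound.\<close>

lemma difference_quotient_bound:
  fixes f :: "complex \<Rightarrow> complex"
  assumes f: "f holomorphic_on ball 0 R" "\<And>t. t \<in> ball 0 R \<Longrightarrow> norm (f t) \<le> M" and "0 < R"
    and s: "norm s < R/4" "s \<noteq> 0"
  shows "norm ((f s - f 0) / s - deriv f 0) \<le> 32 * M / R\<^sup>2 * norm s"
proof -
  have d: "deriv f holomorphic_on ball 0 (R/2)"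
    using f(1) assms(3) by (intro holomorphic_deriv holomorphic_on_subset[OF f(1)]) auto
  have M0: "0 \<le> M"
    using order_trans[OF norm_ge_zero f(2)[of 0]] assms(3) by simp
  define g where "g z = f z - z * deriv f 0" for z
  have "norm (g s - g 0) \<le> (32 * M / R\<^sup>2 * norm s) * norm (s - 0)"
  proof (rule field_differentiable_bound[where S = "cball 0 (norm s)" and f' = "\<lambda>z::complex. deriv f z - deriv f 0"])
    fix z :: complex assume z: "z \<in> cball 0 (norm s)"
    then have z': "z \<in> ball 0 (R/2/2)" using s by auto
    then have "z \<in> ball 0 R" using assms(3) by auto
    then have "(f has_field_derivative deriv f z) (at z within cball 0 (norm s))"
      using f(1) has_field_derivative_at_within holomorphic_derivI open_ball by blast
    then show "(g has_field_derivative deriv f z - deriv f 0) (at z within cball 0 (norm s))"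
      unfolding g_def by (auto intro!: derivative_eq_intros)
    have "norm (deriv f z - deriv f 0) \<le> 4 * (4 * M / R) / (R/2) * norm (z - 0)"
      by (rule bounded_holomorphic_lipschitz[OF d])
        (use z' assms(3) in \<open>auto intro: bounded_deriv_bound[OF f]\<close>)
    also have "\<dots> = 32 * M / R\<^sup>2 * norm z" by (simp add: field_simps power2_eq_square)
    also have "\<dots> \<le> 32 * M / R\<^sup>2 * norm s"
      using z M0 by (intro mult_left_mono) auto
    finally show "norm (deriv f z - deriv f 0) \<le> 32 * M / R\<^sup>2 * norm s" .
  qed auto
  moreover have "(f s - f 0) / s - deriv f 0 = (g s - g 0) / s"
    using s(2) by (simp add: g_def diff_divide_distrib)
  ultimately show ?thesis
    using s(2) by (simp only: norm_divide) (simp add: field_simps)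
qed

definition cderiv :: "'b \<Rightarrow> (('b \<Rightarrow> complex) \<Rightarrow> complex) \<Rightarrow> ('b \<Rightarrow> complex) \<Rightarrow> complex" where
  "cderiv b h z = deriv (\<lambda>s. h (z(b := s))) (z b)"

lemma deriv_shift: "deriv (\<lambda>s. f (c + s)) 0 = deriv f (c :: complex)"
proof -
  have "(\<lambda>y. ((\<lambda>s. f (c + s)) has_field_derivative y) (at 0)) = (\<lambda>y. (f has_field_derivative y) (at c))"
    using DERIV_at_within_shift[of f _ c 0 UNIV] by (auto simp: add.commute)
  then show ?thesis by (simp add: deriv_def)
qed

text \<open>Shifting coordinate \<open>b\<close> of a curve by a constant gives another curve, so
  each difference quotient is holomorphic along \<open>\<gamma>\<close>; by
  \<open>difference_quotient_bound\<close> the quotients converge uniformly near every parameter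
  \<open>t0\<close>.\<close>

lemma curve_hol_cderiv:
  assumes h: "curve_hol B p R h" and M: "\<And>z. z \<in> polydisc B p R \<Longrightarrow> norm (h z) \<le> M"
    and b: "b \<in> B"
  shows "curve_hol B p R (cderiv b h)"
proof (rule curve_holI)
  fix \<gamma> S assume S: "open S" "\<And>b. b \<in> B \<Longrightarrow> (\<lambda>t. \<gamma> t b) holomorphic_on S"
    "\<And>t. t \<in> S \<Longrightarrow> \<gamma> t \<in> polydisc B p R"
  have "(\<lambda>t. cderiv b h (\<gamma> t)) field_differentiable at t0" if t0: "t0 \<in> S" for t0
  proof -
    \<comment> \<open>Half the room left at \<open>t0\<close>: on the neighbourhood
      \<open>S'\<close> below, coordinate \<open>b\<close> may be shifted by anything smaller than
      \<open>r\<close>.\<close>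
    define r where "r = (R - norm (\<gamma> t0 b - p b)) / 2"
    have r: "r > 0" using S(3)[OF t0] b by (auto simp: r_def polydisc_def)
    have c: "continuous_on S (\<lambda>t. \<gamma> t b)"
      using S(2)[OF b] holomorphic_on_imp_continuous_on by blast
    define S' where "S' = {t\<in>S. norm (\<gamma> t b - p b) < R - r}"
    have "open S'"
    proof -
      have "S' = S \<inter> (\<lambda>t. \<gamma> t b) -` ball (p b) (R - r)"
        by (auto simp: S'_def dist_norm norm_minus_commute)
      then show ?thesis
        using continuous_open_preimage[OF c S(1)] by simp
    qed
    have "t0 \<in> S'" using t0 r by (auto simp: S'_def r_def field_simps)
    have poly: "(\<gamma> t)(b := \<gamma> t b + s) \<in> polydisc B p R" if "t \<in> S'" "norm s < r" for t s
    proof -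
      have "norm (\<gamma> t b + s - p b) \<le> norm (\<gamma> t b - p b) + norm s"
        by (metis add_diff_eq add.commute diff_add_eq norm_triangle_ineq)
      then show ?thesis using that S(3)[of t] by (auto simp: S'_def polydisc_def)
    qed
    \<comment> \<open>The summand 5 keeps every \<open>norm (s n)\<close> below
      \<open>r / 4\<close>, the range covered by \<open>difference_quotient_bound\<close>.\<close>
    define s where "s n = complex_of_real (r / (real n + 5))" for n :: nat
    have s: "norm (s n) < r / 4" "s n \<noteq> 0" for n
    proof -
      have "norm (s n) = r / (real n + 5)"
        unfolding s_def norm_of_real using r by simp
      moreover have "r / (real n + 5) < r / 4"
        using r by (intro divide_strict_left_mono) auto
      moreover have "r / (real n + 5) \<noteq> 0"
        using r by auto
      ultimately show "norm (s n) < r / 4" "s n \<noteq> 0" by auto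
    qed
    have lim: "s \<longlonglongrightarrow> 0"
    proof -
      have "(\<lambda>n. r / (real n + 5)) \<longlonglongrightarrow> 0"
        by (rule real_tendsto_divide_at_top[OF tendsto_const],
            rule filterlim_at_top_mono[OF filterlim_real_sequentially]) auto
      then have "(\<lambda>n. complex_of_real (r / (real n + 5))) \<longlonglongrightarrow> of_real 0"
        by (rule tendsto_of_real)
      moreover have "s = (\<lambda>n. complex_of_real (r / (real n + 5)))"
        by (rule ext) (simp only: s_def)
      ultimately show ?thesis by (simp only: of_real_0)
    qed
    have "(\<lambda>t. cderiv b h (\<gamma> t)) holomorphic_on S'"
    proof (rule holomorphic_uniform_limit_open[OF \<open>open S'\<close>,
          where f = "\<lambda>n t. (h ((\<gamma> t)(b := \<gamma> t b + s n)) - h (\<gamma> t)) / s n"])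
      show "(\<lambda>t. (h ((\<gamma> t)(b := \<gamma> t b + s n)) - h (\<gamma> t)) / s n) holomorphic_on S'" for n
      proof (rule holomorphic_on_divide[OF holomorphic_on_diff holomorphic_on_const];
          (rule curve_holD[OF h \<open>open S'\<close>])?)
        show "(\<lambda>t. ((\<gamma> t)(b := \<gamma> t b + s n)) c) holomorphic_on S'" if "c \<in> B" for c
          using S(2)[OF that] holomorphic_on_subset[of _ S S']
          by (cases "c = b") (auto intro!: holomorphic_intros simp: S'_def)
        show "(\<lambda>t. \<gamma> t c) holomorphic_on S'" if "c \<in> B" for c
          using S(2)[OF that] holomorphic_on_subset[of _ S S'] by (auto simp: S'_def)
        show "(\<gamma> t)(b := \<gamma> t b + s n) \<in> polydisc B p R" if "t \<in> S'" for t
          using poly[OF that, of "s n"] s[of n] r by simp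
        show "\<gamma> t \<in> polydisc B p R" if "t \<in> S'" for t
          using S(3) that by (auto simp: S'_def)
        show "s n \<noteq> 0" by (rule s)
      qed
      show "uniform_limit S' (\<lambda>n t. (h ((\<gamma> t)(b := \<gamma> t b + s n)) - h (\<gamma> t)) / s n)
         (\<lambda>t. cderiv b h (\<gamma> t)) sequentially"
      proof (rule uniform_limitI)
        fix e :: real assume "e > 0"
        have "(\<lambda>n. 32 * M / r\<^sup>2 * norm (s n)) \<longlonglongrightarrow> 32 * M / r\<^sup>2 * norm (0::complex)"
          by (intro tendsto_intros lim)
        then have "\<forall>\<^sub>F n in sequentially. 32 * M / r\<^sup>2 * norm (s n) < e"
          using \<open>e > 0\<close> by (auto dest!: order_tendstoD(2)[where a = e])
        then show "\<forall>\<^sub>F n in sequentially. \<forall>t\<in>S'.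
            dist ((h ((\<gamma> t)(b := \<gamma> t b + s n)) - h (\<gamma> t)) / s n) (cderiv b h (\<gamma> t)) < e"
        proof (eventually_elim, intro ballI)
          fix n t assume n: "32 * M / r\<^sup>2 * norm (s n) < e" and t: "t \<in> S'"
          define f where "f u = h ((\<gamma> t)(b := \<gamma> t b + u))" for u
          have "norm ((f (s n) - f 0) / s n - deriv f 0) \<le> 32 * M / r\<^sup>2 * norm (s n)"
          proof (rule difference_quotient_bound)
            show "f holomorphic_on ball 0 r"
              unfolding f_def
            proof (rule curve_holD[OF h open_ball])
              show "(\<lambda>u. ((\<gamma> t)(b := \<gamma> t b + u)) c) holomorphic_on ball 0 r" for c
                by (cases "c = b") (auto intro!: holomorphic_intros)
            qed (use t in \<open>auto intro!: poly\<close>)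
            show "norm (f u) \<le> M" if "u \<in> ball 0 r" for u
              unfolding f_def using M poly[OF t] that by auto
          qed (use r s in auto)
          moreover have "deriv f 0 = cderiv b h (\<gamma> t)"
            unfolding f_def cderiv_def by (rule deriv_shift)
          ultimately show "dist ((h ((\<gamma> t)(b := \<gamma> t b + s n)) - h (\<gamma> t)) / s n) (cderiv b h (\<gamma> t)) < e"
            using n by (simp add: f_def dist_norm)
        qed
      qed
    qed
    then show ?thesis
      using \<open>open S'\<close> \<open>t0 \<in> S'\<close> holomorphic_on_imp_differentiable_at by blast
  qed
  then show "(\<lambda>t. cderiv b h (\<gamma> t)) holomorphic_on S"
    by (auto simp: holomorphic_on_def field_differentiable_at_within)
qed

lemma bounded_cderiv:
  assumes h: "curve_hol B p R h" and M: "\<And>z. z \<in> polydisc B p R \<Longrightarrow> norm (h z) \<le> M"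
    and "r < R" and z: "z \<in> polydisc B p r" and b: "b \<in> B"
  shows "norm (cderiv b h z) \<le> 2 * M / (R - r)"
proof -
  have z': "z \<in> polydisc B p R" using z polydisc_mono[of r R B p] assms(3) by auto
  have sub: "cball (z b) ((R - r)/2) \<subseteq> ball (p b) R"
  proof
    fix x assume "x \<in> cball (z b) ((R - r)/2)"
    then have "dist (p b) x \<le> dist (p b) (z b) + dist (z b) x" "dist (z b) x \<le> (R - r)/2"
      by (auto intro: dist_triangle)
    moreover have "dist (p b) (z b) < r"
      using z b by (auto simp: polydisc_def dist_norm norm_minus_commute)
    ultimately show "x \<in> ball (p b) R" using assms(3) by (auto simp: field_simps)
  qed
  have hol: "(\<lambda>s. h (z(b := s))) holomorphic_on ball (p b) R"
    by (rule curve_hol_slice[OF h z'])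
  have "norm ((deriv ^^ 1) (\<lambda>s. h (z(b := s))) (z b)) \<le> fact 1 * M / ((R - r)/2)^1"
  proof (rule Cauchy_inequality)
    show "(\<lambda>s. h (z(b := s))) holomorphic_on ball (z b) ((R - r)/2)"
      by (rule holomorphic_on_subset[OF hol]) (use sub ball_subset_cball in blast)
    show "continuous_on (cball (z b) ((R - r)/2)) (\<lambda>s. h (z(b := s)))"
      using holomorphic_on_imp_continuous_on[OF holomorphic_on_subset[OF hol sub]] .
    show "norm (h (z(b := x))) \<le> M" if "norm (z b - x) = (R - r)/2" for x
    proof (rule M)
      have "x \<in> cball (z b) ((R - r)/2)" using that by (simp add: dist_norm)
      then have "x \<in> ball (p b) R" using sub by blast
      then show "z(b := x) \<in> polydisc B p R"
        using z' by (auto simp: polydisc_def dist_norm norm_minus_commute)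
    qed
  qed (use assms(3) in auto)
  then show ?thesis by (simp add: cderiv_def field_simps)
qed

text \<open>Restrict \<open>h\<close> to the complex line through \<open>p\<close> and
  \<open>z\<close>. Scaled so that \<open>z\<close> is reached at parameter \<open>d\<close>, it has
  slope at most 1 in each coordinate and maps the disc of radius \<open>R\<close> into the polydisc,
  so the one-variable Lipschitz bound applies, whatever the dimension.\<close>

lemma bounded_curve_hol_continuous:
  assumes h: "curve_hol B p R h" and M: "\<And>z. z \<in> polydisc B p R \<Longrightarrow> norm (h z) \<le> M"
    and "0 < d" "d < R/2" and z: "z \<in> polydisc B p d"
  shows "norm (h z - h p) \<le> 4 * M / R * d"
proof -
  define \<gamma> where "\<gamma> t = (\<lambda>b. p b + t * ((z b - p b) / d))" for t :: complex
  have poly: "\<gamma> t \<in> polydisc B p R" if "t \<in> ball 0 R" for t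
  proof -
    have "norm (t * ((z b - p b) / d)) < R" if "b \<in> B" for b
    proof -
      have "norm (z b - p b) / d \<le> 1" using z that assms(3) by (auto simp: polydisc_def)
      then have "norm t * (norm (z b - p b) / d) \<le> norm t * 1"
        by (intro mult_left_mono) auto
      then show ?thesis using \<open>t \<in> ball 0 R\<close> assms(3) by (simp add: norm_mult norm_divide)
    qed
    then show ?thesis by (simp add: polydisc_def \<gamma>_def)
  qed
  have "norm (h (\<gamma> d) - h (\<gamma> 0)) \<le> 4 * M / R * norm (complex_of_real d - 0)"
  proof (rule bounded_holomorphic_lipschitz[where f = "\<lambda>t. h (\<gamma> t)" and a = 0])
    show "(\<lambda>t. h (\<gamma> t)) holomorphic_on ball 0 R"
    proof (rule curve_holD[OF h open_ball])
      show "(\<lambda>t. \<gamma> t b) holomorphic_on ball 0 R" for b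
        unfolding \<gamma>_def using assms(3) by (auto intro!: holomorphic_intros)
    qed (fact poly)
    show "norm (h (\<gamma> t)) \<le> M" if "t \<in> ball 0 R" for t using M poly that by blast
  qed (use assms in auto)
  moreover have "\<gamma> d = z" "\<gamma> 0 = p" using assms(3) by (auto simp: \<gamma>_def)
  ultimately show ?thesis using assms(3) by simp
qed


section \<open>Taylor coefficients in one coordinate, and the power series in all
  coordinates\<close>

lemma funpow_cderiv_eq: "(cderiv b ^^ k) h (z(b := s)) = (deriv ^^ k) (\<lambda>s. h (z(b := s))) s"
proof (induction k arbitrary: s)
  case (Suc k)
  have "(cderiv b ^^ Suc k) h (z(b := s)) = deriv (\<lambda>u. (cderiv b ^^ k) h (z(b := u))) s"
    by (simp add: cderiv_def)
  then show ?case by (simp only: Suc) simp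
qed simp

text \<open>A derivative is known to be bounded only on a smaller polydisc; inserting a midpoint
  radius at each step leaves room for any number of derivatives.\<close>

lemma funpow_cderiv:
  assumes h: "curve_hol B p R h" and M: "\<And>z. z \<in> polydisc B p R \<Longrightarrow> norm (h z) \<le> M"
    and b: "b \<in> B"
  shows "r < R \<Longrightarrow> curve_hol B p r ((cderiv b ^^ k) h) \<and>
    (\<exists>M. \<forall>z\<in>polydisc B p r. norm ((cderiv b ^^ k) h z) \<le> M)"
proof (induction k arbitrary: r)
  case 0
  then have sub: "polydisc B p r \<subseteq> polydisc B p R" by (intro polydisc_mono) simp
  have "\<forall>z\<in>polydisc B p r. norm (h z) \<le> M" using sub M by blast
  then show ?case using curve_hol_subset[OF h sub]
    by (intro conjI exI[of _ M]) simp_all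
next
  case (Suc k)
  define t where "t = (r + R) / 2"
  have t: "r < t" "t < R" using Suc.prems by (auto simp: t_def)
  obtain M' where h': "curve_hol B p t ((cderiv b ^^ k) h)"
    and M': "\<And>z. z \<in> polydisc B p t \<Longrightarrow> norm ((cderiv b ^^ k) h z) \<le> M'"
    using Suc.IH[OF t(2)] by blast
  have "curve_hol B p t ((cderiv b ^^ Suc k) h)"
    using curve_hol_cderiv[OF h' M' b] by simp
  then have "curve_hol B p r ((cderiv b ^^ Suc k) h)"
    by (rule curve_hol_subset[OF _ polydisc_mono[OF less_imp_le[OF t(1)]]])
  moreover have "\<forall>z\<in>polydisc B p r. norm ((cderiv b ^^ Suc k) h z) \<le> 2 * M' / (t - r)"
    using bounded_cderiv[OF h' M' t(1) _ b] by simp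
  ultimately show ?case by blast
qed

definition slice_coeff ::
  "'b \<Rightarrow> complex \<Rightarrow> nat \<Rightarrow> (('b \<Rightarrow> complex) \<Rightarrow> complex) \<Rightarrow> ('b \<Rightarrow> complex) \<Rightarrow> complex" where
  "slice_coeff b a k h z = (deriv ^^ k) (\<lambda>s. h (z(b := s))) a / fact k"

text \<open>Up to a factorial the coefficient is an iterated \<open>cderiv\<close> restricted to the
  hyperplane \<open>z b = p b\<close>; a curve in the other coordinates is completed by the constant
  \<open>p b\<close>.\<close>

lemma curve_hol_slice_coeff:
  assumes h: "curve_hol B p R h" and M: "\<And>z. z \<in> polydisc B p R \<Longrightarrow> norm (h z) \<le> M"
    and b: "b \<in> B" and r: "0 < r" "r < R"
  shows "curve_hol (B - {b}) p r (slice_coeff b (p b) k h)"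
proof (rule curve_holI)
  fix \<gamma> S assume S: "open S" "\<And>c. c \<in> B - {b} \<Longrightarrow> (\<lambda>t. \<gamma> t c) holomorphic_on S"
    "\<And>t. t \<in> S \<Longrightarrow> \<gamma> t \<in> polydisc (B - {b}) p r"
  have "(\<lambda>t. (cderiv b ^^ k) h ((\<gamma> t)(b := p b))) holomorphic_on S"
  proof (rule curve_holD[OF conjunct1[OF funpow_cderiv[OF h M b r(2)]] S(1)])
    show "(\<lambda>t. ((\<gamma> t)(b := p b)) c) holomorphic_on S" if "c \<in> B" for c
      using S(2)[of c] that by (cases "c = b") auto
  qed (use S r in \<open>auto simp: polydisc_def\<close>)
  then show "(\<lambda>t. slice_coeff b (p b) k h (\<gamma> t)) holomorphic_on S"
    unfolding slice_coeff_def funpow_cderiv_eq by (rule holomorphic_intros) auto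
qed

lemma slice_coeff_bound:
  assumes h: "curve_hol B p R h" and M: "\<And>z. z \<in> polydisc B p R \<Longrightarrow> norm (h z) \<le> M"
    and R: "0 < r" "r < R" and z: "z(b := p b) \<in> polydisc B p R"
  shows "norm (slice_coeff b (p b) k h z) \<le> M / r ^ k"
proof -
  have hol: "(\<lambda>s. h (z(b := s))) holomorphic_on ball (p b) R"
    using curve_hol_slice[OF h z, of b] by simp
  have "norm ((deriv ^^ k) (\<lambda>s. h (z(b := s))) (p b)) \<le> fact k * M / r^k"
  proof (rule Cauchy_inequality)
    show "(\<lambda>s. h (z(b := s))) holomorphic_on ball (p b) r"
      by (rule holomorphic_on_subset[OF hol]) (use R in auto)
    show "continuous_on (cball (p b) r) (\<lambda>s. h (z(b := s)))"
      by (rule holomorphic_on_imp_continuous_on[OF holomorphic_on_subset[OF hol]]) (use R in auto)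
    show "norm (h (z(b := x))) \<le> M" if "norm (p b - x) = r" for x
      by (rule M) (use z that R in \<open>auto simp: polydisc_def norm_minus_commute\<close>)
  qed (use R in auto)
  then show ?thesis by (simp add: slice_coeff_def norm_divide field_simps)
qed

lemma slice_coeff_sums:
  assumes h: "curve_hol B p R h" and z: "z \<in> polydisc B p R" and b: "b \<in> B"
  shows "(\<lambda>k. slice_coeff b (p b) k h z * (z b - p b) ^ k) sums h z"
proof -
  have "z b \<in> ball (p b) R"
    using z b by (auto simp: polydisc_def dist_norm norm_minus_commute)
  from holomorphic_power_series[OF curve_hol_slice[OF h z] this]
  show ?thesis by (simp add: slice_coeff_def)
qed

text \<open>With no coordinate to control, even the curve that jumps from \<open>w\<close> to
  \<open>z\<close> at parameter 0 is admissible, and continuity of \<open>h\<close> along it forces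
  the two values to agree.\<close>

lemma curve_hol_empty:
  assumes "curve_hol {} p R h"
  shows "h z = h w"
proof -
  define g where "g t = h (if t = 0 then z else w)" for t :: complex
  have "g holomorphic_on UNIV"
    unfolding g_def by (rule curve_holD[OF assms]) (auto simp: polydisc_def)
  then have "isCont g 0"
    using holomorphic_on_imp_continuous_on continuous_on_eq_continuous_at open_UNIV by blast
  then have "g \<midarrow>0\<rightarrow> g 0" by (simp add: isCont_def)
  moreover have "g \<midarrow>0\<rightarrow> h w"
    by (rule tendsto_eventually) (simp add: g_def eventually_at_filter)
  ultimately have "g 0 = h w" by (rule LIM_unique)
  then show ?thesis by (simp add: g_def)
qed

text \<open>The majorant for the power series below. A multi-index on \<open>insert b B\<close> is
  an exponent paired with a multi-index on \<open>B\<close>, so the sum factors.\<close>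

lemma summable_on_multi_geometric:
  fixes q :: "'b \<Rightarrow> real"
  assumes "finite B" "\<And>b. b \<in> B \<Longrightarrow> 0 \<le> q b" "\<And>b. b \<in> B \<Longrightarrow> q b < 1"
  shows "(\<lambda>\<alpha>::'b \<Rightarrow> nat. \<Prod>b\<in>B. q b ^ \<alpha> b) summable_on (B \<rightarrow>\<^sub>E UNIV)"
  using assms
proof (induction B rule: finite_induct)
  case empty
  then show ?case by (simp add: PiE_empty_domain)
next
  case (insert b B)
  let ?P = "\<lambda>\<alpha>::'b \<Rightarrow> nat. \<Prod>b\<in>B. q b ^ \<alpha> b"
  have inj: "inj_on (\<lambda>(y, g). g(b := y)) (UNIV \<times> (B \<rightarrow>\<^sub>E (UNIV :: nat set)))"
    using inj_combinator[OF insert(2), of "\<lambda>_. UNIV"] by simp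
  have s: "?P summable_on (B \<rightarrow>\<^sub>E UNIV)" using insert by auto
  have "(\<lambda>(y, g). q b ^ y * ?P g) summable_on (UNIV \<times> (B \<rightarrow>\<^sub>E UNIV))"
  proof (rule summable_on_SigmaI)
    show "((\<lambda>g. case (y, g) of (y, g) \<Rightarrow> q b ^ y * ?P g) has_sum q b ^ y * infsum ?P (B \<rightarrow>\<^sub>E UNIV)) (B \<rightarrow>\<^sub>E UNIV)"
      for y using has_sum_cmult_right[OF has_sum_infsum[OF s], of "q b ^ y"] by simp
    have "(\<lambda>y. q b ^ y) summable_on UNIV"
      using insert.prems by (intro summable_nonneg_imp_summable_on summable_geometric) auto
    then show "(\<lambda>y. q b ^ y * infsum ?P (B \<rightarrow>\<^sub>E UNIV)) summable_on UNIV"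
      by (rule summable_on_cmult_left)
  qed (use insert.prems in \<open>auto intro!: prod_nonneg mult_nonneg_nonneg\<close>)
  moreover have "(\<lambda>(y, g). q b ^ y * ?P g) = (\<lambda>\<alpha>. \<Prod>b\<in>insert b B. q b ^ \<alpha> b) \<circ> (\<lambda>(y, g). g(b := y))"
  proof (rule ext, clarsimp)
    fix y and g :: "'b \<Rightarrow> nat"
    have "(\<Prod>c\<in>B. q c ^ (if c = b then y else g c)) = ?P g"
      by (rule prod.cong) (use insert(2) in auto)
    then show "q b ^ y * ?P g = (\<Prod>c\<in>insert b B. q c ^ (if c = b then y else g c))"
      using insert(1,2) by simp
  qed
  ultimately show ?case
    by (simp add: PiE_insert_eq summable_on_reindex[OF inj])
qed

text \<open>Induction on the number of variables: expand in \<open>b\<close>, then expand each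
  Taylor coefficient in the remaining variables. The bound on \<open>c\<close> belongs to the
  statement because it makes the resulting double series absolutely summable, by comparison with a
  multi-geometric series.\<close>

theorem curve_hol_power_series:
  assumes "finite B" "curve_hol B p R h"
    "\<And>z. z \<in> polydisc B p R \<Longrightarrow> norm (h z) \<le> M" "0 < r" "r < R"
  shows "\<exists>c. (\<forall>\<alpha>\<in>B \<rightarrow>\<^sub>E UNIV. norm (c \<alpha>) \<le> M * (\<Prod>b\<in>B. (1 / r) ^ \<alpha> b)) \<and>
    (\<forall>z\<in>polydisc B p r. ((\<lambda>\<alpha>. c \<alpha> * (\<Prod>b\<in>B. (z b - p b) ^ \<alpha> b)) has_sum h z) (B \<rightarrow>\<^sub>E UNIV))"
  using assms
proof (induction B arbitrary: h M R rule: finite_induct)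
  case empty
  define c :: "('a \<Rightarrow> nat) \<Rightarrow> complex" where "c \<alpha> = h p" for \<alpha>
  have "h z = h p" for z using curve_hol_empty[OF empty(1)] .
  then have "((\<lambda>\<alpha>. c \<alpha> * (\<Prod>b\<in>{}. (z b - p b) ^ \<alpha> b)) has_sum h z) ({} \<rightarrow>\<^sub>E UNIV)" for z
    using has_sum_finite[of "{\<lambda>_. undefined :: nat}" c] unfolding \<open>h z = h p\<close>
    by (simp add: c_def[abs_def] PiE_empty_domain)
  moreover have "norm (h p) \<le> M" using empty by (simp add: polydisc_def)
  ultimately show ?case by (intro exI[of _ c]) (simp add: c_def)
next
  case (insert b B)
  \<comment> \<open>The induction hypothesis is applied to the coefficient functions with
    \<open>T\<close> in place of \<open>R\<close> and \<open>M / T ^ k\<close> in place of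
    \<open>M\<close>.\<close>
  define T where "T = (r + R) / 2"
  have T: "r < T" "T < R" "0 < T" using insert.prems by (auto simp: T_def)
  have M0: "0 \<le> M"
    using order_trans[OF norm_ge_zero insert.prems(2)[of p]] insert.prems by (simp add: polydisc_def)
  let ?S = "\<lambda>k. slice_coeff b (p b) k h"
  have "curve_hol B p T (?S k)" for k
    using curve_hol_slice_coeff[OF insert.prems(1,2) _ T(3,2), of b k] insert(2) by simp
  moreover have Sb: "norm (?S k z) \<le> M / T ^ k" if "z \<in> polydisc B p T" for z k
  proof (rule slice_coeff_bound[OF insert.prems(1,2) T(3,2)])
    show "z(b := p b) \<in> polydisc (insert b B) p R"
    proof -
      have "z \<in> polydisc B p R"
        using polydisc_mono[OF less_imp_le[OF T(2)]] that by blast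
      then show ?thesis using T(2,3) unfolding polydisc_def by simp
    qed
  qed
  moreover define Q where "Q k c \<longleftrightarrow> (\<forall>\<alpha>\<in>B \<rightarrow>\<^sub>E UNIV. norm (c \<alpha>) \<le> M / T ^ k * (\<Prod>b\<in>B. (1 / r) ^ \<alpha> b)) \<and>
    (\<forall>z\<in>polydisc B p r. ((\<lambda>\<alpha>. c \<alpha> * (\<Prod>b\<in>B. (z b - p b) ^ \<alpha> b)) has_sum ?S k z) (B \<rightarrow>\<^sub>E UNIV))"
    for k c
  ultimately have "\<exists>c. Q k c" for k
    unfolding Q_def by (intro insert.IH[OF _ _ insert.prems(3) T(1)])
  then obtain d where "\<forall>k. Q k (d k)" using choice[of Q] by blast
  then have d: "\<And>k \<alpha>. \<alpha> \<in> B \<rightarrow>\<^sub>E UNIV \<Longrightarrow> norm (d k \<alpha>) \<le> M / T ^ k * (\<Prod>b\<in>B. (1 / r) ^ \<alpha> b)"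
    "\<And>k z. z \<in> polydisc B p r \<Longrightarrow>
      ((\<lambda>\<alpha>. d k \<alpha> * (\<Prod>b\<in>B. (z b - p b) ^ \<alpha> b)) has_sum ?S k z) (B \<rightarrow>\<^sub>E UNIV)"
    unfolding Q_def by blast+
  \<comment> \<open>Splits a multi-index on \<open>insert b B\<close> into its exponent at
    \<open>b\<close> and a multi-index on \<open>B\<close>; the reset to \<open>undefined\<close>
    makes the latter extensional.\<close>
  define c where "c \<alpha> = d (\<alpha> b) (\<alpha>(b := undefined))" for \<alpha>
  have upd: "c (g(b := y)) = d y g" if "g \<in> B \<rightarrow>\<^sub>E UNIV" for g y
  proof -
    have "g(b := undefined) = g" using that insert(2) by (auto simp: PiE_def extensional_def)
    then show ?thesis by (simp add: c_def)
  qed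
  have prod_upd: "(\<Prod>e\<in>insert b B. f e ^ (g(b := y)) e) = f b ^ y * (\<Prod>e\<in>B. f e ^ g e)"
    for f :: "'a \<Rightarrow> 'c :: comm_monoid_mult" and g :: "'a \<Rightarrow> nat" and y
  proof -
    have "(\<Prod>e\<in>B. f e ^ (g(b := y)) e) = (\<Prod>e\<in>B. f e ^ g e)"
      by (rule prod.cong) (use insert(2) in auto)
    then show ?thesis using insert(1,2) by simp
  qed
  have inj: "inj_on (\<lambda>(y, g). g(b := y)) (UNIV \<times> (B \<rightarrow>\<^sub>E (UNIV :: nat set)))"
    using inj_combinator[OF insert(2), of "\<lambda>_. UNIV"] by simp
  have pow: "M / T ^ k \<le> M * (1 / r) ^ k" for k
  proof -
    have "M / T ^ k \<le> M / r ^ k"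
      using M0 T insert.prems(3) by (intro divide_left_mono power_mono mult_pos_pos zero_less_power) auto
    then show ?thesis by (simp add: power_one_over)
  qed
  have bound: "norm (c (g(b := y))) \<le> M * (\<Prod>e\<in>insert b B. (1 / r) ^ (g(b := y)) e)"
    if g: "g \<in> B \<rightarrow>\<^sub>E UNIV" for g y
  proof -
    have "norm (c (g(b := y))) \<le> M / T ^ y * (\<Prod>b\<in>B. (1 / r) ^ g b)"
      using d(1)[OF g] by (simp add: upd[OF g])
    also have "\<dots> \<le> M * (1 / r) ^ y * (\<Prod>b\<in>B. (1 / r) ^ g b)"
      using insert.prems(3) by (intro mult_right_mono pow prod_nonneg) auto
    finally show ?thesis by (subst prod_upd) (simp add: mult.assoc)
  qed
  have "((\<lambda>\<alpha>. c \<alpha> * (\<Prod>e\<in>insert b B. (z e - p e) ^ \<alpha> e)) has_sum h z) (insert b B \<rightarrow>\<^sub>E UNIV)"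
    if z: "z \<in> polydisc (insert b B) p r" for z
  proof -
    define q where "q e = norm (z e - p e) / r" for e
    have q: "0 \<le> q e" "e \<in> insert b B \<Longrightarrow> q e < 1" for e
      using z insert.prems(3) by (auto simp: q_def polydisc_def)
    have zB: "z \<in> polydisc B p r" and zr: "z \<in> polydisc (insert b B) p R"
      using z insert.prems(4) by (auto simp: polydisc_def)
    define F where "F = (\<lambda>(y, g). c (g(b := y)) * (\<Prod>e\<in>insert b B. (z e - p e) ^ (g(b := y)) e))"
    have "(F has_sum h z) (UNIV \<times> (B \<rightarrow>\<^sub>E UNIV))"
    proof (rule has_sum_SigmaI)
      show "((\<lambda>g. F (y, g)) has_sum ?S y z * (z b - p b) ^ y) (B \<rightarrow>\<^sub>E UNIV)" for y
      proof (rule has_sum_cong[THEN iffD1, OF _ has_sum_cmult_left[OF d(2)[OF zB, of y], of "(z b - p b) ^ y"]])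
        fix g assume g: "g \<in> B \<rightarrow>\<^sub>E (UNIV::nat set)"
        show "d y g * (\<Prod>b\<in>B. (z b - p b) ^ g b) * (z b - p b) ^ y = F (y, g)"
          unfolding F_def prod.case upd[OF g] prod_upd by simp
      qed
      have s: "(\<lambda>y. ?S y z * (z b - p b) ^ y) sums h z"
        by (rule slice_coeff_sums[OF insert.prems(1) zr]) simp
      have "summable (\<lambda>y. norm (?S y z * (z b - p b) ^ y))"
      proof (rule summable_comparison_test'[where N = 0])
        show "summable (\<lambda>y. M * q b ^ y)"
          using q by (intro summable_mult summable_geometric) auto
        fix y
        have zt: "z \<in> polydisc B p T" using zB T polydisc_mono[of r T B p] by auto
        have "norm (?S y z) * norm (z b - p b) ^ y \<le> M * (1/r) ^ y * norm (z b - p b) ^ y"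
          by (intro mult_right_mono order_trans[OF Sb[OF zt] pow]) auto
        then show "norm (norm (?S y z * (z b - p b) ^ y)) \<le> M * q b ^ y"
          by (simp add: norm_mult norm_power q_def power_one_over divide_inverse power_mult_distrib mult_ac)
      qed
      then show "((\<lambda>y. ?S y z * (z b - p b) ^ y) has_sum h z) UNIV"
        using s by (rule norm_summable_imp_has_sum)
      show "F summable_on UNIV \<times> (B \<rightarrow>\<^sub>E UNIV)"
      proof (rule abs_summable_summable, rule Infinite_Sum.abs_summable_on_comparison_test')
        have "(\<lambda>\<alpha>. \<Prod>b\<in>insert b B. q b ^ \<alpha> b) summable_on (insert b B \<rightarrow>\<^sub>E UNIV)"
          by (rule summable_on_multi_geometric) (use insert(1) q in auto)
        then have "((\<lambda>\<alpha>. \<Prod>b\<in>insert b B. q b ^ \<alpha> b) \<circ> (\<lambda>(y, g). g(b := y))) summable_on UNIV \<times> (B \<rightarrow>\<^sub>E UNIV)"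
          by (simp only: PiE_insert_eq summable_on_reindex[OF inj])
        then show "(\<lambda>x. M * ((\<lambda>\<alpha>. \<Prod>b\<in>insert b B. q b ^ \<alpha> b) \<circ> (\<lambda>(y, g). g(b := y))) x) summable_on UNIV \<times> (B \<rightarrow>\<^sub>E UNIV)"
          by (rule summable_on_cmult_right)
        fix x :: "nat \<times> ('a \<Rightarrow> nat)" assume x: "x \<in> UNIV \<times> (B \<rightarrow>\<^sub>E (UNIV::nat set))"
        obtain y g where [simp]: "x = (y, g)" and g: "g \<in> B \<rightarrow>\<^sub>E UNIV" using x by auto
        have "norm (F x) \<le> M * (\<Prod>e\<in>insert b B. (1 / r) ^ (g(b := y)) e) * norm (\<Prod>e\<in>insert b B. (z e - p e) ^ (g(b := y)) e)"
          unfolding F_def \<open>x = (y, g)\<close> prod.case norm_mult by (intro mult_right_mono bound[OF g]) auto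
        also have "\<dots> = M * ((\<lambda>\<alpha>. \<Prod>b\<in>insert b B. q b ^ \<alpha> b) \<circ> (\<lambda>(y, g). g(b := y))) x"
          unfolding prod_norm[symmetric] norm_power mult.assoc prod.distrib[symmetric] q_def
          by (simp add: power_one_over divide_inverse power_mult_distrib mult.commute del: fun_upd_apply)
        finally show "norm (F x) \<le> M * ((\<lambda>\<alpha>. \<Prod>b\<in>insert b B. q b ^ \<alpha> b) \<circ> (\<lambda>(y, g). g(b := y))) x" .
      qed
    qed
    moreover have "F = (\<lambda>\<alpha>. c \<alpha> * (\<Prod>e\<in>insert b B. (z e - p e) ^ \<alpha> e)) \<circ> (\<lambda>(y, g). g(b := y))"
      by (auto simp: F_def fun_eq_iff)
    ultimately show ?thesis
      by (simp add: PiE_insert_eq has_sum_reindex[OF inj])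
  qed
  moreover have "norm (c \<alpha>) \<le> M * (\<Prod>e\<in>insert b B. (1 / r) ^ \<alpha> e)" if "\<alpha> \<in> insert b B \<rightarrow>\<^sub>E UNIV" for \<alpha>
    using that bound by (auto simp: PiE_insert_eq simp del: fun_upd_apply)
  ultimately show ?case by blast
qed

section \<open>Real functions with a local complex extension\<close>

text \<open>The value 0 off \<open>Basis\<close> is a normal form; it turns \<open>cplx_upd\<close>,
  \<open>cplx_join\<close> and the composition step in \<open>cext_compose\<close> into equalities
  of functions.\<close>

definition cplx :: "'a::euclidean_space \<Rightarrow> 'a \<Rightarrow> complex" where
  "cplx x b = (if b \<in> Basis then of_real (x \<bullet> b) else 0)"

abbreviation cdisc :: "'a::euclidean_space \<Rightarrow> real \<Rightarrow> ('a \<Rightarrow> complex) set" where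
  "cdisc p R \<equiv> polydisc Basis (cplx p) R"

text \<open>The bound \<open>M\<close> is part of the notion because it yields continuity at the
  centre, on which every composition depends.\<close>

definition extends_on ::
  "('a::euclidean_space \<Rightarrow> real) \<Rightarrow> 'a \<Rightarrow> real \<Rightarrow> real \<Rightarrow> (('a \<Rightarrow> complex) \<Rightarrow> complex) \<Rightarrow> bool" where
  "extends_on f p R M h \<longleftrightarrow> curve_hol Basis (cplx p) R h \<and>
     (\<forall>z \<in> cdisc p R. norm (h z) \<le> M) \<and>
     (\<forall>x. cplx x \<in> cdisc p R \<longrightarrow> h (cplx x) = of_real (f x))"

definition cext :: "('a::euclidean_space \<Rightarrow> real) \<Rightarrow> 'a \<Rightarrow> bool" where
  "cext f p \<longleftrightarrow> (\<exists>R>0. \<exists>M h. extends_on f p R M h)"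

lemma cplx_in_polydisc: "cplx x \<in> cdisc p R \<longleftrightarrow> (\<forall>b\<in>Basis. \<bar>(x - p) \<bullet> b\<bar> < R)"
proof -
  have "norm (cplx x b - cplx p b) = \<bar>(x - p) \<bullet> b\<bar>" if "b \<in> Basis" for b
    using that unfolding cplx_def inner_diff_left
    by (simp only: if_True of_real_diff[symmetric] norm_of_real)
  then show ?thesis by (simp add: polydisc_def)
qed

lemma cplx_center: "0 < R \<Longrightarrow> cplx p \<in> cdisc p R"
  by (simp add: polydisc_def)

lemma cplx_ball: "x \<in> ball p R \<Longrightarrow> cplx x \<in> cdisc p R"
  unfolding cplx_in_polydisc by (metis Basis_le_norm dist_commute dist_norm mem_ball order_le_less_trans)

lemma cplx_polydisc_imp_ball:
  fixes x p :: "'a::euclidean_space"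
  assumes "cplx x \<in> cdisc p R"
  shows "dist x p < real DIM('a) * R"
proof -
  have "norm (x - p) \<le> (\<Sum>b\<in>Basis. \<bar>(x - p) \<bullet> b\<bar>)" by (rule norm_le_l1)
  also have "\<dots> < (\<Sum>b\<in>(Basis::'a set). R)"
    using assms by (intro sum_strict_mono) (auto simp: cplx_in_polydisc)
  finally show ?thesis by (simp add: dist_norm)
qed

lemma extends_on_mono:
  assumes "extends_on f p R M h" "s \<le> R"
  shows "extends_on f p s M h"
  using assms curve_hol_subset[OF _ polydisc_mono[OF assms(2)]] polydisc_mono[OF assms(2)]
  unfolding extends_on_def by (meson subsetD)

lemma extends_onD:
  assumes "extends_on f p R M h"
  shows "curve_hol Basis (cplx p) R h"
    "z \<in> cdisc p R \<Longrightarrow> norm (h z) \<le> M"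
    "cplx x \<in> cdisc p R \<Longrightarrow> h (cplx x) = of_real (f x)"
  using assms unfolding extends_on_def by blast+

lemma cextE:
  assumes "cext f p"
  obtains R M h where "0 < R" "extends_on f p R M h"
  using assms unfolding cext_def by blast

lemma cextI: "0 < R \<Longrightarrow> extends_on f p R M h \<Longrightarrow> cext f p"
  unfolding cext_def by blast

text \<open>At real points the monomials centred at \<open>p\<close> are real, so the real parts of
  the complex coefficients already sum to \<open>f\<close>.\<close>

theorem real_analytic_on_cext:
  fixes f :: "'a::euclidean_space \<Rightarrow> real"
  assumes "\<And>p. p \<in> S \<Longrightarrow> cext f p"
  shows "f real_analytic_on S"
  unfolding real_analytic_on_def
proof
  fix p assume "p \<in> S"
  then obtain R M h where R: "0 < R" and h: "extends_on f p R M h" using assms cextE by blast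
  obtain c where c: "\<And>z. z\<in>cdisc p (R/2) \<Longrightarrow>
      ((\<lambda>\<alpha>. c \<alpha> * (\<Prod>b\<in>Basis. (z b - cplx p b) ^ \<alpha> b)) has_sum h z) (Basis \<rightarrow>\<^sub>E UNIV)"
    using curve_hol_power_series[OF finite_Basis extends_onD(1,2)[OF h], of "R/2"] R
    by fastforce
  have "((\<lambda>\<alpha>. Re (c \<alpha>) * (\<Prod>b\<in>Basis. ((x - p) \<bullet> b) ^ \<alpha> b)) has_sum f x) (Basis \<rightarrow>\<^sub>E UNIV)"
    if "x \<in> ball p (R/2)" for x
  proof -
    have x: "cplx x \<in> cdisc p (R/2)" using cplx_ball[OF that] .
    then have x': "cplx x \<in> cdisc p R" using polydisc_mono[of "R/2" R] R by fastforce
    have "(\<Prod>b\<in>Basis. (cplx x b - cplx p b) ^ \<alpha> b) = of_real (\<Prod>b\<in>Basis. ((x - p) \<bullet> b) ^ \<alpha> b)" for \<alpha>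
      unfolding of_real_prod by (rule prod.cong) (auto simp: cplx_def inner_diff_left)
    then show ?thesis
      using has_sum_Re[OF c[OF x]] extends_onD(3)[OF h x'] by (simp del: of_real_prod)
  qed
  then show "\<exists>c \<epsilon>. 0 < \<epsilon> \<and> (\<forall>x\<in>ball p \<epsilon>.
      ((\<lambda>\<alpha>. c \<alpha> * (\<Prod>b\<in>Basis. ((x - p) \<bullet> b) ^ \<alpha> b)) has_sum f x) (Basis \<rightarrow>\<^sub>E UNIV))"
    using R by (intro exI[of _ "\<lambda>\<alpha>. Re (c \<alpha>)"] exI[of _ "R/2"]) auto
qed

lemma cext_cong:
  fixes f :: "'a::euclidean_space \<Rightarrow> real"
  assumes "cext f p" and ev: "\<forall>\<^sub>F x in nhds p. f x = g x"
  shows "cext g p"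
proof -
  obtain R M h where R: "0 < R" and h: "extends_on f p R M h" using assms cextE by blast
  obtain \<epsilon> where \<epsilon>: "\<epsilon> > 0" "\<And>x. dist x p < \<epsilon> \<Longrightarrow> f x = g x"
    using ev unfolding eventually_nhds_metric by blast
  \<comment> \<open>The real points of the polydisc form a cube;
    \<open>cplx_polydisc_imp_ball\<close> places a cube of this size inside the ball of radius
    \<open>\<epsilon>\<close>.\<close>
  define s where "s = min R (\<epsilon> / real DIM('a))"
  have s: "0 < s" "s \<le> R" "real DIM('a) * s \<le> \<epsilon>"
    using R \<epsilon> by (auto simp: s_def min_def field_simps)
  have h': "extends_on f p s M h" using extends_on_mono[OF h s(2)] .
  have "f x = g x" if "cplx x \<in> cdisc p s" for x
    using cplx_polydisc_imp_ball[OF that] s(3) \<epsilon>(2) by auto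
  then have "extends_on g p s M h" using h' unfolding extends_on_def by metis
  then show ?thesis using s(1) cextI by blast
qed

lemma extends_on_continuous:
  assumes "0 < R" "extends_on f p R M h" "0 < (\<epsilon>::real)"
  shows "\<exists>d>0. d \<le> R \<and> (\<forall>z\<in>cdisc p d. norm (h z - h (cplx p)) < \<epsilon>)"
proof -
  have M: "0 \<le> M"
    using order_trans[OF norm_ge_zero extends_onD(2)[OF assms(2) cplx_center[OF assms(1)]]] .
  \<comment> \<open>Makes the continuity bound \<open>4 * M / R * d\<close> smaller than
    \<open>\<epsilon>\<close>; \<open>M + 1\<close> guards against \<open>M = 0\<close>.\<close>
  define d where "d = min (R/4) (\<epsilon> * R / (8 * (M + 1)))"
  have d: "0 < d" "d < R/2" using assms M by (auto simp: d_def)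
  have "4 * M / R * d < \<epsilon>"
  proof -
    have "4 * M / R * d \<le> 4 * M / R * (\<epsilon> * R / (8 * (M + 1)))"
      using M assms by (intro mult_left_mono) (auto simp: d_def)
    also have "\<dots> = \<epsilon> * (M / (2 * (M + 1)))" using assms M by (simp add: field_simps)
    also have "\<dots> < \<epsilon> * 1" using assms M by (intro mult_strict_left_mono) (auto simp: field_simps)
    finally show ?thesis by simp
  qed
  then have "norm (h z - h (cplx p)) < \<epsilon>" if "z \<in> cdisc p d" for z
    using bounded_curve_hol_continuous[OF extends_onD(1,2)[OF assms(2)] d that] by linarith
  then show ?thesis using d assms by (intro exI[of _ d]) auto
qed

lemma cext_continuous:
  assumes "cext f p"
  shows "(f \<longlongrightarrow> f p) (nhds p)"
proof (rule tendstoI)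
  fix e :: real assume e: "0 < e"
  obtain R M h where R: "0 < R" and h: "extends_on f p R M h" using assms cextE by blast
  obtain d where d: "d > 0" "d \<le> R" "\<And>z. z\<in>cdisc p d \<Longrightarrow> norm (h z - h (cplx p)) < e"
    using extends_on_continuous[OF R h e] by blast
  have "dist (f x) (f p) < e" if "dist x p < d" for x
  proof -
    have x: "cplx x \<in> cdisc p d" by (rule cplx_ball) (use that in \<open>simp add: dist_commute\<close>)
    then have "cplx x \<in> cdisc p R" using polydisc_mono[OF d(2)] by blast
    then have "h (cplx x) - h (cplx p) = of_real (f x - f p)"
      using extends_onD(3)[OF h] extends_onD(3)[OF h cplx_center[OF R]] by simp
    then have "norm (h (cplx x) - h (cplx p)) = \<bar>f x - f p\<bar>" by (simp only: norm_of_real)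
    then show ?thesis using d(3)[OF x] by (simp add: dist_real_def)
  qed
  then show "\<forall>\<^sub>F x in nhds p. dist (f x) (f p) < e"
    unfolding eventually_nhds_metric using d(1) by blast
qed

lemma cext_isCont: "cext f p \<Longrightarrow> isCont f p"
  using cext_continuous continuous_within tendsto_at_iff_tendsto_nhds
  by (metis isCont_def)

lemma cext_eventually:
  assumes "cext f p"
  shows "\<forall>\<^sub>F x in nhds p. cext f x"
proof -
  obtain R M h where R: "0 < R" and h: "extends_on f p R M h" using assms cextE by blast
  have "cext f x" if "dist x p < R/2" for x
  proof (rule cextI)
    have x: "cplx x \<in> cdisc p (R/2)" by (rule cplx_ball) (use that in \<open>simp add: dist_commute\<close>)
    have sub: "cdisc x (R/2) \<subseteq> cdisc p R"
    proof
      fix z assume z: "z \<in> cdisc x (R/2)"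
      have "norm (z b - cplx p b) < R" if "b \<in> Basis" for b
      proof -
        have "norm (z b - cplx p b) \<le> norm (z b - cplx x b) + norm (cplx x b - cplx p b)"
          using norm_triangle_ineq[of "z b - cplx x b" "cplx x b - cplx p b"] by simp
        moreover have "norm (z b - cplx x b) < R/2" "norm (cplx x b - cplx p b) < R/2"
          using z x that by (auto simp: polydisc_def)
        ultimately show ?thesis by linarith
      qed
      then show "z \<in> cdisc p R" by (simp add: polydisc_def)
    qed
    show "extends_on f x (R/2) M h"
      using h curve_hol_subset[OF _ sub] sub unfolding extends_on_def by (meson subsetD)
    show "0 < R/2" using R by simp
  qed
  then show ?thesis unfolding eventually_nhds_metric using R by (intro exI[of _ "R/2"]) auto
qed

text \<open>On a small polydisc the extended components of \<open>G\<close> move by less than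
  \<open>R\<close>, hence land where \<open>F\<close> extends; there a holomorphic curve is carried
  to a holomorphic curve.\<close>

lemma cext_compose:
  fixes F :: "'b::euclidean_space \<Rightarrow> real" and G :: "'a::euclidean_space \<Rightarrow> 'b"
  assumes F: "cext F (G p)" and G: "\<And>b. b \<in> Basis \<Longrightarrow> cext (\<lambda>x. G x \<bullet> b) p"
  shows "cext (\<lambda>x. F (G x)) p"
proof -
  obtain R M h where R: "0 < R" and h: "extends_on F (G p) R M h" using F cextE by blast
  have "\<forall>b. \<exists>s N g. b \<in> Basis \<longrightarrow> 0 < s \<and> extends_on (\<lambda>x. G x \<bullet> b) p s N g \<and>
      (\<forall>z\<in>cdisc p s. norm (g z - g (cplx p)) < R)"
  proof
    fix b :: 'b
    show "\<exists>s N g. b \<in> Basis \<longrightarrow> 0 < s \<and> extends_on (\<lambda>x. G x \<bullet> b) p s N g \<and>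
      (\<forall>z\<in>cdisc p s. norm (g z - g (cplx p)) < R)"
    proof (cases "b \<in> Basis")
      case True
      obtain \<tau> N g where "0 < \<tau>" and g: "extends_on (\<lambda>x. G x \<bullet> b) p \<tau> N g"
        using G[OF True] cextE by blast
      then obtain s where "0 < s" "s \<le> \<tau>" "\<forall>z\<in>cdisc p s. norm (g z - g (cplx p)) < R"
        using extends_on_continuous[OF _ g R] by blast
      then show ?thesis using extends_on_mono[OF g] by blast
    qed auto
  qed
  then obtain s N g where g: "\<And>b. b \<in> Basis \<Longrightarrow> 0 < s b"
    "\<And>b. b \<in> Basis \<Longrightarrow> extends_on (\<lambda>x. G x \<bullet> b) p (s b) (N b) (g b)"
    "\<And>b z. b \<in> Basis \<Longrightarrow> z\<in>cdisc p (s b) \<Longrightarrow> norm (g b z - g b (cplx p)) < R"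
    by metis
  define d where "d = Min (s ` Basis)"
  have d: "0 < d" using g(1) by (simp add: d_def)
  have d': "d \<le> s b" if "b \<in> Basis" for b using that by (simp add: d_def)
  have ge: "extends_on (\<lambda>x. G x \<bullet> b) p d (N b) (g b)" if "b \<in> Basis" for b
    using extends_on_mono[OF g(2) d'] that by blast
  define K where "K z = (\<lambda>b. if b \<in> Basis then g b z else 0)" for z
  have K: "K z \<in> cdisc (G p) R" if "z \<in> cdisc p d" for z
  proof -
    have "norm (g b z - cplx (G p) b) < R" if b: "b \<in> Basis" for b
    proof -
      have "z \<in> cdisc p (s b)"
        using \<open>z \<in> _\<close> polydisc_mono[OF d'[OF b]] by blast
      then show ?thesis
        using g(3)[OF b, of z] extends_onD(3)[OF ge[OF b] cplx_center[OF d]] b by (simp add: cplx_def)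
    qed
    then show ?thesis by (simp add: polydisc_def K_def)
  qed
  have "extends_on (\<lambda>x. F (G x)) p d M (\<lambda>z. h (K z))"
    unfolding extends_on_def
  proof (intro conjI ballI allI impI)
    show "curve_hol Basis (cplx p) d (\<lambda>z. h (K z))"
    proof (rule curve_holI)
      fix u S assume S: "open S" "\<And>b. b \<in> Basis \<Longrightarrow> (\<lambda>t. u t b) holomorphic_on S"
        "\<And>t. t \<in> S \<Longrightarrow> u t \<in> cdisc p d"
      show "(\<lambda>t. h (K (u t))) holomorphic_on S"
      proof (rule curve_holD[OF extends_onD(1)[OF h] S(1)])
        show "(\<lambda>t. K (u t) b) holomorphic_on S" if "b \<in> Basis" for b
          using curve_holD[OF extends_onD(1)[OF ge[OF that]] S] that by (simp add: K_def)
      qed (use K S(3) in blast)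
    qed
    show "norm (h (K z)) \<le> M" if "z \<in> cdisc p d" for z
      using extends_onD(2)[OF h K[OF that]] .
    fix x assume x: "cplx x \<in> cdisc p d"
    have "K (cplx x) = cplx (G x)"
      using extends_onD(3)[OF ge x] by (auto simp: K_def cplx_def)
    then show "h (K (cplx x)) = of_real (F (G x))"
      using extends_onD(3)[OF h] K[OF x] by simp
  qed
  then show ?thesis using d cextI by blast
qed

section \<open>Closure of \<open>cext\<close> under algebraic operations and elementary
  functions\<close>

lemma cext_const: "cext (\<lambda>x. c) p"
  by (rule cextI[of 1 _ _ "\<bar>c\<bar>" "\<lambda>_. of_real c"]) (auto simp: extends_on_def curve_hol_def)

lemma cext_inner_Basis:
  assumes "b \<in> Basis"
  shows "cext (\<lambda>x. x \<bullet> b) p"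
proof (rule cextI[of 1 _ _ "norm (cplx p b) + 1" "\<lambda>z. z b"])
  have "norm (z b) \<le> norm (cplx p b) + 1" if "z \<in> cdisc p 1" for z
  proof -
    have "norm (z b - cplx p b) < 1" using that assms by (auto simp: polydisc_def)
    then show ?thesis using norm_triangle_sub[of "z b" "cplx p b"] by linarith
  qed
  then show "extends_on (\<lambda>x. x \<bullet> b) p 1 (norm (cplx p b) + 1) (\<lambda>z. z b)"
    using assms by (auto simp: extends_on_def curve_hol_def cplx_def)
qed simp

text \<open>The required bound comes from compactness: the extension of \<open>f\<close> is confined
  to a closed disc inside \<open>S\<close>, on which the continuous function \<open>\<phi>\<close>
  is bounded.\<close>

lemma cext_holomorphic:
  fixes f :: "'a::euclidean_space \<Rightarrow> real"
  assumes f: "cext f p" and S: "open S" "of_real (f p) \<in> S" "\<phi> holomorphic_on S"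
    and g: "\<And>t. of_real t \<in> S \<Longrightarrow> \<phi> (of_real t) = of_real (g t)"
  shows "cext (\<lambda>x. g (f x)) p"
proof -
  obtain r where r: "0 < r" "cball (of_real (f p)) r \<subseteq> S"
    using S(1,2) open_contains_cball by blast
  have "compact (\<phi> ` cball (of_real (f p)) r)"
    using S(3) r(2) by (intro compact_continuous_image compact_cball)
      (meson continuous_on_subset holomorphic_on_imp_continuous_on)
  then obtain N where N: "\<And>w. w \<in> cball (of_real (f p)) r \<Longrightarrow> norm (\<phi> w) \<le> N"
    using compact_imp_bounded bounded_iff by (metis imageI)
  obtain \<tau> M h where "0 < \<tau>" and h: "extends_on f p \<tau> M h" using f cextE by blast
  then obtain s where s: "0 < s" "s \<le> \<tau>" "\<And>z. z\<in>cdisc p s \<Longrightarrow> norm (h z - h (cplx p)) < r"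
    using extends_on_continuous[OF _ h r(1)] by blast
  have h': "extends_on f p s M h" using extends_on_mono[OF h s(2)] .
  have in_ball: "h z \<in> ball (of_real (f p)) r" if "z\<in>cdisc p s" for z
    using s(3)[OF that] extends_onD(3)[OF h' cplx_center[OF s(1)]]
    by (simp add: dist_norm norm_minus_commute)
  have "extends_on (\<lambda>x. g (f x)) p s N (\<lambda>z. \<phi> (h z))"
    unfolding extends_on_def
  proof (intro conjI ballI allI impI)
    show "curve_hol Basis (cplx p) s (\<lambda>z. \<phi> (h z))"
    proof (rule curve_holI)
      fix u T assume T: "open T" "\<And>b. b \<in> Basis \<Longrightarrow> (\<lambda>t. u t b) holomorphic_on T"
        "\<And>t. t \<in> T \<Longrightarrow> u t \<in> cdisc p s"
      have "(\<lambda>t. h (u t)) holomorphic_on T"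
        by (rule curve_holD[OF extends_onD(1)[OF h'] T])
      then have "(\<phi> \<circ> (\<lambda>t. h (u t))) holomorphic_on T"
        by (rule holomorphic_on_compose_gen[OF _ S(3)]) (use in_ball T(3) r(2) in fastforce)
      then show "(\<lambda>t. \<phi> (h (u t))) holomorphic_on T" by (simp add: o_def)
    qed
    show "norm (\<phi> (h z)) \<le> N" if "z \<in> cdisc p s" for z
      by (rule N) (use in_ball[OF that] in auto)
    show "\<phi> (h (cplx x)) = of_real (g (f x))" if "cplx x \<in> cdisc p s" for x
    proof -
      have "h (cplx x) \<in> S" using in_ball[OF that] r(2) by auto
      then show ?thesis using g[of "f x"] extends_onD(3)[OF h' that] by simp
    qed
  qed
  then show ?thesis using s(1) cextI by blast
qed

lemma cext_exp: "cext f p \<Longrightarrow> cext (\<lambda>x. exp (f x)) p"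
  by (rule cext_holomorphic[where S = UNIV and \<phi> = exp])
    (auto intro!: holomorphic_intros simp: exp_of_real)

lemma cext_ln: "cext f p \<Longrightarrow> 0 < f p \<Longrightarrow> cext (\<lambda>x. ln (f x)) p"
  by (rule cext_holomorphic[where S = "{z. 0 < Re z}" and \<phi> = Ln])
    (auto intro!: holomorphic_intros open_halfspace_Re_gt simp: Ln_of_real complex_nonpos_Reals_iff)

lemma cext_add:
  assumes "cext f p" "cext g p"
  shows "cext (\<lambda>x. f x + g x) p"
proof -
  obtain R M h where h: "0 < R" "extends_on f p R M h" using assms cextE by blast
  obtain s N k where k: "0 < s" "extends_on g p s N k" using assms cextE by blast
  define \<tau> where "\<tau> = min R s"
  have h': "extends_on f p \<tau> M h" and k': "extends_on g p \<tau> N k"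
    using h k by (auto intro: extends_on_mono simp: \<tau>_def)
  have "extends_on (\<lambda>x. f x + g x) p \<tau> (M + N) (\<lambda>z. h z + k z)"
    unfolding extends_on_def
  proof (intro conjI ballI allI impI)
    show "curve_hol Basis (cplx p) \<tau> (\<lambda>z. h z + k z)"
      by (rule curve_holI, rule holomorphic_on_add)
        (auto intro!: curve_holD[OF extends_onD(1)[OF h']] curve_holD[OF extends_onD(1)[OF k']])
    show "norm (h z + k z) \<le> M + N" if "z \<in> cdisc p \<tau>" for z
      using extends_onD(2)[OF h' that] extends_onD(2)[OF k' that] by (rule norm_triangle_mono)
  qed (simp add: extends_onD(3)[OF h'] extends_onD(3)[OF k'])
  then show ?thesis using h k cextI[of \<tau>] by (auto simp: \<tau>_def)
qed

lemma cext_mult: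
  assumes "cext f p" "cext g p"
  shows "cext (\<lambda>x. f x * g x) p"
proof -
  obtain R M h where h: "0 < R" "extends_on f p R M h" using assms cextE by blast
  obtain s N k where k: "0 < s" "extends_on g p s N k" using assms cextE by blast
  define \<tau> where "\<tau> = min R s"
  have \<tau>: "0 < \<tau>" using h k by (simp add: \<tau>_def)
  have h': "extends_on f p \<tau> M h" and k': "extends_on g p \<tau> N k"
    using h k by (auto intro: extends_on_mono simp: \<tau>_def)
  have "0 \<le> M" using order_trans[OF norm_ge_zero extends_onD(2)[OF h' cplx_center[OF \<tau>]]] .
  have "extends_on (\<lambda>x. f x * g x) p \<tau> (M * N) (\<lambda>z. h z * k z)"
    unfolding extends_on_def
  proof (intro conjI ballI allI impI)
    show "curve_hol Basis (cplx p) \<tau> (\<lambda>z. h z * k z)"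
      by (rule curve_holI, rule holomorphic_on_mult)
        (auto intro!: curve_holD[OF extends_onD(1)[OF h']] curve_holD[OF extends_onD(1)[OF k']])
    show "norm (h z * k z) \<le> M * N" if "z \<in> cdisc p \<tau>" for z
      unfolding norm_mult
      by (intro mult_mono extends_onD(2)[OF h' that] extends_onD(2)[OF k' that] \<open>0 \<le> M\<close>) auto
  qed (simp add: extends_onD(3)[OF h'] extends_onD(3)[OF k'])
  then show ?thesis using \<tau> cextI[of \<tau>] by auto
qed

lemma cext_diff:
  assumes "cext f p" "cext g p"
  shows "cext (\<lambda>x. f x - g x) p"
  using cext_add[OF assms(1) cext_mult[OF cext_const[of "-1"] assms(2)]] by simp

lemma cext_sum: "(\<And>i. i \<in> A \<Longrightarrow> cext (f i) p) \<Longrightarrow> cext (\<lambda>x. \<Sum>i\<in>A. f i x) p"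
  by (induction A rule: infinite_finite_induct) (auto intro: cext_const cext_add)

lemma cext_prod: "(\<And>i. i \<in> A \<Longrightarrow> cext (f i) p) \<Longrightarrow> cext (\<lambda>x. \<Prod>i\<in>A. f i x) p"
  by (induction A rule: infinite_finite_induct) (auto intro: cext_const cext_mult)

lemma cext_power: "cext f p \<Longrightarrow> cext (\<lambda>x. f x ^ n) p"
  by (induction n) (auto intro: cext_const cext_mult)

lemma cext_inner: "cext (\<lambda>x. x \<bullet> v) p"
proof -
  have "cext (\<lambda>x. \<Sum>b\<in>Basis. (x \<bullet> b) * (v \<bullet> b)) p"
    by (intro cext_sum cext_mult cext_const cext_inner_Basis)
  then show ?thesis by (simp add: euclidean_inner[symmetric])
qed

lemma cext_powr:
  assumes "cext f p" "cext g p" "0 < f p"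
  shows "cext (\<lambda>x. f x powr g x) p"
proof (rule cext_cong)
  show "cext (\<lambda>x. exp (g x * ln (f x))) p"
    by (intro cext_exp cext_mult cext_ln assms)
  have "\<forall>\<^sub>F x in nhds p. 0 < f x"
    using order_tendstoD(1)[OF cext_continuous[OF assms(1)] assms(3)] .
  then show "\<forall>\<^sub>F x in nhds p. exp (g x * ln (f x)) = f x powr g x"
    by eventually_elim (simp add: powr_def)
qed

section \<open>Restriction to coordinate lines, and analytic primitives along them\<close>

lemma cplx_upd:
  assumes "b \<in> Basis"
  shows "(cplx x)(b := of_real t) = cplx (x + (t - x \<bullet> b) *\<^sub>R b)"
proof
  fix c
  show "((cplx x)(b := of_real t)) c = cplx (x + (t - x \<bullet> b) *\<^sub>R b) c"
    using assms by (cases "c \<in> Basis") (auto simp: cplx_def inner_add_left inner_Basis)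
qed

text \<open>Both numbers are the vector derivative of one and the same curve in the real
  parameter.\<close>

lemma deriv_real_on_reals:
  fixes f :: "complex \<Rightarrow> complex" and F :: "real \<Rightarrow> real"
  assumes f: "(f has_field_derivative D) (at (of_real t))"
    and F: "(F has_real_derivative A) (at t)"
    and ev: "\<forall>\<^sub>F s in nhds t. f (of_real s) = of_real (F s)"
  shows "D = of_real A"
proof -
  have "((\<lambda>s. complex_of_real (F s)) has_vector_derivative of_real A) (at t)"
    using F by (intro has_vector_derivative_of_real) (simp add: has_real_derivative_iff_has_vector_derivative)
  moreover have "((\<lambda>s. complex_of_real (F s)) has_vector_derivative D) (at t)"
  proof -
    have "((\<lambda>s. f (of_real s)) has_vector_derivative D) (at t)"
      by (rule has_vector_derivative_real_field[OF f])
    moreover have "f (of_real t) = of_real (F t)" by (rule eventually_nhds_x_imp_x[OF ev])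
    ultimately show ?thesis
      using has_vector_derivative_cong_ev[where x = t and S = UNIV and f = "\<lambda>s. f (of_real s)"
          and g = "\<lambda>s. of_real (F s)" and f' = D] ev by simp
  qed
  ultimately show ?thesis by (rule vector_derivative_unique_at[symmetric])
qed

text \<open>The Taylor series in coordinate \<open>b\<close>, integrated term by term from
  \<open>a\<close>. Being a series rather than a path integral, it inherits holomorphy along curves
  from its partial sums.\<close>

definition slice_primitive ::
  "'b \<Rightarrow> complex \<Rightarrow> (('b \<Rightarrow> complex) \<Rightarrow> complex) \<Rightarrow> ('b \<Rightarrow> complex) \<Rightarrow> complex" where
  "slice_primitive b a h z =
     (suminf (\<lambda>n. (if n = 0 then 0 else slice_coeff b a (n - 1) h z / of_nat n) * (z b - a) ^ n))"

lemma slice_coeff_upd: "slice_coeff b a k h (z(b := s)) = slice_coeff b a k h z"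
  by (simp add: slice_coeff_def)

lemma slice_primitive_center: "slice_primitive b a h (z(b := a)) = 0"
proof -
  have "(if n = 0 then 0 else slice_coeff b a (n - 1) h (z(b := a)) / of_nat n) * ((z(b := a)) b - a) ^ n = 0"
    for n by simp
  then show ?thesis unfolding slice_primitive_def by (simp only: suminf_zero)
qed

lemma slice_primitive:
  assumes h: "curve_hol B p R h" and M: "\<And>z. z \<in> polydisc B p R \<Longrightarrow> norm (h z) \<le> M"
    and b: "b \<in> B" and "0 < R"
  shows "curve_hol B p (R/2) (slice_primitive b (p b) h)"
    and "\<exists>N. \<forall>z\<in>polydisc B p (R/2). norm (slice_primitive b (p b) h z) \<le> N"
    and "z \<in> polydisc B p (R/2) \<Longrightarrow>
      ((\<lambda>s. slice_primitive b (p b) h (z(b := s))) has_field_derivative h z) (at (z b))"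
proof -
  \<comment> \<open>Coefficients are of size \<open>M / r ^ k\<close> and points lie within
    \<open>R/2 = 2/3 * r\<close>, so the series is dominated by the geometric series
    \<open>N\<close> of ratio 2/3.\<close>
  define r where "r = 3 / 4 * R"
  have r: "0 < r" "r < R" "R/2 < r" using assms(4) by (auto simp: r_def)
  have M0: "0 \<le> M"
    using order_trans[OF norm_ge_zero M[of p]] assms(4) by (simp add: polydisc_def)
  define T where "T n z = (if n = 0 then 0 else slice_coeff b (p b) (n - 1) h z / of_nat n) * (z b - p b) ^ n"
    for n z
  define N where "N n = M * r * (2/3) ^ n" for n :: nat
  have T: "norm (T n z) \<le> N n" if z: "z \<in> polydisc B p (R/2)" for n z
  proof (cases n)
    case (Suc k)
    have zr: "z \<in> polydisc B p R" using z polydisc_mono[of "R/2" R B p] assms(4) by auto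
    have "norm (slice_coeff b (p b) k h z) \<le> M / r ^ k"
    proof (rule slice_coeff_bound[OF h M r(1,2)])
      show "z(b := p b) \<in> polydisc B p R" using zr assms(4) by (auto simp: polydisc_def)
    qed
    moreover have "norm (z b - p b) \<le> R/2" using z b by (force simp: polydisc_def)
    ultimately have "norm (slice_coeff b (p b) k h z) * norm (z b - p b) ^ n \<le> M / r ^ k * (R/2) ^ n"
      using M0 r by (intro mult_mono power_mono) auto
    also have "(R/2) = 2/3 * r" by (simp add: r_def)
    also have "M / r ^ k * (2/3 * r) ^ n = N n"
      unfolding power_mult_distrib N_def using r(1) Suc by (simp add: field_simps)
    finally have *: "norm (slice_coeff b (p b) k h z) * norm (z b - p b) ^ n \<le> N n" .
    have "norm (T n z) = norm (slice_coeff b (p b) k h z) * norm (z b - p b) ^ n / real n"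
      by (simp add: T_def Suc norm_mult norm_divide norm_power del: of_nat_Suc power_Suc)
    also have "\<dots> \<le> norm (slice_coeff b (p b) k h z) * norm (z b - p b) ^ n / 1"
      by (rule divide_left_mono) (auto simp: Suc)
    finally show ?thesis using * by simp
  qed (use M0 r in \<open>simp add: T_def N_def\<close>)
  have sN: "summable N"
    unfolding N_def by (intro summable_mult summable_geometric) auto
  have eq: "slice_primitive b (p b) h z = (suminf (\<lambda>n. T n z))" for z
    by (simp add: slice_primitive_def T_def)
  have hol: "curve_hol B p (R/2) (\<lambda>z. \<Sum>n<m. T n z)" for m
  proof (rule curve_holI, rule holomorphic_on_sum)
    fix \<gamma> S n assume S: "open S" "\<And>b. b \<in> B \<Longrightarrow> (\<lambda>t. \<gamma> t b) holomorphic_on S"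
      "\<And>t. t \<in> S \<Longrightarrow> \<gamma> t \<in> polydisc B p (R/2)"
    have Sr: "\<gamma> t \<in> polydisc (B - {b}) p r" if "t \<in> S" for t
      using S(3)[OF that] r(3) by (fastforce simp: polydisc_def)
    have "(\<lambda>t. slice_coeff b (p b) k h (\<gamma> t)) holomorphic_on S" for k
      by (rule curve_holD[OF curve_hol_slice_coeff[OF h M b r(1,2)] S(1)])
        (use S Sr in auto)
    then show "(\<lambda>t. T n (\<gamma> t)) holomorphic_on S"
      unfolding T_def by (cases "n = 0") (auto intro!: holomorphic_intros S b)
  qed
  show "curve_hol B p (R/2) (slice_primitive b (p b) h)"
    by (rule curve_hol_uniform_limit[OF hol])
      (use Weierstrass_m_test[OF T sN] in \<open>simp add: eq[abs_def]\<close>)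
  have sT: "summable (\<lambda>n. norm (T n z))" if "z \<in> polydisc B p (R/2)" for z
    by (rule summable_comparison_test'[OF sN]) (use T[OF that] in simp)
  have "norm (slice_primitive b (p b) h z) \<le> suminf N" if "z \<in> polydisc B p (R/2)" for z
  proof -
    have "norm (suminf (\<lambda>n. T n z)) \<le> (suminf (\<lambda>n. norm (T n z)))" by (rule summable_norm[OF sT[OF that]])
    also have "\<dots> \<le> suminf N" by (rule suminf_le[OF T[OF that] sT[OF that] sN])
    finally show ?thesis by (simp add: eq)
  qed
  then show "\<exists>N. \<forall>z\<in>polydisc B p (R/2). norm (slice_primitive b (p b) h z) \<le> N" by blast
  assume z: "z \<in> polydisc B p (R/2)"
  define c where "c n = (if n = 0 then 0 else slice_coeff b (p b) (n - 1) h z / of_nat n)" for n :: nat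
  have zb: "norm (z b - p b) < R/2" using z b by (simp add: polydisc_def)
  \<comment> \<open>Convergence at the larger radius \<open>K\<close> permits termwise
    differentiation at \<open>z b\<close>.\<close>
  obtain K where K: "norm (z b - p b) < K" "K < R/2" using zb dense by blast
  have "summable (\<lambda>n. c n * of_real K ^ n)"
  proof -
    have K0: "0 < K" using K(1) norm_ge_zero order_le_less_trans by blast
    have "z(b := p b + of_real K) \<in> polydisc B p (R/2)"
      using z K K0 by (auto simp: polydisc_def)
    from summable_norm_cancel[OF sT[OF this]] show ?thesis
      unfolding T_def c_def slice_coeff_upd by simp
  qed
  then have "((\<lambda>x. suminf (\<lambda>n. c n * x ^ n)) has_field_derivative (suminf (\<lambda>n. diffs c n * (z b - p b) ^ n))) (at (z b - p b))"
    by (rule termdiffs_strong) (use K norm_ge_zero[of "z b - p b"] in \<open>simp add: abs_of_pos\<close>)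
  moreover have "diffs c = (\<lambda>n. slice_coeff b (p b) n h z)"
    by (simp add: diffs_def c_def fun_eq_iff del: of_nat_Suc)
  moreover have "(suminf (\<lambda>n. slice_coeff b (p b) n h z * (z b - p b) ^ n)) = h z"
    using sums_unique[OF slice_coeff_sums[OF h _ b, of z]] z polydisc_mono[of "R/2" R B p] assms(4) by auto
  ultimately have "((\<lambda>x. suminf (\<lambda>n. c n * x ^ n)) has_field_derivative h z) (at (z b - p b))" by simp
  then have "((\<lambda>s. suminf (\<lambda>n. c n * (s - p b) ^ n)) has_field_derivative h z) (at (z b))"
    using DERIV_at_within_shift[of "\<lambda>x. suminf (\<lambda>n. c n * x ^ n)" "h z" "- p b" "z b" UNIV] by simp
  moreover have "slice_primitive b (p b) h (z(b := s)) = (suminf (\<lambda>n. c n * (s - p b) ^ n))" for s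
    unfolding slice_primitive_def c_def slice_coeff_upd by simp
  ultimately show "((\<lambda>s. slice_primitive b (p b) h (z(b := s))) has_field_derivative h z) (at (z b))"
    by simp
qed

text \<open>The complex primitive is real at real points: along \<open>b\<close> its imaginary part
  has derivative 0, and it vanishes where coordinate \<open>b\<close> equals that of
  \<open>p\<close>. Its real part therefore has the complex primitive as extension.\<close>

theorem cext_primitive:
  fixes f :: "'a::euclidean_space \<Rightarrow> real"
  assumes f: "cext f p" and b: "b \<in> Basis"
  shows "\<exists>\<Phi>. cext \<Phi> p \<and> (\<forall>\<^sub>F x in nhds p. ((\<lambda>t. \<Phi> (x + t *\<^sub>R b)) has_real_derivative f x) (at 0))"
proof -
  obtain R M h where R: "0 < R" and h: "extends_on f p R M h" using f cextE by blast
  let ?H = "slice_primitive b (cplx p b) h"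
  have hM: "norm (h z) \<le> M" if "z \<in> cdisc p R" for z
    using extends_onD(2)[OF h that] .
  have H: "curve_hol Basis (cplx p) (R/2) ?H"
    "\<exists>N. \<forall>z\<in>cdisc p (R/2). norm (?H z) \<le> N"
    "\<And>z. z \<in> cdisc p (R/2) \<Longrightarrow> ((\<lambda>s. ?H (z(b := s))) has_field_derivative h z) (at (z b))"
    by (fact slice_primitive(1)[OF extends_onD(1)[OF h] hM b R, simplified]
        slice_primitive(2)[OF extends_onD(1)[OF h] hM b R, simplified]
        slice_primitive(3)[OF extends_onD(1)[OF h] hM b R, simplified])+
  have real: "((\<lambda>s. ?H (cplx (x + (s - x \<bullet> b) *\<^sub>R b))) has_vector_derivative of_real (f x)) (at (x \<bullet> b))"
    if x: "cplx x \<in> cdisc p (R/2)" for x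
  proof -
    have x': "cplx x \<in> cdisc p R" using x polydisc_mono[of "R/2" R] R by fastforce
    have "((\<lambda>s. ?H ((cplx x)(b := s))) has_field_derivative of_real (f x)) (at (of_real (x \<bullet> b)))"
      using H(3)[OF x] extends_onD(3)[OF h x'] b by (simp add: cplx_def)
    from has_vector_derivative_real_field[OF this] show ?thesis by (simp add: cplx_upd[OF b])
  qed
  have Im0: "Im (?H (cplx x)) = 0" if x: "cplx x \<in> cdisc p (R/2)" for x
  proof -
    define y where "y s = x + (s - x \<bullet> b) *\<^sub>R b" for s
    have yb: "y s \<bullet> b = s" for s using b by (simp add: y_def inner_add_left)
    have yy: "y s + (u - y s \<bullet> b) *\<^sub>R b = y u" for s u
      unfolding yb by (simp add: y_def algebra_simps)
    have yin: "cplx (y s) \<in> cdisc p (R/2)" if "\<bar>s - p \<bullet> b\<bar> < R/2" for s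
    proof -
      have "\<bar>(y s - p) \<bullet> c\<bar> < R/2" if c: "c \<in> Basis" for c
      proof (cases "c = b")
        case True
        then show ?thesis using \<open>\<bar>s - p \<bullet> b\<bar> < R/2\<close> yb by (simp add: inner_diff_left)
      next
        case False
        then have "y s \<bullet> c = x \<bullet> c" using b c by (simp add: y_def inner_add_left inner_Basis)
        then show ?thesis using x c by (simp add: cplx_in_polydisc inner_diff_left)
      qed
      then show ?thesis by (simp add: cplx_in_polydisc)
    qed
    have d: "((\<lambda>s. Im (?H (cplx (y s)))) has_field_derivative 0) (at s)" if "\<bar>s - p \<bullet> b\<bar> < R/2" for s
    proof -
      have "((\<lambda>s. ?H (cplx (y s))) has_vector_derivative of_real (f (y s))) (at s)"
        using real[OF yin[OF that]] unfolding yy unfolding yb .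
      then have "((\<lambda>s. Im (?H (cplx (y s)))) has_vector_derivative Im (of_real (f (y s)))) (at s)"
        by (intro bounded_linear.has_vector_derivative[OF bounded_linear_Im])
      then show ?thesis by (simp add: has_real_derivative_iff_has_vector_derivative)
    qed
    have "\<exists>c. \<forall>s\<in>ball (p \<bullet> b) (R/2). Im (?H (cplx (y s))) = c"
    proof (rule has_field_derivative_zero_constant)
      show "((\<lambda>s. Im (?H (cplx (y s)))) has_field_derivative 0) (at s within ball (p \<bullet> b) (R/2))"
        if "s \<in> ball (p \<bullet> b) (R/2)" for s
        using d[of s] that by (auto simp: dist_real_def abs_minus_commute intro: has_field_derivative_at_within)
    qed simp
    moreover have "x \<bullet> b \<in> ball (p \<bullet> b) (R/2)"
      using x b by (auto simp: cplx_in_polydisc dist_real_def abs_minus_commute inner_diff_left)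
    moreover have "p \<bullet> b \<in> ball (p \<bullet> b) (R/2)" using R by simp
    ultimately have "Im (?H (cplx (y (x \<bullet> b)))) = Im (?H (cplx (y (p \<bullet> b))))" by metis
    moreover have "?H (cplx (y (p \<bullet> b))) = 0"
    proof -
      have "cplx (y (p \<bullet> b)) = (cplx x)(b := cplx p b)"
        using cplx_upd[OF b, of x "p \<bullet> b"] b by (simp add: y_def cplx_def)
      then show ?thesis by (simp add: slice_primitive_center)
    qed
    moreover have "y (x \<bullet> b) = x" by (simp add: y_def)
    ultimately show ?thesis by simp
  qed
  define \<Phi> where "\<Phi> x = Re (?H (cplx x))" for x
  obtain N where N: "\<forall>z\<in>cdisc p (R/2). norm (?H z) \<le> N" using H(2) by blast
  have "extends_on \<Phi> p (R/2) N ?H"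
    unfolding extends_on_def using H(1) N Im0 by (auto simp: \<Phi>_def complex_eq_iff)
  then have "cext \<Phi> p" using cextI[of "R/2"] R by simp
  moreover have "((\<lambda>t. \<Phi> (x + t *\<^sub>R b)) has_real_derivative f x) (at 0)" if "dist x p < R/2" for x
  proof -
    have x: "cplx x \<in> cdisc p (R/2)"
      by (rule cplx_ball) (use that in \<open>simp add: dist_commute\<close>)
    have "((\<lambda>s. \<Phi> (x + (s - x \<bullet> b) *\<^sub>R b)) has_vector_derivative Re (of_real (f x))) (at (x \<bullet> b))"
      unfolding \<Phi>_def by (rule bounded_linear.has_vector_derivative[OF bounded_linear_Re real[OF x]])
    then have "((\<lambda>s. \<Phi> (x + (s - x \<bullet> b) *\<^sub>R b)) has_real_derivative f x) (at (x \<bullet> b))"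
      by (simp add: has_real_derivative_iff_has_vector_derivative)
    then show ?thesis
      using DERIV_at_within_shift[of "\<lambda>s. \<Phi> (x + (s - x \<bullet> b) *\<^sub>R b)" "f x" "x \<bullet> b" 0 UNIV] by simp
  qed
  ultimately show ?thesis
    using R unfolding eventually_nhds_metric by (intro exI[of _ \<Phi>] conjI exI[of _ "R/2"]) auto
qed

section \<open>The analytic implicit function theorem\<close>

definition join :: "('a::euclidean_space \<Rightarrow> complex) \<Rightarrow> complex \<Rightarrow> ('a \<times> real) \<Rightarrow> complex" where
  "join w z b = (if b = (0, 1) then z else if b \<in> Basis then w (fst b) else 0)"

lemma Basis_prod_real:
  "b \<in> (Basis :: ('a::euclidean_space \<times> real) set) \<Longrightarrow> b = (0, 1) \<or> (\<exists>u\<in>Basis. b = (u, 0))"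
  by (auto simp: Basis_prod_def)

lemma zero_one_Basis: "(0, 1) \<in> (Basis :: ('a::euclidean_space \<times> real) set)"
  by (auto simp: Basis_prod_def)

lemma cplx_join: "cplx (q, x) = join (cplx q) (of_real x)"
proof
  fix b :: "'a \<times> real"
  show "cplx (q, x) b = join (cplx q) (of_real x) b"
  proof (cases "b \<in> Basis")
    case True
    then consider "b = (0, 1)" | u where "u \<in> Basis" "b = (u, 0)"
      using Basis_prod_real by blast
    then show ?thesis
      using True by cases (auto simp: join_def cplx_def inner_prod_def)
  next
    case False
    then show ?thesis using zero_one_Basis by (auto simp: join_def cplx_def)
  qed
qed

lemma join_polydisc:
  fixes q0 :: "'a::euclidean_space"
  assumes "w \<in> cdisc q0 R" "norm (z - of_real x0) < R"
  shows "join w z \<in> cdisc (q0, x0) R"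
proof -
  have "norm (join w z b - join (cplx q0) (of_real x0) b) < R" if b: "b \<in> Basis" for b :: "'a \<times> real"
    using Basis_prod_real[OF b] b assms by (auto simp: join_def polydisc_def)
  then show ?thesis unfolding cplx_join polydisc_def by blast
qed

lemma holomorphic_join:
  assumes "\<And>b. b \<in> Basis \<Longrightarrow> (\<lambda>t. \<gamma> t b) holomorphic_on S" "\<zeta> holomorphic_on S" "b \<in> Basis"
  shows "(\<lambda>t. join (\<gamma> t) (\<zeta> t) b) holomorphic_on S"
  using Basis_prod_real[OF assms(3)] assms by (auto simp: join_def)

lemma join_upd: "(join w z)((0, 1) := s) = join w s"
  by (auto simp: join_def)

text \<open>Newton iteration with the derivative frozen at the centre,
  \<open>z - h (join w z) / A\<close>. It contracts a closed disc by the factor 1/2 uniformly in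
  \<open>w\<close>; its iterates are holomorphic along curves and real at real points, and both
  properties pass to the uniform limit.\<close>

theorem cext_implicit_function:
  fixes F :: "'a::euclidean_space \<times> real \<Rightarrow> real"
  assumes F: "cext F (q0, x0)" and zero: "F (q0, x0) = 0"
    and A: "((\<lambda>x. F (q0, x)) has_real_derivative A) (at x0)" "A \<noteq> 0"
  shows "\<exists>X. cext X q0 \<and> X q0 = x0 \<and> (\<forall>\<^sub>F q in nhds q0. F (q, X q) = 0)"
proof -
  let ?b = "(0, 1) :: 'a \<times> real" and ?p = "cplx (q0, x0)"
  obtain R M h where R: "0 < R" and h: "extends_on F (q0, x0) R M h" using F cextE by blast
  have M: "norm (h z) \<le> M" if "z \<in> polydisc Basis ?p R" for z using extends_onD(2)[OF h that] .
  have pp: "?p \<in> polydisc Basis ?p s1" if "0 < s1" for s1 using cplx_center[OF that] .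
  have slice: "((\<lambda>s. h (join w s)) has_field_derivative cderiv ?b h (join w z)) (at z)"
    if "w \<in> cdisc q0 R" "norm (z - of_real x0) < R" for w z
  proof -
    have "(\<lambda>s. h (join w s)) holomorphic_on ball (of_real x0) R"
      using curve_hol_slice[OF extends_onD(1)[OF h] join_polydisc[OF that], of ?b]
      by (simp add: join_upd cplx_join) (simp add: join_def)
    moreover have "z \<in> ball (of_real x0) R" using that by (simp add: dist_norm norm_minus_commute)
    moreover have "cderiv ?b h (join w z) = deriv (\<lambda>s. h (join w s)) z"
      by (simp add: cderiv_def join_upd) (simp add: join_def)
    ultimately show ?thesis using holomorphic_derivI[OF _ open_ball] by metis
  qed
  have DA: "cderiv ?b h ?p = of_real A"
  proof (rule deriv_real_on_reals[OF _ A(1)])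
    show "((\<lambda>s. h (join (cplx q0) s)) has_field_derivative cderiv ?b h ?p) (at (of_real x0))"
      unfolding cplx_join by (rule slice) (use R in \<open>auto simp: polydisc_def\<close>)
    have "h (join (cplx q0) (of_real s)) = of_real (F (q0, s))" if "dist s x0 < R" for s
    proof -
      have "norm (complex_of_real s - of_real x0) < R"
        using that by (simp only: of_real_diff[symmetric] norm_of_real dist_real_def)
      then have "cplx (q0, s) \<in> polydisc Basis ?p R"
        unfolding cplx_join[of q0 s] by (intro join_polydisc cplx_center R)
      then have "h (cplx (q0, s)) = of_real (F (q0, s))" by (rule extends_onD(3)[OF h])
      then show ?thesis by (simp only: cplx_join)
    qed
    then show "\<forall>\<^sub>F s in nhds x0. h (join (cplx q0) (of_real s)) = of_real (F (q0, s))"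
      unfolding eventually_nhds_metric using R by blast
  qed
  define D where "D = 2 * M / (R - R/2)"
  have cb: "norm (cderiv ?b h z) \<le> D" if "z \<in> polydisc Basis ?p (R/2)" for z
    unfolding D_def using bounded_cderiv[OF extends_onD(1)[OF h] M _ that zero_one_Basis] R by simp
  have ch: "curve_hol Basis ?p (R/2) (cderiv ?b h)"
    using curve_hol_subset[OF curve_hol_cderiv[OF extends_onD(1)[OF h] M zero_one_Basis]
        polydisc_mono[of "R/2" R]] R by simp
  have D0: "0 \<le> D" using order_trans[OF norm_ge_zero cb[OF pp]] R by simp
  \<comment> \<open>Chosen so that continuity of \<open>cderiv\<close> on the radius
    \<open>R/2\<close> keeps the derivative within |A|/2 of A, which gives the contraction factor
    1/2.\<close>
  define d where "d = min (R/8) (\<bar>A\<bar> * R / (16 * (D + 1)))"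
  have d: "0 < d" "d < R/2/2" "d < R" using R A(2) D0 by (auto simp: d_def)
  have near: "norm (1 - cderiv ?b h z / of_real A) \<le> 1/2" if z: "z \<in> polydisc Basis ?p d" for z
  proof -
    have "norm (cderiv ?b h z - cderiv ?b h ?p) \<le> 4 * D / (R/2) * d"
      by (rule bounded_curve_hol_continuous[OF ch cb d(1,2) z])
    also have "\<dots> \<le> 4 * D / (R/2) * (\<bar>A\<bar> * R / (16 * (D + 1)))"
      using R D0 by (intro mult_left_mono) (auto simp: d_def)
    also have "\<dots> = \<bar>A\<bar> / 2 * (D / (D + 1))" using R D0 by (simp add: field_simps)
    also have "\<dots> \<le> \<bar>A\<bar> / 2 * 1" using D0 by (intro mult_left_mono) auto
    finally have "norm (of_real A - cderiv ?b h z) \<le> \<bar>A\<bar> / 2" by (simp add: DA norm_minus_commute)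
    moreover have "1 - cderiv ?b h z / of_real A = (of_real A - cderiv ?b h z) / of_real A"
      using A(2) by (simp add: diff_divide_distrib)
    ultimately show ?thesis using A(2) by (simp add: norm_divide field_simps)
  qed
  define r where "r = d / 2"
  have r: "0 < r" "r < d" using d by (auto simp: r_def)
  \<comment> \<open>The first iteration then moves \<open>x0\<close> by at most
    \<open>r / 2\<close>; together with the contraction factor this keeps the disc of radius
    \<open>r\<close> invariant.\<close>
  obtain \<eta> where \<eta>: "0 < \<eta>" "\<eta> \<le> R" "\<And>z. z\<in>polydisc Basis ?p \<eta> \<Longrightarrow> norm (h z - h ?p) < \<bar>A\<bar> * r / 2"
    using extends_on_continuous[OF R h, of "\<bar>A\<bar> * r / 2"] A(2) r by auto
  define s1 where "s1 = min d \<eta>"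
  have s1: "0 < s1" "s1 \<le> d" "s1 \<le> \<eta>" using d \<eta> by (auto simp: s1_def)
  define T where "T w z = z - h (join w z) / of_real A" for w z
  let ?P = "cdisc q0 s1" and ?C = "cball (complex_of_real x0) r"
  have PC: "join w z \<in> polydisc Basis ?p d" if "w \<in> ?P" "z \<in> ?C" for w z
    using that r polydisc_mono[OF s1(2)] by (intro join_polydisc) (auto simp: dist_norm norm_minus_commute)
  have contr: "norm (T w z - T w z') \<le> 1/2 * norm (z - z')"
    if w: "w \<in> ?P" and z: "z \<in> ?C" "z' \<in> ?C" for w z z'
  proof (rule field_differentiable_bound[where S = ?C and f' = "\<lambda>z. 1 - cderiv ?b h (join w z) / of_real A"])
    fix y assume y: "y \<in> ?C"
    show "norm (1 - cderiv ?b h (join w y) / of_real A) \<le> 1/2" by (rule near[OF PC[OF w y]])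
    have "((\<lambda>s. h (join w s)) has_field_derivative cderiv ?b h (join w y)) (at y)"
    proof (rule slice)
      show "w \<in> cdisc q0 R" using w polydisc_mono[of s1 R] s1 d by fastforce
      show "norm (y - of_real x0) < R" using y r d by (simp add: dist_norm norm_minus_commute)
    qed
    then have "((\<lambda>s. s - h (join w s) / of_real A) has_field_derivative
        1 - cderiv ?b h (join w y) / of_real A) (at y)"
      by (intro DERIV_diff DERIV_ident DERIV_cdivide)
    then show "(T w has_field_derivative 1 - cderiv ?b h (join w y) / of_real A) (at y within ?C)"
      unfolding T_def[abs_def] by (rule has_field_derivative_at_within)
  qed (use z in auto)
  have hp: "h ?p = 0" using extends_onD(3)[OF h pp[OF R]] zero by simp
  have start: "norm (T w (of_real x0) - of_real x0) \<le> r / 2" if w: "w \<in> ?P" for w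
  proof -
    have "w \<in> cdisc q0 \<eta>" using w polydisc_mono[OF s1(3)] by blast
    then have "norm (h (join w (of_real x0)) - h ?p) < \<bar>A\<bar> * r / 2"
      by (intro \<eta>(3) join_polydisc) (use \<eta>(1) in auto)
    then show ?thesis using A(2) hp by (simp add: T_def norm_divide field_simps)
  qed
  have self: "T w z \<in> ?C" if w: "w \<in> ?P" and z: "z \<in> ?C" for w z
  proof -
    have "norm (T w z - T w (of_real x0)) \<le> 1/2 * norm (z - of_real x0)"
      by (rule contr[OF w z]) (use r in auto)
    also have "\<dots> \<le> r / 2" using z by (simp add: dist_norm norm_minus_commute)
    finally have "norm (T w z - of_real x0) \<le> r"
      using start[OF w] norm_triangle_ineq[of "T w z - T w (of_real x0)" "T w (of_real x0) - of_real x0"]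
      by simp
    then show ?thesis by (simp add: dist_norm norm_minus_commute)
  qed
  define X where "X k w = (T w ^^ k) (of_real x0)" for k w
  have X_Suc: "X (Suc k) w = T w (X k w)" for k w by (simp add: X_def)
  have XC: "X k w \<in> ?C" if w: "w \<in> ?P" for k w
    by (induction k) (use r self[OF w] in \<open>auto simp: X_def\<close>)
  have step: "norm (X (Suc k) w - X k w) \<le> r * (1/2) ^ k" if w: "w \<in> ?P" for k w
  proof (induction k)
    case 0
    then show ?case using start[OF w] r by (simp add: X_def)
  next
    case (Suc k)
    have "norm (X (Suc (Suc k)) w - X (Suc k) w) \<le> 1/2 * norm (X (Suc k) w - X k w)"
      unfolding X_Suc[of "Suc k"] X_Suc[of k] using contr[OF w, of "T w (X k w)" "X k w"] XC[OF w, of k] self[OF w] by simp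
    then show ?case using Suc by simp
  qed
  \<comment> \<open>The limit as a telescoping series, so that the Weierstrass test gives uniform
    convergence.\<close>
  define Y where "Y w = of_real x0 + suminf (\<lambda>k. X (Suc k) w - X k w)" for w
  have uni: "uniform_limit ?P X Y sequentially"
  proof -
    have "uniform_limit ?P (\<lambda>n w. \<Sum>k<n. X (Suc k) w - X k w) (\<lambda>w. suminf (\<lambda>k. X (Suc k) w - X k w)) sequentially"
      by (rule Weierstrass_m_test[OF step]) (auto intro!: summable_mult summable_geometric)
    then have "uniform_limit ?P (\<lambda>n w. of_real x0 + (\<Sum>k<n. X (Suc k) w - X k w)) Y sequentially"
      unfolding Y_def[abs_def] by (intro uniform_limit_add uniform_limit_const)
    moreover have "of_real x0 + (\<Sum>k<n. X (Suc k) w - X k w) = X n w" for n w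
      using sum_lessThan_telescope[of "\<lambda>k. X k w" n] by (simp add: X_def)
    ultimately show ?thesis by simp
  qed
  have lim: "(\<lambda>k. X k w) \<longlonglongrightarrow> Y w" if "w \<in> ?P" for w
    using tendsto_uniform_limitI[OF uni that] .
  have YC: "Y w \<in> ?C" if w: "w \<in> ?P" for w
    by (rule closed_sequentially[OF closed_cball _ lim[OF w]]) (use XC[OF w] in blast)
  have fix_Y: "h (join w (Y w)) = 0" if w: "w \<in> ?P" for w
  proof -
    have "(\<lambda>k. T w (X k w)) \<longlonglongrightarrow> T w (Y w)"
    proof (rule Lim_null[THEN iffD2], rule Lim_null_comparison)
      show "\<forall>\<^sub>F k in sequentially. norm (T w (X k w) - T w (Y w)) \<le> 1/2 * norm (X k w - Y w)"
        using contr[OF w XC[OF w] YC[OF w]] by simp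
      show "(\<lambda>k. 1/2 * norm (X k w - Y w)) \<longlonglongrightarrow> 0"
        using tendsto_mult_right_zero[OF tendsto_norm_zero[OF Lim_null[THEN iffD1, OF lim[OF w]]]] .
    qed
    moreover have "(\<lambda>k. T w (X k w)) \<longlonglongrightarrow> Y w"
      using LIMSEQ_Suc[OF lim[OF w]] by (simp add: X_Suc)
    ultimately have "T w (Y w) = Y w" using LIMSEQ_unique by blast
    then show ?thesis using A(2) by (simp add: T_def)
  qed
  have holX: "curve_hol Basis (cplx q0) s1 (X k)" for k
  proof (rule curve_holI)
    fix \<gamma> S assume S: "open S" "\<And>b. b \<in> Basis \<Longrightarrow> (\<lambda>t. \<gamma> t b) holomorphic_on S"
      "\<And>t. t \<in> S \<Longrightarrow> \<gamma> t \<in> ?P"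
    show "(\<lambda>t. X k (\<gamma> t)) holomorphic_on S"
    proof (induction k)
      case (Suc k)
      have "(\<lambda>t. h (join (\<gamma> t) (X k (\<gamma> t)))) holomorphic_on S"
      proof (rule curve_holD[OF extends_onD(1)[OF h] S(1)])
        show "(\<lambda>t. join (\<gamma> t) (X k (\<gamma> t)) b) holomorphic_on S" if "b \<in> Basis" for b
          by (rule holomorphic_join[OF S(2) Suc that])
        show "join (\<gamma> t) (X k (\<gamma> t)) \<in> polydisc Basis ?p R" if "t \<in> S" for t
          using PC[OF S(3) XC[OF S(3)]] that polydisc_mono[of d R] d(3) by (meson less_imp_le subsetD)
      qed
      then show ?case
        unfolding X_Suc T_def using A(2) by (intro holomorphic_intros Suc) auto
    qed (simp add: X_def)
  qed
  have holY: "curve_hol Basis (cplx q0) s1 Y"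
    by (rule curve_hol_uniform_limit[OF holX uni])
  have realY: "Im (Y (cplx q)) = 0" if q: "cplx q \<in> ?P" for q
  proof -
    have "Im (X k (cplx q)) = 0" for k
    proof (induction k)
      case (Suc k)
      define x where "x = Re (X k (cplx q))"
      have x: "X k (cplx q) = of_real x" using Suc by (simp add: x_def complex_eq_iff)
      have "cplx (q, x) \<in> polydisc Basis ?p R"
        using PC[OF q XC[OF q, of k]] polydisc_mono[of d R Basis ?p] d(3) by (auto simp: cplx_join x)
      then have "h (cplx (q, x)) = of_real (F (q, x))" by (rule extends_onD(3)[OF h])
      then have "h (join (cplx q) (of_real x)) = of_real (F (q, x))" by (simp only: cplx_join)
      then show ?case unfolding X_Suc x T_def by simp
    qed (simp add: X_def)
    then have "(\<lambda>k. 0) \<longlonglongrightarrow> Im (Y (cplx q))" using tendsto_Im[OF lim[OF q]] by simp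
    then show ?thesis using LIMSEQ_unique tendsto_const by blast
  qed
  define \<xi> where "\<xi> q = Re (Y (cplx q))" for q
  have \<xi>: "of_real (\<xi> q) = Y (cplx q)" if "cplx q \<in> ?P" for q
    using realY[OF that] by (simp add: \<xi>_def complex_eq_iff)
  have "extends_on \<xi> q0 s1 (norm (of_real x0 :: complex) + r) Y"
    unfolding extends_on_def
  proof (intro conjI ballI allI impI holY)
    show "norm (Y w) \<le> norm (of_real x0 :: complex) + r" if "w \<in> ?P" for w
      using YC[OF that] norm_triangle_sub[of "Y w" "of_real x0"] by (simp add: dist_norm norm_minus_commute)
  qed (use \<xi> in auto)
  then have "cext \<xi> q0" using s1(1) cextI by blast
  moreover have "\<xi> q0 = x0"
  proof -
    have "X k (cplx q0) = of_real x0" for k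
      by (induction k) (use hp in \<open>auto simp: X_def T_def cplx_join\<close>)
    then have "Y (cplx q0) = of_real x0" by (simp add: Y_def)
    then show ?thesis by (simp add: \<xi>_def)
  qed
  moreover have "F (q, \<xi> q) = 0" if "dist q q0 < s1" for q
  proof -
    have q: "cplx q \<in> ?P" by (rule cplx_ball) (use that in \<open>simp add: dist_commute\<close>)
    have "cplx (q, \<xi> q) \<in> polydisc Basis ?p R"
      using PC[OF q YC[OF q]] polydisc_mono[of d R Basis ?p] d(3) by (auto simp: cplx_join \<xi>[OF q])
    then have "h (cplx (q, \<xi> q)) = of_real (F (q, \<xi> q))" by (rule extends_onD(3)[OF h])
    then have "h (join (cplx q) (Y (cplx q))) = of_real (F (q, \<xi> q))"
      by (simp only: cplx_join \<xi>[OF q])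
    then show ?thesis using fix_Y[OF q] by simp
  qed
  ultimately show ?thesis
    using s1(1) unfolding eventually_nhds_metric by blast
qed

section \<open>Termination of the derivation-division sequence\<close>

abbreviation "keys \<equiv> Poly_Mapping.keys"
abbreviation "lookup \<equiv> Poly_Mapping.lookup"
abbreviation "single \<equiv> Poly_Mapping.single"
abbreviation lu :: "expo \<Rightarrow> var \<Rightarrow> int" where "lu \<equiv> lookup"

abbreviation eX :: "nat \<Rightarrow> expo" where "eX j \<equiv> single (XVar j) 1"

abbreviation eY :: "nat \<Rightarrow> expo" where "eY j \<equiv> single (YVar j) 1"

text \<open>The exponent vector of x_1 ... x_(j-1) / (y_1 ... y_(j-1)), the quotient that occurs in
  \<open>dvar j\<close>.\<close>

definition ratio_expo :: "nat \<Rightarrow> expo" where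
  "ratio_expo j = (\<Sum>i = 1..<j. eX i - eY i)"

lemma lookup_ratio_expo:
  "lu (ratio_expo j) (XVar l) = (if 1 \<le> l \<and> l < j then 1 else 0)"
  "lu (ratio_expo j) (YVar l) = (if 1 \<le> l \<and> l < j then - 1 else 0)"
proof -
  have "lu (ratio_expo j) (XVar l) = (\<Sum>i = 1..<j. if i = l then 1 else 0)"
    by (auto simp: ratio_expo_def lookup_sum lookup_minus lookup_single when_def intro!: sum.cong)
  then show "lu (ratio_expo j) (XVar l) = (if 1 \<le> l \<and> l < j then 1 else 0)" by simp
  have "lu (ratio_expo j) (YVar l) = (\<Sum>i = 1..<j. if i = l then - 1 else 0)"
    unfolding ratio_expo_def lookup_sum
    by (rule sum.cong) (auto simp: lookup_minus lookup_single when_def)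
  then show "lu (ratio_expo j) (YVar l) = (if 1 \<le> l \<and> l < j then - 1 else 0)" by simp
qed

lemma monom_mult: "monom a * monom b = monom (a + b)"
  by (simp add: monom_def mult_single)

lemma monom_zero: "monom 0 = 1"
  by (simp add: monom_def)

lemma monom_prod: "(\<Prod>i\<in>A. monom (f i)) = monom (\<Sum>i\<in>A. f i)"
  by (induction A rule: infinite_finite_induct) (auto simp: monom_mult monom_zero)

lemma dvar_eq: "dvar j = single (eX j + ratio_expo j) (Delta j)"
proof -
  have "ratio_expo j = (\<Sum>i = 1..<j. eX i) + (\<Sum>i = 1..<j. single (YVar i) (- 1))"
    by (simp add: ratio_expo_def sum.distrib[symmetric] single_uminus)
  then show ?thesis
    unfolding dvar_def varpow_def monom_prod by (simp add: const_def monom_def mult_single add.assoc)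
qed

lemma deriv_op_single:
  "deriv_op n (single m c) = (\<Sum>j = 1..n.
     single (m + ratio_expo j) (of_int (lu m (XVar j)) * c * Delta j) +
     single (m - eY j + eX j + ratio_expo j)
       (of_int (lu m (YVar j)) * c * Delta j))"
  unfolding deriv_op_def by (rule sum.cong) (auto simp: partial_single dvar_eq mult_single algebra_simps)

lemma deriv_op_zero: "deriv_op n 0 = 0"
  by (simp add: deriv_op_def partial_zero)

lemma deriv_op_sum: "deriv_op n (\<Sum>i\<in>A. f i) = (\<Sum>i\<in>A. deriv_op n (f i))"
  by (induction A rule: infinite_finite_induct) (auto simp: deriv_op_zero deriv_op_add)

lemma sum_single_keys:
  "(\<Sum>m\<in>keys p. single m (lookup p m)) = p"
  by (rule poly_mapping_eqI) (auto simp: lookup_sum lookup_single when_def in_keys_iff sum.delta)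

text \<open>The monomials produced by differentiating a power of x_j or of y_j. The conditions on
  the exponents record that a zero exponent produces nothing, so that a nonnegative power of y_j
  never becomes negative.\<close>

definition expo_step :: "nat \<Rightarrow> expo \<Rightarrow> expo \<Rightarrow> bool" where
  "expo_step j m m' \<longleftrightarrow> (lu m (XVar j) \<noteq> 0 \<and> m' = m + ratio_expo j) \<or>
     (lu m (YVar j) \<noteq> 0 \<and> m' = m - eY j + eX j + ratio_expo j)"

definition expo_succ :: "nat \<Rightarrow> expo \<Rightarrow> expo \<Rightarrow> bool" where
  "expo_succ n m m' \<longleftrightarrow> (\<exists>j\<in>{1..n}. expo_step j m m')"

text \<open>Terms may cancel, so not every successor survives; the descent argument asks only that
  each surviving monomial has a predecessor.\<close>

lemma keys_deriv_op:
  assumes "m' \<in> keys (deriv_op n p)"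
  shows "\<exists>m\<in>keys p. expo_succ n m m'"
proof -
  have "deriv_op n p = (\<Sum>m\<in>keys p. deriv_op n (single m (lookup p m)))"
    by (subst sum_single_keys[of p, symmetric]) (simp only: deriv_op_sum)
  then obtain m where m: "m \<in> keys p"
    "m' \<in> keys (deriv_op n (single m (lookup p m)))"
    using assms keys_sum[of "\<lambda>m. deriv_op n (single m (lookup p m))" "keys p"]
    by auto
  then obtain j where j: "j \<in> {1..n}" "m' \<in> keys
      (single (m + ratio_expo j) (of_int (lu m (XVar j)) * lookup p m * Delta j) +
       single (m - eY j + eX j + ratio_expo j) (of_int (lu m (YVar j)) * lookup p m * Delta j))"
    using subsetD[OF keys_sum m(2)[unfolded deriv_op_single]] by blast
  from subsetD[OF Poly_Mapping.keys_add j(2)] have "expo_step j m m'"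
    by (auto simp: expo_step_def split: if_splits)
  then show ?thesis using m(1) j(1) unfolding expo_succ_def by blast
qed

section \<open>Multihomogeneous elements\<close>

definition homog :: "(nat \<Rightarrow> int) \<Rightarrow> lpoly \<Rightarrow> bool" where
  "homog d p \<longleftrightarrow> (\<forall>m\<in>keys p. expo_deg m = d)"

lemma expo_deg_add: "expo_deg (a + b) j = expo_deg a j + expo_deg b j"
  by (simp add: expo_deg_def lookup_add)

lemma expo_deg_succ: "expo_succ n m m' \<Longrightarrow> expo_deg m' j = expo_deg m j"
  by (auto simp: expo_succ_def expo_step_def expo_deg_def lookup_add lookup_minus lookup_ratio_expo lookup_single when_def)

lemma homog_deriv_op: "homog d p \<Longrightarrow> homog d (deriv_op n p)"
  unfolding homog_def using keys_deriv_op expo_deg_succ by (metis ext)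

lemma homog_add: "homog d p \<Longrightarrow> homog d q \<Longrightarrow> homog d (p + q)"
  unfolding homog_def using Poly_Mapping.keys_add[of p q] by blast

lemma homog_zero: "homog d 0"
  by (simp add: homog_def)

lemma homog_sum: "(\<And>i. i \<in> A \<Longrightarrow> homog d (f i)) \<Longrightarrow> homog d (\<Sum>i\<in>A. f i)"
  by (induction A rule: infinite_finite_induct) (auto intro: homog_add homog_zero)

lemma homog_mult:
  assumes "homog d p" "homog d' q"
  shows "homog (\<lambda>j. d j + d' j) (p * q)"
proof -
  have "keys (p * q) \<subseteq> {a + b | a b. a \<in> keys p \<and> b \<in> keys q}"
    by (rule keys_mult)
  then show ?thesis using assms unfolding homog_def by (fastforce simp: expo_deg_add)
qed

lemma homog_const: "homog (\<lambda>_. 0) (const c)"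
  by (auto simp: homog_def const_def expo_deg_def split: if_splits)

lemma homog_monom: "homog (expo_deg m) (monom m)"
  by (auto simp: homog_def monom_def)

lemma homog_cong: "homog d p \<Longrightarrow> (\<And>j. d j = d' j) \<Longrightarrow> homog d' p"
  by (metis ext)

lemma expo_deg_sum: "expo_deg (\<Sum>i\<in>A. f i) j = (\<Sum>i\<in>A. expo_deg (f i) j)"
  by (simp add: expo_deg_def lookup_sum sum.distrib)

lemma homog_dd_start: "homog (\<lambda>l. if 1 \<le> l \<and> l < n then 1 else 0) (dd_start n)"
proof -
  let ?d = "\<lambda>l. if 1 \<le> l \<and> l < n then 1 else 0 :: int"
  have *: "homog ?d (const (Delta j - Delta (j - 1)) * (\<Prod>i = 1..<j. varpow (XVar i) 1) * (\<Prod>i = j..<n. varpow (YVar i) 1))"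
    if "j \<in> {1..n}" for j
    unfolding varpow_def monom_prod
  proof (rule homog_cong[OF homog_mult[OF homog_mult[OF homog_const homog_monom] homog_monom]])
    fix l
    have "expo_deg (\<Sum>i = 1..<j. eX i) l = (\<Sum>i = 1..<j. if i = l then 1 else 0)"
      unfolding expo_deg_sum by (rule sum.cong) (auto simp: expo_deg_def lookup_single when_def)
    moreover have "expo_deg (\<Sum>i = j..<n. eY i) l = (\<Sum>i = j..<n. if i = l then 1 else 0)"
      unfolding expo_deg_sum by (rule sum.cong) (auto simp: expo_deg_def lookup_single when_def)
    ultimately show "0 + expo_deg (\<Sum>i = 1..<j. eX i) l +
        expo_deg (\<Sum>i = j..<n. eY i) l = ?d l"
      using that by auto
  qed
  show ?thesis
    unfolding dd_start_def
    by (rule homog_cong[OF homog_mult[OF homog_const homog_sum[OF *]]]) auto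
qed

text \<open>The combinatorial content of \<open>reg_expo\<close>: for homogeneous elements the
  regularization monomial depends on the support alone, and \<open>d - n1\<close> is the least
  exponent of y_j.\<close>

primrec min_expo :: "nat \<Rightarrow> expo set \<Rightarrow> expo" where
  "min_expo 0 S = 0"
| "min_expo (Suc j) S =
     single (XVar (Suc j)) (Min ((\<lambda>m. lu m (XVar (Suc j))) ` S)) +
     single (YVar (Suc j)) (Min ((\<lambda>m. lu m (YVar (Suc j))) ` S)) +
     min_expo j {m\<in>S. lu m (XVar (Suc j)) = Min ((\<lambda>m. lu m (XVar (Suc j))) ` S)}"

primrec var_index :: "var \<Rightarrow> nat" where
  "var_index (XVar j) = j"
| "var_index (YVar j) = j"

lemma lookup_min_expo_outside: "var_index v \<notin> {1..j} \<Longrightarrow> lu (min_expo j S) v = 0"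
  by (induction j arbitrary: S) (auto simp: lookup_add lookup_single when_def)

lemma Min_filter_nonempty:
  assumes "finite S" "S \<noteq> {}"
  shows "{m\<in>S. f m = Min (f ` S)} \<noteq> {}"
proof -
  have "Min (f ` S) \<in> f ` S" using assms by (intro Min_in) auto
  then show ?thesis by auto
qed

text \<open>Minima commute with translations and the set of minimizers is translated along; only
  coordinates of index at most \<open>j\<close> are seen.\<close>

lemma min_expo_shift:
  assumes "finite S" "S \<noteq> {}" "var_index v \<in> {1..j}"
  shows "lu (min_expo j ((\<lambda>m. m + c) ` S)) v = lu (min_expo j S) v + lu c v"
  using assms
proof (induction j arbitrary: S)
  case (Suc j)
  let ?X = "\<lambda>m. lu m (XVar (Suc j))"
  have M: "Min ((\<lambda>m. lu m v) ` (\<lambda>m. m + c) ` S) = Min ((\<lambda>m. lu m v) ` S) + lu c v" for v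
  proof -
    have "Min ((\<lambda>m. lu m v) ` S) + lu c v = Min ((\<lambda>x. x + lu c v) ` (\<lambda>m. lu m v) ` S)"
      using Suc.prems by (intro mono_Min_commute) (auto simp: mono_def)
    then show ?thesis by (simp add: image_image lookup_add)
  qed
  have F: "{m \<in> (\<lambda>m. m + c) ` S. ?X m = Min (?X ` (\<lambda>m. m + c) ` S)} = (\<lambda>m. m + c) ` {m \<in> S. ?X m = Min (?X ` S)}"
    unfolding M by (auto simp: lookup_add)
  let ?S = "{m \<in> S. ?X m = Min (?X ` S)}"
  have "finite ?S" "?S \<noteq> {}"
    using Suc.prems(1) Min_filter_nonempty[OF Suc.prems(1,2), of ?X] by simp_all
  then have IH: "var_index v \<in> {1..j} \<Longrightarrow>
      lu (min_expo j ((\<lambda>m. m + c) ` ?S)) v = lu (min_expo j ?S) v + lu c v"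
    by (rule Suc.IH)
  show ?case
  proof (cases "var_index v = Suc j")
    case True
    then show ?thesis
      using lookup_min_expo_outside[of v j] unfolding min_expo.simps F M
      by (cases v) (auto simp: lookup_add lookup_single when_def)
  next
    case False
    then show ?thesis
      using IH Suc.prems(3) unfolding min_expo.simps F
      by (cases v) (auto simp: lookup_add lookup_single when_def)
  qed
qed auto

lemma min_expo_shift_high:
  assumes "finite S" "S \<noteq> {}" "\<And>v. var_index v \<in> {1..j} \<Longrightarrow> lu c v = 0"
  shows "min_expo j ((\<lambda>m. m + c) ` S) = min_expo j S"
proof (rule poly_mapping_eqI)
  show "lu (min_expo j ((\<lambda>m. m + c) ` S)) v = lu (min_expo j S) v" for v
    using min_expo_shift[OF assms(1,2), of v j c] lookup_min_expo_outside[of v j] assms(3)[of v]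
    by (cases "var_index v \<in> {1..j}") auto
qed

text \<open>Division by the regularization monomial thus leaves a support with
  \<open>min_expo j S = 0\<close>, the condition by which regularized elements are recognized
  below.\<close>

lemma min_expo_normalize:
  assumes "finite S" "S \<noteq> {}"
  shows "min_expo j ((\<lambda>m. m - min_expo j S) ` S) = 0"
proof (rule poly_mapping_eqI)
  have eq: "(\<lambda>m. m - min_expo j S) ` S = (\<lambda>m. m + - min_expo j S) ` S" by auto
  show "lu (min_expo j ((\<lambda>m. m - min_expo j S) ` S)) v = lu 0 v" for v
    using min_expo_shift[OF assms, of v j "- min_expo j S"] lookup_min_expo_outside[of v j]
    unfolding eq by (cases "var_index v \<in> {1..j}") auto
qed

lemma keys_sum_single:
  assumes "finite A" "inj_on f A" "\<And>a. a \<in> A \<Longrightarrow> g a \<noteq> 0"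
  shows "keys (\<Sum>a\<in>A. single (f a) (g a)) = f ` A"
proof -
  have "lookup (\<Sum>a\<in>A. single (f a) (g a)) (f b) = g b" if "b \<in> A" for b
  proof -
    have "lookup (\<Sum>a\<in>A. single (f a) (g a)) (f b) = (\<Sum>a\<in>A. if a = b then g a else 0)"
      unfolding lookup_sum by (rule sum.cong) (use assms(2) that in \<open>auto simp: lookup_single when_def inj_on_def\<close>)
    then show ?thesis using assms(1) that by simp
  qed
  moreover have "lookup (\<Sum>a\<in>A. single (f a) (g a)) k = 0" if "k \<notin> f ` A" for k
    unfolding lookup_sum by (rule sum.neutral) (use that in \<open>auto simp: lookup_single when_def\<close>)
  ultimately show ?thesis using assms(3) by (force simp: in_keys_iff)
qed

lemma pdeg_eq:
  assumes "homog d p" "p \<noteq> 0"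
  shows "pdeg p = d"
proof -
  obtain m where "m \<in> keys p" using assms(2) by (metis all_not_in_conv keys_eq_empty)
  then show ?thesis using assms(1) unfolding pdeg_def homog_def by (intro the_equality) auto
qed

text \<open>Homogeneity ties the exponent of y_j to that of x_j. Hence \<open>xy_coeff\<close>
  collects exactly the monomials with a given exponent of x_j, without cancellation, and the largest
  exponent of x_j belongs to the least one of y_j.\<close>

lemma reg_expo_eq:
  assumes "homog d p" "p \<noteq> 0"
  shows "reg_expo j p = min_expo j (keys p)"
  using assms
proof (induction j arbitrary: p d)
  case (Suc j)
  let ?S = "keys p" and ?d = "d (Suc j)"
  let ?X = "\<lambda>m. lu m (XVar (Suc j))" and ?Y = "\<lambda>m. lu m (YVar (Suc j))"
  have S: "finite ?S" "?S \<noteq> {}" using Suc.prems by (auto simp: keys_eq_empty)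
  have Y: "?Y m = ?d - ?X m" if "m \<in> ?S" for m
    using Suc.prems that by (force simp: homog_def expo_deg_def)
  define q where "q i = xy_coeff (Suc j) i (?d - i) p" for i
  \<comment> \<open>Removing the top variables is a translation that \<open>min_expo j\<close> does
    not see.\<close>
  define c where "c i = - single (XVar (Suc j)) i - single (YVar (Suc j)) (?d - i)" for i
  have keys: "keys (q i) = (\<lambda>m. m + c i) ` {m\<in>?S. ?X m = i}" for i
  proof -
    have "{m. m \<in> ?S \<and> ?X m = i \<and> ?Y m = ?d - i} = {m\<in>?S. ?X m = i}" using Y by auto
    then have "q i = (\<Sum>m\<in>{m\<in>?S. ?X m = i}. single (m + c i) (lookup p m))"
      unfolding q_def xy_coeff_def by (simp add: c_def algebra_simps)
    then show ?thesis
      by (simp only:, intro keys_sum_single) (auto simp: inj_on_def in_keys_iff)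
  qed
  have q0: "q i \<noteq> 0 \<longleftrightarrow> i \<in> ?X ` ?S" for i
    using keys[of i] by (auto simp: keys_eq_empty[symmetric] simp del: keys_eq_empty)
  define a where "a = Min (?X ` ?S)"
  have Q: "{i. q i \<noteq> 0} = ?X ` ?S" using q0 by auto
  have YS: "Min (?Y ` ?S) = ?d - Max {i. q i \<noteq> 0}"
  proof -
    have "?Y ` ?S = (\<lambda>x. ?d - x) ` ?X ` ?S" using Y by (auto simp: image_image)
    moreover have "Min ((\<lambda>x. ?d - x) ` ?X ` ?S) = ?d - Max (?X ` ?S)"
      using S by (intro Min_eqI) auto
    ultimately show ?thesis by (simp add: Q)
  qed
  have "q a \<noteq> 0" using q0 Min_in[of "?X ` ?S"] S by (auto simp: a_def)
  moreover have "homog (\<lambda>l. d l + expo_deg (c a) l) (q a)"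
    using Suc.prems(1) unfolding homog_def keys by (auto simp: expo_deg_add)
  ultimately have "reg_expo j (q a) = min_expo j (keys (q a))"
    by (intro Suc.IH) auto
  also have "\<dots> = min_expo j {m\<in>?S. ?X m = a}"
    unfolding keys using S Min_filter_nonempty[OF S, of ?X]
    by (intro min_expo_shift_high) (auto simp: c_def a_def lookup_minus lookup_single when_def)
  finally have r: "reg_expo j (q a) = min_expo j {m\<in>?S. ?X m = a}" .
  have pd: "pdeg p (Suc j) = ?d" using pdeg_eq[OF Suc.prems(1,2)] by simp
  have "reg_expo (Suc j) p = single (XVar (Suc j)) a + single (YVar (Suc j)) (Min (?Y ` ?S))
      + reg_expo j (q a)"
    using YS Q by (simp add: Let_def pd q_def[symmetric] a_def)
  then show ?case using r by (simp add: a_def)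
qed auto

section \<open>Lexicographic descent of the multidegree\<close>

lemma keys_div_reg:
  "keys (div_reg n p) = (\<lambda>m. m - reg_expo n p) ` keys p"
proof -
  have "div_reg n p = (\<Sum>m\<in>keys p. single (m - reg_expo n p) (lookup p m))"
    unfolding div_reg_def
    by (subst sum_single_keys[of p, symmetric]) (simp add: sum_distrib_right monom_def mult_single)
  then show ?thesis
    by (simp only:, intro keys_sum_single) (auto simp: inj_on_def in_keys_iff)
qed

lemma min_expo_zeroD:
  assumes "min_expo (Suc j) S = 0"
  shows "Min ((\<lambda>m. lu m (XVar (Suc j))) ` S) = 0" "Min ((\<lambda>m. lu m (YVar (Suc j))) ` S) = 0"
    "min_expo j {m\<in>S. lu m (XVar (Suc j)) = 0} = 0"
proof -
  have "lu (min_expo (Suc j) S) (XVar (Suc j)) = 0" "lu (min_expo (Suc j) S) (YVar (Suc j)) = 0"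
    unfolding assms by simp_all
  then show *: "Min ((\<lambda>m. lu m (XVar (Suc j))) ` S) = 0" "Min ((\<lambda>m. lu m (YVar (Suc j))) ` S) = 0"
    using lookup_min_expo_outside[of "XVar (Suc j)" j] lookup_min_expo_outside[of "YVar (Suc j)" j]
    by (auto simp: lookup_add lookup_single when_def)
  show "min_expo j {m\<in>S. lu m (XVar (Suc j)) = 0} = 0"
    using assms unfolding min_expo.simps * by simp
qed

text \<open>The core of termination: among the degrees that regularizing a derivative changes, the
  one of highest index drops. If no power of the top variables splits off from \<open>T\<close>,
  consider the members of \<open>T\<close> free of the top x-variable. A differentiation at the top
  index leaves a positive power of that variable, so these members arise by lower differentiations
  from members of \<open>S\<close> free of it, and the induction hypothesis applies.\<close>

lemma min_expo_descent:
  assumes "min_expo j S = 0" "finite S" "finite T" "T \<noteq> {}"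
    "\<And>m'. m' \<in> T \<Longrightarrow> \<exists>m\<in>S. expo_succ j m m'"
  shows "\<exists>i\<in>{1..j}. (\<forall>l. i < l \<and> l \<le> j \<longrightarrow> expo_deg (min_expo j T) l = 0) \<and>
    0 < expo_deg (min_expo j T) i"
  using assms
proof (induction j arbitrary: S T)
  case 0
  then show ?case by (auto simp: expo_succ_def)
next
  case (Suc j)
  let ?X = "\<lambda>m. lu m (XVar (Suc j))" and ?Y = "\<lambda>m. lu m (YVar (Suc j))"
  note z = min_expo_zeroD[OF Suc.prems(1)]
  have S0: "0 \<le> ?X m" "0 \<le> ?Y m" if "m \<in> S" for m
    using z(1,2) Min_le[of "?X ` S" "?X m"] Min_le[of "?Y ` S" "?Y m"] that Suc.prems(2) by auto
  \<comment> \<open>A step at the top index lowers the exponent of y only where it is nonzero, hence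
    at least 1; steps at lower indices do not touch the top variables.\<close>
  have T0: "0 \<le> ?X m'" "0 \<le> ?Y m'" if "m' \<in> T" for m'
  proof -
    obtain m i where m: "m \<in> S" "i \<in> {1..Suc j}" and s: "expo_step i m m'"
      using Suc.prems(5)[OF \<open>m' \<in> T\<close>] unfolding expo_succ_def by blast
    show "0 \<le> ?X m'" "0 \<le> ?Y m'"
      using s S0[OF m(1)] m(2)
      by (auto simp: expo_step_def lookup_add lookup_minus lookup_ratio_expo lookup_single when_def)
  qed
  define a where "a = Min (?X ` T)"
  define b where "b = Min (?Y ` T)"
  have ab: "0 \<le> a" "0 \<le> b"
    using T0 Suc.prems(3,4) by (auto simp: a_def b_def)
  let ?T = "{m\<in>T. ?X m = a}"
  have top: "expo_deg (min_expo (Suc j) T) (Suc j) = a + b"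
    using lookup_min_expo_outside[of "XVar (Suc j)" j] lookup_min_expo_outside[of "YVar (Suc j)" j]
    by (simp add: expo_deg_def lookup_add lookup_single when_def a_def b_def)
  have low: "expo_deg (min_expo (Suc j) T) l = expo_deg (min_expo j ?T) l" if "l \<noteq> Suc j" for l
    using that by (simp add: expo_deg_def lookup_add lookup_single when_def a_def b_def)
  show ?case
  proof (cases "a + b = 0")
    case False
    then show ?thesis using ab top by (intro bexI[of _ "Suc j"]) auto
  next
    case True
    then have a0: "a = 0" using ab by simp
    have "\<exists>i\<in>{1..j}. (\<forall>l. i < l \<and> l \<le> j \<longrightarrow> expo_deg (min_expo j ?T) l = 0) \<and> 0 < expo_deg (min_expo j ?T) i"
    proof (rule Suc.IH[OF z(3)])
      show "finite {m \<in> S. ?X m = 0}" "finite ?T" using Suc.prems by auto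
      show "?T \<noteq> {}" unfolding a_def by (rule Min_filter_nonempty[OF Suc.prems(3,4)])
      fix m' assume m': "m' \<in> ?T"
      then obtain m i where m: "m \<in> S" and i: "i \<in> {1..Suc j}" and s: "expo_step i m m'"
        using Suc.prems(5) unfolding expo_succ_def by blast
      have X: "?X m' = 0" using m' a0 by simp
      have "?X m = 0 \<and> i \<noteq> Suc j"
        using s X S0[OF m] i
        by (auto simp: expo_step_def lookup_add lookup_minus lookup_ratio_expo lookup_single when_def split: if_splits)
      then show "\<exists>m\<in>{m \<in> S. ?X m = 0}. expo_succ j m m'"
        using s m i unfolding expo_succ_def by (intro bexI[of _ m] bexI[of _ i]) auto
    qed
    then obtain i where i: "i \<in> {1..j}" "\<And>l. i < l \<and> l \<le> j \<Longrightarrow> expo_deg (min_expo j ?T) l = 0"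
      "0 < expo_deg (min_expo j ?T) i" by blast
    have "expo_deg (min_expo (Suc j) T) l = 0" if "i < l" "l \<le> Suc j" for l
      using that i(2) top low True by (cases "l = Suc j") auto
    then show ?thesis using i(1,3) low by (intro bexI[of _ i]) auto
  qed
qed

text \<open>The lower bound that makes the descent finite: a regularized support keeps, at every
  level, members with nonnegative exponents there.\<close>

lemma homog_min_expo_zero_nonneg:
  assumes "min_expo j S = 0" "finite S" "S \<noteq> {}" "\<And>m l. m \<in> S \<Longrightarrow> l \<in> {1..j} \<Longrightarrow> expo_deg m l = d l"
    "l \<in> {1..j}"
  shows "0 \<le> d l"
  using assms
proof (induction j arbitrary: S)
  case (Suc j)
  let ?X = "\<lambda>m. lu m (XVar (Suc j))" and ?Y = "\<lambda>m. lu m (YVar (Suc j))"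
  note z = min_expo_zeroD[OF Suc.prems(1)]
  have S0: "0 \<le> ?X m" "0 \<le> ?Y m" if "m \<in> S" for m
    using z(1,2) Min_le[of "?X ` S" "?X m"] Min_le[of "?Y ` S" "?Y m"] that Suc.prems(2) by auto
  show ?case
  proof (cases "l = Suc j")
    case True
    then show ?thesis using S0 Suc.prems(3,4) by (fastforce simp: expo_deg_def)
  next
    case False
    have "{m \<in> S. ?X m = 0} \<noteq> {}" using Min_filter_nonempty[OF Suc.prems(2,3), of ?X] z(1) by simp
    then show ?thesis
      using False Suc.prems by (intro Suc.IH[OF z(3)]) auto
  qed
qed auto

text \<open>Lexicographic order with the highest index most significant, matching the recursion of
  \<open>reg_expo\<close> from the top index down.\<close>

definition top_less :: "nat \<Rightarrow> ((nat \<Rightarrow> nat) \<times> (nat \<Rightarrow> nat)) set" where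
  "top_less n = {(f, g). \<exists>i\<in>{1..n}. (\<forall>l. i < l \<and> l \<le> n \<longrightarrow> f l = g l) \<and> f i < g i}"

lemma wf_top_less: "wf (top_less n)"
proof (induction n)
  case (Suc n)
  have "top_less (Suc n) \<subseteq> inv_image (less_than <*lex*> top_less n) (\<lambda>f. (f (Suc n), f))"
  proof (rule subrelI)
    fix f g assume "(f, g) \<in> top_less (Suc n)"
    then obtain i where i: "i \<in> {1..Suc n}" "\<And>l. i < l \<Longrightarrow> l \<le> Suc n \<Longrightarrow> f l = g l" "f i < g i"
      by (auto simp: top_less_def)
    show "(f, g) \<in> inv_image (less_than <*lex*> top_less n) (\<lambda>f. (f (Suc n), f))"
    proof (cases "i = Suc n")
      case False
      then have "(f, g) \<in> top_less n" using i by (auto simp: top_less_def intro!: bexI[of _ i])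
      moreover have "f (Suc n) = g (Suc n)" using i False by auto
      ultimately show ?thesis by simp
    qed (use i in simp)
  qed
  then show ?case using Suc by (meson wf_inv_image wf_less_than wf_lex_prod wf_subset)
qed (simp add: top_less_def)

lemma homog_div_reg:
  assumes "homog d p"
  shows "homog (\<lambda>j. d j - expo_deg (reg_expo n p) j) (div_reg n p)"
  using assms unfolding homog_def keys_div_reg
  by (force simp: expo_deg_def lookup_minus)

theorem dd_seq_terminates:
  assumes "homog d p"
  shows "\<exists>k. dd_seq n p k = 0"
proof (rule ccontr)
  assume nz: "\<nexists>k. dd_seq n p k = 0"
  let ?p = "dd_seq n p"
  have Suc_eq: "?p (Suc k) = div_reg n (deriv_op n (?p k))" and dnz: "deriv_op n (?p k) \<noteq> 0" for k
    using nz[unfolded not_ex, rule_format, of "Suc k"] by (auto split: if_splits)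
  define D where "D = rec_nat d (\<lambda>k D j. D j - expo_deg (reg_expo n (deriv_op n (?p k))) j)"
  have D_Suc: "D (Suc k) j = D k j - expo_deg (reg_expo n (deriv_op n (?p k))) j" for k j
    by (simp add: D_def)
  have hom: "homog (D k) (?p k)" for k
  proof (induction k)
    case (Suc k)
    then show ?case unfolding Suc_eq D_Suc[abs_def] by (intro homog_div_reg homog_deriv_op)
  qed (simp add: D_def assms)
  have reg: "reg_expo n (deriv_op n (?p k)) = min_expo n (keys (deriv_op n (?p k)))" for k
    by (rule reg_expo_eq[OF homog_deriv_op[OF hom] dnz])
  have regular: "min_expo n (keys (?p (Suc k))) = 0" for k
    unfolding Suc_eq keys_div_reg reg using dnz by (intro min_expo_normalize) (auto simp: keys_eq_empty)
  \<comment> \<open>The initial \<open>p\<close> need not be regularized, so degrees are compared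
    only from the first quotient on.\<close>
  have nonneg: "0 \<le> D (Suc k) l" if "l \<in> {1..n}" for k l
    by (rule homog_min_expo_zero_nonneg[OF regular[of k] _ _ _ that])
      (use nz hom[of "Suc k"] in \<open>auto simp: homog_def keys_eq_empty simp del: dd_seq.simps\<close>)
  have "(\<lambda>l. nat (D (Suc (Suc k)) l), \<lambda>l. nat (D (Suc k) l)) \<in> top_less n" for k
  proof -
    obtain i where i: "i \<in> {1..n}"
      "\<And>l. i < l \<and> l \<le> n \<Longrightarrow> expo_deg (reg_expo n (deriv_op n (?p (Suc k)))) l = 0"
      "0 < expo_deg (reg_expo n (deriv_op n (?p (Suc k)))) i"
    proof -
      have "\<exists>i\<in>{1..n}. (\<forall>l. i < l \<and> l \<le> n \<longrightarrow> expo_deg (reg_expo n (deriv_op n (?p (Suc k)))) l = 0) \<and>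
          0 < expo_deg (reg_expo n (deriv_op n (?p (Suc k)))) i"
        unfolding reg
      proof (rule min_expo_descent[OF regular[of k] finite_keys finite_keys])
        show "keys (deriv_op n (?p (Suc k))) \<noteq> {}"
          using dnz[of "Suc k"] by (simp add: keys_eq_empty del: dd_seq.simps)
      qed (rule keys_deriv_op)
      then show ?thesis using that by blast
    qed
    then show ?thesis
      using nonneg[of i k] nonneg[of i "Suc k"] unfolding top_less_def
      by (auto intro!: bexI[of _ i] simp: D_Suc[of "Suc k"] simp del: dd_seq.simps)
  qed
  then have "\<exists>f. \<forall>k. (f (Suc k), f k) \<in> top_less n"
    by (intro exI[of _ "\<lambda>k l. nat (D (Suc k) l)"]) blast
  then show False
    using wf_top_less[of n] by (simp add: wf_iff_no_infinite_down_chain)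
qed

text \<open>The \<open>LEAST\<close> in \<open>DD_of\<close> is attained because the value 0, which
  the sequence reaches, lies in R.\<close>

lemma dd_seq_DD: "dd_seq n (dd_start n) (DD n) \<in> laurent n 0"
proof -
  obtain k where "dd_seq n (dd_start n) k = 0"
    using dd_seq_terminates[OF homog_dd_start] by blast
  then have "dd_seq n (dd_start n) k \<in> laurent n 0" by (simp add: laurent_def)
  then show ?thesis unfolding DD_def DD_of_def by (rule LeastI)
qed

section \<open>Chebyshev systems of iterated integrals\<close>

text \<open>Finite sets \<open>Z\<close> of zeros are built up by adding the maximum last. The
  associated zeros of \<open>f'\<close> are kept below \<open>Max Z\<close>, so the one that Rolle
  finds between the old and the new maximum is new. Bounding all finite \<open>Z\<close> also gives
  finiteness.\<close>

lemma rolle_card: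
  fixes f f' :: "real \<Rightarrow> real"
  assumes I: "connected I" and f: "\<And>x. x \<in> I \<Longrightarrow> (f has_real_derivative f' x) (at x)"
    and fin: "finite {x\<in>I. f' x = 0}" and card: "card {x\<in>I. f' x = 0} \<le> N"
  shows "finite {x\<in>I. f x = 0} \<and> card {x\<in>I. f x = 0} \<le> Suc N"
proof -
  have main: "Z \<noteq> {} \<longrightarrow> Z \<subseteq> {x\<in>I. f x = 0} \<longrightarrow>
      (\<exists>R\<subseteq>{x\<in>I. f' x = 0 \<and> x < Max Z}. finite R \<and> card Z = Suc (card R))"
    if "finite Z" for Z
    using that
  proof (induction Z rule: finite_linorder_max_induct)
    case (insert b Z)
    show ?case
    proof (cases "Z = {}")
      case False
      show ?thesis
      proof (intro impI)
        assume Z: "insert b Z \<subseteq> {x\<in>I. f x = 0}"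
        then obtain R where R: "R \<subseteq> {x\<in>I. f' x = 0 \<and> x < Max Z}" "finite R" "card Z = Suc (card R)"
          using insert.IH False by blast
        have M: "Max Z \<in> Z" "Max Z < b" using insert False by auto
        have seg: "{Max Z..b} \<subseteq> I"
          using connected_contains_Icc[OF I] M Z by blast
        have "\<exists>c. Max Z < c \<and> c < b \<and> f' c = 0"
        proof -
          have "\<exists>c. Max Z < c \<and> c < b \<and> f' c = 0 \<or> False"
          proof (rule exE[OF Rolle_deriv[OF M(2)]])
            show "f (Max Z) = f b" using M Z by auto
            show "continuous_on {Max Z..b} f"
              using seg f DERIV_isCont by (intro continuous_at_imp_continuous_on) blast
            show "(f has_derivative (*) (f' x)) (at x)" if "Max Z < x" "x < b" for x
              using f[of x] subsetD[OF seg, of x] that by (auto simp: has_field_derivative_def)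
            fix z assume z: "Max Z < z \<and> z < b \<and> (*) (f' z) = (\<lambda>v. 0)"
            then have eq: "(*) (f' z) = (\<lambda>v. 0)" by blast
            have "f' z * 1 = 0" unfolding eq by (rule refl)
            then have "f' z = 0" by (simp only: mult_1_right)
            then show ?thesis using z by blast
          qed
          then show ?thesis by simp
        qed
        then obtain c where c: "Max Z < c" "c < b" "f' c = 0" by blast
        have Mb: "Max (insert b Z) = b"
          using insert(1,2) by (intro Max_eqI) (auto intro: less_imp_le)
        have "c \<in> I" using subsetD[OF seg, of c] c by simp
        then have "c \<in> {x\<in>I. f' x = 0 \<and> x < b}" using c by simp
        moreover have "R \<subseteq> {x\<in>I. f' x = 0 \<and> x < b}"
        proof
          fix x assume "x \<in> R"
          from subsetD[OF R(1) this] M(2) show "x \<in> {x\<in>I. f' x = 0 \<and> x < b}" by simp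
        qed
        ultimately have sub: "insert c R \<subseteq> {x\<in>I. f' x = 0 \<and> x < Max (insert b Z)}"
          unfolding Mb by (rule insert_subsetI)
        have "c \<notin> R" using subsetD[OF R(1), of c] c(1) by (auto simp del: Max_less_iff)
        moreover have "b \<notin> Z" using insert by auto
        ultimately have "card (insert b Z) = Suc (card (insert c R))" using R(2,3) insert(1) by simp
        with sub R(2) show "\<exists>R\<subseteq>{x\<in>I. f' x = 0 \<and> x < Max (insert b Z)}. finite R \<and> card (insert b Z) = Suc (card R)"
          by (intro exI[of _ "insert c R"] conjI) simp_all
      qed
    qed (auto intro!: exI[of _ "{}"])
  qed auto
  have bound: "card Z \<le> Suc N" if Z: "finite Z" "Z \<subseteq> {x\<in>I. f x = 0}" for Z
  proof (cases "Z = {}")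
    case False
    obtain R where R: "R \<subseteq> {x\<in>I. f' x = 0 \<and> x < Max Z}" "finite R" "card Z = Suc (card R)"
      using main[OF Z(1), rule_format, OF False Z(2)] by (elim exE conjE)
    have "card R \<le> card {x\<in>I. f' x = 0}" by (rule card_mono[OF fin]) (use R(1) in blast)
    then show ?thesis using R(3) card by simp
  qed simp
  have "finite {x\<in>I. f x = 0}"
  proof (rule ccontr)
    assume "infinite {x\<in>I. f x = 0}"
    then obtain Z where "finite Z" "card Z = Suc (Suc N)" "Z \<subseteq> {x\<in>I. f x = 0}"
      using infinite_arbitrarily_large by blast
    then show False using bound by fastforce
  qed
  then show ?thesis using bound by blast
qed

text \<open>The oriented integral from \<open>c\<close> to \<open>x\<close>: on either side of
  \<open>c\<close> one of the two intervals is empty.\<close>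

definition based_integral :: "real \<Rightarrow> (real \<Rightarrow> real) \<Rightarrow> real \<Rightarrow> real" where
  "based_integral c f x = integral {c..x} f - integral {x..c} f"

lemma based_integral_base [simp]: "based_integral c f c = 0"
  by (simp add: based_integral_def)

lemma based_integral_derivative:
  assumes I: "open I" "connected I" and f: "continuous_on I f" and x: "x \<in> I" "c \<in> I"
  shows "(based_integral c f has_real_derivative f x) (at x)"
proof -
  obtain \<epsilon> where \<epsilon>: "\<epsilon> > 0" "cball x \<epsilon> \<subseteq> I" using I(1) x(1) open_contains_cball by blast
  \<comment> \<open>A segment of \<open>I\<close> that contains \<open>c\<close> and has
    \<open>x\<close> in its interior; on it the integrals from \<open>c\<close> and from
    \<open>a\<close> differ by a constant.\<close>
  define a where "a = min c (x - \<epsilon>)"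
  define b where "b = max c (x + \<epsilon>)"
  have ends: "x - \<epsilon> \<in> I" "x + \<epsilon> \<in> I" using \<epsilon> by (auto simp: dist_real_def subset_iff)
  have ab: "a \<in> I" "b \<in> I" "a < x" "x < b" "a \<le> c" "c \<le> b"
    using ends x \<epsilon> by (auto simp: a_def b_def min_def max_def)
  have sub: "{a..b} \<subseteq> I" using connected_contains_Icc[OF I(2) ab(1,2)] .
  have cont: "continuous_on {a..b} f" using f sub continuous_on_subset by blast
  have int: "f integrable_on {s..t}" if "a \<le> s" "t \<le> b" for s t
    by (rule integrable_continuous_real, rule continuous_on_subset[OF cont]) (use that in auto)
  have eq: "based_integral c f u = integral {a..u} f - integral {a..c} f" if u: "u \<in> {a..b}" for u
  proof (cases "c \<le> u")
    case True
    then have "integral {a..c} f + integral {c..u} f = integral {a..u} f"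
      using ab u by (intro Henstock_Kurzweil_Integration.integral_combine int) auto
    then show ?thesis using True by (cases "c = u") (auto simp: based_integral_def)
  next
    case False
    then have "integral {a..u} f + integral {u..c} f = integral {a..c} f"
      using ab u by (intro Henstock_Kurzweil_Integration.integral_combine int) auto
    then show ?thesis using False by (auto simp: based_integral_def)
  qed
  have "((\<lambda>u. integral {a..u} f) has_real_derivative f x) (at x within {a..b})"
    using integral_has_real_derivative[OF cont, of x] ab by auto
  then have "((\<lambda>u. integral {a..u} f) has_real_derivative f x) (at x)"
    using at_within_interior[of x "{a..b}"] ab by simp
  then have "((\<lambda>u. integral {a..u} f - integral {a..c} f) has_real_derivative f x) (at x)"
    by (auto intro!: derivative_eq_intros)
  then show ?thesis
  proof (rule has_field_derivative_transform_within_open)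
    show "x \<in> {a<..<b}" using ab by auto
  qed (use eq in auto)
qed

lemma antiderivative_diff:
  fixes F G :: "real \<Rightarrow> real"
  assumes I: "connected I" and F: "\<And>x. x \<in> I \<Longrightarrow> (F has_real_derivative f x) (at x)"
    and G: "\<And>x. x \<in> I \<Longrightarrow> (G has_real_derivative f x) (at x)" and st: "s \<in> I" "t \<in> I"
  shows "F s - F t = G s - G t"
proof -
  have "convex I" using I by (simp add: is_interval_connected_1[symmetric] is_interval_convex)
  then have "\<exists>c. \<forall>x\<in>I. F x - G x = c"
  proof (rule has_field_derivative_zero_constant)
    show "((\<lambda>x. F x - G x) has_real_derivative 0) (at x within I)" if "x \<in> I" for x
      using DERIV_diff[OF F[OF that] G[OF that]] by (simp add: has_field_derivative_at_within)
  qed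
  then obtain c where c: "\<And>x. x \<in> I \<Longrightarrow> F x - G x = c" by blast
  show ?thesis using c[OF st(1)] c[OF st(2)] by simp
qed

section \<open>Primitives on a family of intervals with an analytic base point\<close>

locale interval_bundle =
  fixes U :: "'q::euclidean_space set" and I :: "'q \<Rightarrow> real set" and X0 :: "'q \<Rightarrow> real"
  assumes open_U: "open U" and open_V: "open {(q, x). q \<in> U \<and> x \<in> I q}"
    and connected_I: "\<And>q. q \<in> U \<Longrightarrow> connected (I q)"
    and X0_in: "\<And>q. q \<in> U \<Longrightarrow> X0 q \<in> I q"
    and cext_X0: "\<And>q. q \<in> U \<Longrightarrow> cext X0 q"
begin

abbreviation V :: "('q \<times> real) set" where "V \<equiv> {(q, x). q \<in> U \<and> x \<in> I q}"

lemma open_I: "q \<in> U \<Longrightarrow> open (I q)"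
  using open_vimage[OF open_V, of "\<lambda>x. (q, x)"] by (simp add: vimage_def continuous_on_Pair)

definition prim :: "('q \<times> real \<Rightarrow> real) \<Rightarrow> 'q \<times> real \<Rightarrow> real" where
  "prim f = (\<lambda>(q, x). based_integral (X0 q) (\<lambda>t. f (q, t)) x)"

lemma prim_base: "prim f (q, X0 q) = 0"
  by (simp add: prim_def)

lemma prim_derivative:
  assumes f: "\<And>z. z \<in> V \<Longrightarrow> cext f z" and q: "q \<in> U" "x \<in> I q"
  shows "((\<lambda>x. prim f (q, x)) has_real_derivative f (q, x)) (at x)"
proof -
  have "isCont (\<lambda>t. f (q, t)) t" if "t \<in> I q" for t
    using isCont_o2[where f = "\<lambda>t. (q, t)" and a = t and g = f] cext_isCont[OF f, of "(q, t)"] that q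
    by auto
  then have "continuous_on (I q) (\<lambda>t. f (q, t))" by (simp add: continuous_at_imp_continuous_on)
  then have "(based_integral (X0 q) (\<lambda>t. f (q, t)) has_real_derivative f (q, x)) (at x)"
    using based_integral_derivative[OF open_I connected_I] X0_in q by blast
  then show ?thesis by (simp add: prim_def)
qed

lemma cext_fst_const:
  fixes F :: "'q \<times> real \<Rightarrow> real" and x :: real
  assumes "cext F (q, t)"
  shows "cext (\<lambda>z. F (fst z, t)) (q, x)"
proof (rule cext_compose[where G = "\<lambda>z. (fst z, t)"])
  show "cext (\<lambda>z. (fst z, t) \<bullet> b) (q, x)" for b :: "'q \<times> real"
  proof -
    have "cext (\<lambda>z::'q \<times> real. z \<bullet> (fst b, 0) + t * snd b) (q, x)"
      by (intro cext_add cext_inner cext_const)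
    then show ?thesis by (simp add: inner_prod_def)
  qed
qed (use assms in simp)

lemma cext_fst_X0:
  fixes F :: "'q \<times> real \<Rightarrow> real" and x :: real
  assumes "cext F (q, X0 q)" "q \<in> U"
  shows "cext (\<lambda>z. F (fst z, X0 (fst z))) (q, x)"
proof (rule cext_compose[where G = "\<lambda>z. (fst z, X0 (fst z))"])
  show "cext (\<lambda>z. (fst z, X0 (fst z)) \<bullet> b) (q, x)" for b :: "'q \<times> real"
  proof -
    have "cext (\<lambda>z. X0 (fst z)) (q, x)"
    proof (rule cext_compose[where G = fst])
      show "cext (\<lambda>z. fst z \<bullet> c) (q, x)" for c :: 'q
        using cext_inner[of "(c, 0)" "(q, x)"] by (simp add: inner_prod_def)
    qed (use assms cext_X0 in simp)
    then have "cext (\<lambda>z::'q \<times> real. z \<bullet> (fst b, 0) + X0 (fst z) * snd b) (q, x)"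
      by (intro cext_add cext_inner cext_const cext_mult)
    then show ?thesis by (simp add: inner_prod_def)
  qed
qed (use assms in simp)

text \<open>A primitive vanishing at the base point is analytic near the base point, and analyticity
  propagates along the fibre because two primitives of the same function differ by a function of
  \<open>q\<close> alone.\<close>

lemma cext_prim:
  assumes f: "\<And>z. z \<in> V \<Longrightarrow> cext f z" and z: "z \<in> V"
  shows "cext (prim f) z"
proof -
  obtain q0 x0 where zz: "z = (q0, x0)" and q0: "q0 \<in> U" "x0 \<in> I q0" using z by auto
  \<comment> \<open>Near each point of the fibre, \<open>prim f\<close> and a local analytic
    primitive have the same increments in \<open>x\<close>, for all \<open>q\<close> near
    \<open>q0\<close> with one and the same \<open>\<delta>\<close>.\<close>
  have loc: "\<exists>\<Phi> \<delta>. \<delta> > 0 \<and> cball q0 \<delta> \<subseteq> U \<and> (\<forall>q\<in>ball q0 \<delta>. ball t \<delta> \<subseteq> I q) \<and>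
      (\<forall>x\<in>ball t \<delta>. cext \<Phi> (q0, x)) \<and>
      (\<forall>q\<in>ball q0 \<delta>. \<forall>x\<in>ball t \<delta>. \<forall>y\<in>ball t \<delta>. prim f (q, x) - prim f (q, y) = \<Phi> (q, x) - \<Phi> (q, y))"
    if t: "t \<in> I q0" for t
  proof -
    have tV: "(q0, t) \<in> V" using q0 t by simp
    obtain \<Phi> where \<Phi>: "cext \<Phi> (q0, t)"
      "\<forall>\<^sub>F z in nhds (q0, t). ((\<lambda>s. \<Phi> (z + s *\<^sub>R (0, 1))) has_real_derivative f z) (at 0)"
      using cext_primitive[OF f[OF tV] zero_one_Basis] by blast
    have "\<forall>\<^sub>F z in nhds (q0, t). z \<in> V \<and> cext \<Phi> z \<and> ((\<lambda>s. \<Phi> (z + s *\<^sub>R (0, 1))) has_real_derivative f z) (at 0)"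
      using \<Phi>(2) cext_eventually[OF \<Phi>(1)] eventually_nhds_in_open[OF open_V tV]
      by eventually_elim auto
    then obtain \<epsilon> where \<epsilon>: "\<epsilon> > 0" "\<And>z. dist z (q0, t) < \<epsilon> \<Longrightarrow> z \<in> V \<and> cext \<Phi> z \<and>
        ((\<lambda>s. \<Phi> (z + s *\<^sub>R (0, 1))) has_real_derivative f z) (at 0)"
      unfolding eventually_nhds_metric by blast
    obtain \<epsilon>' where \<epsilon>': "\<epsilon>' > 0" "cball q0 \<epsilon>' \<subseteq> U" using open_U q0 open_contains_cball by blast
    define \<delta> where "\<delta> = min \<epsilon>' (\<epsilon> / 2)"
    have \<delta>: "\<delta> > 0" "\<delta> \<le> \<epsilon>'" "\<delta> \<le> \<epsilon> / 2" using \<epsilon>(1) \<epsilon>'(1) by (auto simp: \<delta>_def)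
    have near: "(q, x) \<in> V" "cext \<Phi> (q, x)"
      "((\<lambda>x. \<Phi> (q, x)) has_real_derivative f (q, x)) (at x)"
      if "q \<in> ball q0 \<delta>" "x \<in> ball t \<delta>" for q x
    proof -
      have "dist (q, x) (q0, t) \<le> dist q q0 + dist x t"
        unfolding dist_Pair_Pair by (rule sqrt_sum_squares_le_sum) auto
      also have "\<dots> < \<epsilon>" using that \<delta> by (simp add: dist_commute)
      finally have d: "dist (q, x) (q0, t) < \<epsilon>" .
      show "(q, x) \<in> V" "cext \<Phi> (q, x)" using \<epsilon>(2)[OF d] by auto
      have "((\<lambda>s. \<Phi> (q, x + s)) has_real_derivative f (q, x)) (at 0)" using \<epsilon>(2)[OF d] by simp
      then show "((\<lambda>x. \<Phi> (q, x)) has_real_derivative f (q, x)) (at x)"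
        using DERIV_at_within_shift[of "\<lambda>x. \<Phi> (q, x)" "f (q, x)" x 0 UNIV] by simp
    qed
    have "prim f (q, x) - prim f (q, y) = \<Phi> (q, x) - \<Phi> (q, y)"
      if q: "q \<in> ball q0 \<delta>" and xy: "x \<in> ball t \<delta>" "y \<in> ball t \<delta>" for q x y
    proof (rule antiderivative_diff[where I = "ball t \<delta>" and f = "\<lambda>x. f (q, x)"])
      show "((\<lambda>x. prim f (q, x)) has_real_derivative f (q, u)) (at u)" if "u \<in> ball t \<delta>" for u
        using prim_derivative[OF f] near(1)[OF q that] by auto
    qed (use near(3)[OF q] xy in auto)
    then show ?thesis
      using \<delta> \<epsilon>'(2) near(1,2) by (intro exI[of _ \<Phi>] exI[of _ \<delta>]) (auto simp: subset_iff)
  qed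
  \<comment> \<open>For fixed \<open>s\<close>, the value at \<open>(q, x)\<close> is
    \<open>prim f (q, s)\<close> plus an increment of \<open>\<Phi>\<close>; analyticity at one
    point of the ball passes to all others.\<close>
  have spread: "cext (prim f) (q0, y)"
    if \<delta>: "\<delta> > 0" and \<Phi>: "\<And>x. x \<in> ball t \<delta> \<Longrightarrow> cext \<Phi> (q0, x)"
      "\<And>q x y. q \<in> ball q0 \<delta> \<Longrightarrow> x \<in> ball t \<delta> \<Longrightarrow> y \<in> ball t \<delta> \<Longrightarrow> prim f (q, x) - prim f (q, y) = \<Phi> (q, x) - \<Phi> (q, y)"
      and s: "s \<in> ball t \<delta>" "cext (prim f) (q0, s)" and y: "y \<in> ball t \<delta>" for \<Phi> \<delta> t s y
  proof (rule cext_cong)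
    show "cext (\<lambda>z. prim f (fst z, s) + (\<Phi> z - \<Phi> (fst z, s))) (q0, y)"
      by (intro cext_add cext_diff cext_fst_const \<Phi>(1) s y)
    have "\<forall>\<^sub>F z in nhds (q0, y). z \<in> ball q0 \<delta> \<times> ball t \<delta>"
      using y \<delta> by (intro eventually_nhds_in_open open_Times) auto
    then show "\<forall>\<^sub>F z in nhds (q0, y). prim f (fst z, s) + (\<Phi> z - \<Phi> (fst z, s)) = prim f z"
    proof eventually_elim
      case (elim z)
      then show ?case using \<Phi>(2)[of "fst z" "snd z" s] s(1) by auto
    qed
  qed
  \<comment> \<open>Here the constant of integration is \<open>\<Phi> (q, X0 q)\<close>, analytic
    because \<open>X0\<close> is.\<close>
  have base: "cext (prim f) (q0, X0 q0)"
  proof -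
    obtain \<Phi> \<delta> where \<delta>: "\<delta> > 0" "cball q0 \<delta> \<subseteq> U" "\<And>x. x \<in> ball (X0 q0) \<delta> \<Longrightarrow> cext \<Phi> (q0, x)"
      "\<And>q x y. q \<in> ball q0 \<delta> \<Longrightarrow> x \<in> ball (X0 q0) \<delta> \<Longrightarrow> y \<in> ball (X0 q0) \<delta> \<Longrightarrow>
         prim f (q, x) - prim f (q, y) = \<Phi> (q, x) - \<Phi> (q, y)"
      using loc[OF X0_in[OF q0(1)]] by blast
    show ?thesis
    proof (rule cext_cong)
      show "cext (\<lambda>z. \<Phi> z - \<Phi> (fst z, X0 (fst z))) (q0, X0 q0)"
        by (intro cext_diff cext_fst_X0 \<delta>(3) q0) (use \<delta>(1) in auto)
      have "cext (\<lambda>z::'q \<times> real. X0 (fst z)) (q0, X0 q0)"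
        using cext_fst_X0[where F = "\<lambda>z. z \<bullet> (0, 1)", OF cext_inner q0(1)] by simp
      then have "((\<lambda>z::'q \<times> real. X0 (fst z)) \<longlongrightarrow> X0 q0) (nhds (q0, X0 q0))"
        using cext_continuous by fastforce
      then have "\<forall>\<^sub>F z in nhds (q0, X0 q0). X0 (fst z) \<in> ball (X0 q0) \<delta>"
        using \<delta>(1) by (intro topological_tendstoD) auto
      moreover have "\<forall>\<^sub>F z in nhds (q0, X0 q0). z \<in> ball q0 \<delta> \<times> ball (X0 q0) \<delta>"
        using \<delta>(1) by (intro eventually_nhds_in_open open_Times) auto
      ultimately show "\<forall>\<^sub>F z in nhds (q0, X0 q0). \<Phi> z - \<Phi> (fst z, X0 (fst z)) = prim f z"
      proof eventually_elim
        case (elim z)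
        then show ?case using \<delta>(4)[of "fst z" "snd z" "X0 (fst z)"] by (auto simp: prim_base)
      qed
    qed
  qed
  have "cext (prim f) (q0, x0)"
  proof (rule connected_induction_simple[where P = "\<lambda>x. cext (prim f) (q0, x)",
        OF connected_I[OF q0(1)] X0_in[OF q0(1)] q0(2) base])
    fix t assume t: "t \<in> I q0"
    obtain \<Phi> \<delta> where \<delta>: "\<delta> > 0" "ball t \<delta> \<subseteq> I q0" "\<And>x. x \<in> ball t \<delta> \<Longrightarrow> cext \<Phi> (q0, x)"
      "\<And>q x y. q \<in> ball q0 \<delta> \<Longrightarrow> x \<in> ball t \<delta> \<Longrightarrow> y \<in> ball t \<delta> \<Longrightarrow>
         prim f (q, x) - prim f (q, y) = \<Phi> (q, x) - \<Phi> (q, y)"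
      using loc[OF t] centre_in_ball[of q0] by meson
    have "openin (top_of_set (I q0)) (ball t \<delta>)"
      using \<delta>(2) by (intro open_subset) auto
    moreover have "t \<in> ball t \<delta>" using \<delta>(1) by simp
    moreover have "\<forall>x\<in>ball t \<delta>. \<forall>y\<in>ball t \<delta>. cext (prim f) (q0, x) \<longrightarrow> cext (prim f) (q0, y)"
    proof (intro ballI impI)
      fix x y assume xy: "x \<in> ball t \<delta>" "y \<in> ball t \<delta>" "cext (prim f) (q0, x)"
      show "cext (prim f) (q0, y)"
        by (rule spread[OF \<delta>(1) _ _ xy(1,3,2)]) (fact \<delta>(3), fact \<delta>(4))
    qed
    ultimately show "\<exists>T. openin (top_of_set (I q0)) T \<and> t \<in> T \<and>
        (\<forall>x\<in>T. \<forall>y\<in>T. cext (prim f) (q0, x) \<longrightarrow> cext (prim f) (q0, y))"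
      by (intro exI[of _ "ball t \<delta>"] conjI)
  qed
  then show ?thesis by (simp add: zz)
qed

end

section \<open>Iterated integrals of positive weights\<close>

locale weighted_bundle = interval_bundle U I X0
  for U :: "'q::euclidean_space set" and I X0 +
  fixes W :: "nat \<Rightarrow> 'q \<times> real \<Rightarrow> real"
  assumes cext_W: "\<And>k z. z \<in> V \<Longrightarrow> cext (W k) z"
    and W_pos: "\<And>k z. z \<in> V \<Longrightarrow> 0 < W k z"
begin

text \<open>Nested integrals with outermost weight \<open>W j\<close>, next
  \<open>W (Suc j)\<close>, and so on. The starting index is a parameter because differentiating and
  dividing by \<open>W j\<close> leads to the family that starts at \<open>Suc j\<close>.\<close>

primrec iter_prim :: "nat \<Rightarrow> nat \<Rightarrow> 'q \<times> real \<Rightarrow> real" where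
  "iter_prim 0 j = (\<lambda>_. 1)"
| "iter_prim (Suc k) j = prim (\<lambda>z. W j z * iter_prim k (Suc j) z)"

lemma cext_iter_prim: "z \<in> V \<Longrightarrow> cext (iter_prim k j) z"
proof (induction k arbitrary: j z)
  case (Suc k)
  then show ?case unfolding iter_prim.simps by (intro cext_prim cext_mult cext_W Suc.IH)
qed (simp add: cext_const)

lemma iter_prim_derivative:
  assumes "q \<in> U" "x \<in> I q"
  shows "((\<lambda>x. iter_prim (Suc k) j (q, x)) has_real_derivative W j (q, x) * iter_prim k (Suc j) (q, x)) (at x)"
  unfolding iter_prim.simps
  by (rule prim_derivative[OF cext_mult[OF cext_W cext_iter_prim] assms])

text \<open>Differentiating a combination removes its constant term and leaves \<open>W j\<close>,
  which has no zeros, times a combination of one function fewer from the family starting at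
  \<open>Suc j\<close>; Rolle costs one zero.\<close>

lemma chebyshev_iter_prim:
  assumes q: "q \<in> U"
  shows "chebyshev_system m (\<lambda>k x. iter_prim k j (q, x)) (I q)"
proof (induction m arbitrary: j)
  case (Suc m)
  show ?case
    unfolding chebyshev_system_def
  proof (intro allI impI)
    fix c :: "nat \<Rightarrow> real" assume c: "\<exists>k<Suc m. c k \<noteq> 0"
    let ?f = "\<lambda>x. \<Sum>k<Suc m. c k * iter_prim k j (q, x)"
    let ?g = "\<lambda>x. \<Sum>k<m. c (Suc k) * iter_prim k (Suc j) (q, x)"
    have f_eq: "?f x = c 0 + (\<Sum>k<m. c (Suc k) * iter_prim (Suc k) j (q, x))" for x
      unfolding sum.lessThan_Suc_shift by simp
    show "finite {x \<in> I q. ?f x = 0} \<and> card {x \<in> I q. ?f x = 0} \<le> Suc m - 1"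
    proof (cases "\<exists>k<m. c (Suc k) \<noteq> 0")
      case True
      then have g: "finite {x \<in> I q. ?g x = 0}" "card {x \<in> I q. ?g x = 0} \<le> m - 1" "0 < m"
        using Suc[of "Suc j"] unfolding chebyshev_system_def by auto
      have d: "(?f has_real_derivative W j (q, x) * ?g x) (at x)" if "x \<in> I q" for x
      proof -
        have "((\<lambda>x. c 0 + (\<Sum>k<m. c (Suc k) * iter_prim (Suc k) j (q, x))) has_real_derivative
            0 + (\<Sum>k<m. c (Suc k) * (W j (q, x) * iter_prim k (Suc j) (q, x)))) (at x)"
          by (intro DERIV_add DERIV_const DERIV_sum DERIV_cmult iter_prim_derivative q that)
        then show ?thesis unfolding f_eq by (simp add: sum_distrib_left mult_ac)
      qed
      have "{x \<in> I q. W j (q, x) * ?g x = 0} = {x \<in> I q. ?g x = 0}"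
        using W_pos[of "(q, _)" j] q by force
      then show ?thesis
        using rolle_card[OF connected_I[OF q] d, of "m - 1"] g by simp
    next
      case False
      then have "c 0 \<noteq> 0" using c less_Suc_eq_0_disj by auto
      moreover have "?f x = c 0" for x unfolding f_eq using False by simp
      ultimately have "{x \<in> I q. ?f x = 0} = {}" by auto
      then show ?thesis by (metis card.empty finite.emptyI zero_le)
    qed
  qed
qed (simp add: chebyshev_system_def)

text \<open>A Taylor formula in which each differentiation is followed by division by a weight,
  exact because the last function is constant. By induction both sides have the same derivative, and
  they agree at \<open>X0 q\<close>, where all proper iterated integrals vanish.\<close>

lemma iter_prim_expansion:
  assumes q: "q \<in> U"
    and F: "\<And>k x. x \<in> I q \<Longrightarrow> ((\<lambda>x. F k (q, x)) has_real_derivative W k (q, x) * F (Suc k) (q, x)) (at x)"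
    and const: "\<And>x. x \<in> I q \<Longrightarrow> F (j + m) (q, x) = F (j + m) (q, X0 q)"
    and x: "x \<in> I q"
  shows "F j (q, x) = (\<Sum>k<Suc m. F (j + k) (q, X0 q) * iter_prim k j (q, x))"
  using const x
proof (induction m arbitrary: j x)
  case 0
  then show ?case by simp
next
  case (Suc m)
  let ?G = "\<lambda>x. \<Sum>k<Suc (Suc m). F (j + k) (q, X0 q) * iter_prim k j (q, x)"
  have G_eq: "?G x = F j (q, X0 q) + (\<Sum>k<Suc m. F (Suc j + k) (q, X0 q) * iter_prim (Suc k) j (q, x))" for x
    unfolding sum.lessThan_Suc_shift by simp
  have d: "(?G has_real_derivative W j (q, y) * F (Suc j) (q, y)) (at y)" if y: "y \<in> I q" for y
  proof -
    have IH: "F (Suc j) (q, y) = (\<Sum>k<Suc m. F (Suc j + k) (q, X0 q) * iter_prim k (Suc j) (q, y))"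
      using Suc.prems(1) by (intro Suc.IH y) simp
    have "((\<lambda>x. F j (q, X0 q) + (\<Sum>k<Suc m. F (Suc j + k) (q, X0 q) * iter_prim (Suc k) j (q, x))) has_real_derivative
        0 + (\<Sum>k<Suc m. F (Suc j + k) (q, X0 q) * (W j (q, y) * iter_prim k (Suc j) (q, y)))) (at y)"
      by (intro DERIV_add DERIV_const DERIV_sum DERIV_cmult iter_prim_derivative q y)
    then show ?thesis unfolding G_eq IH by (simp only: sum_distrib_left mult_ac add_0)
  qed
  have "F j (q, x) - F j (q, X0 q) = ?G x - ?G (X0 q)"
    by (rule antiderivative_diff[OF connected_I[OF q] F d Suc.prems(2) X0_in[OF q]])
  moreover have "?G (X0 q) = F j (q, X0 q)"
    unfolding G_eq by (simp add: prim_base)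
  ultimately show ?case by simp
qed

end

section \<open>Evaluation of Laurent polynomials\<close>

text \<open>Abstract in coefficients and exponents because it is used at two levels: integers with
  monomials in the R_i, then such polynomials with Laurent monomials in the x_j and y_j.\<close>

locale evaluation =
  fixes \<phi> :: "'c::comm_ring_1 \<Rightarrow> real" and \<psi> :: "'m::comm_monoid_add \<Rightarrow> real"
  assumes \<phi>_zero [simp]: "\<phi> 0 = 0" and \<phi>_one [simp]: "\<phi> 1 = 1"
    and \<phi>_add: "\<phi> (a + b) = \<phi> a + \<phi> b" and \<phi>_mult: "\<phi> (a * b) = \<phi> a * \<phi> b"
    and \<psi>_zero [simp]: "\<psi> 0 = 1" and \<psi>_add: "\<psi> (u + v) = \<psi> u * \<psi> v"
begin

definition eval_pm :: "('m \<Rightarrow>\<^sub>0 'c) \<Rightarrow> real" where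
  "eval_pm p = (\<Sum>m\<in>keys p. \<phi> (lookup p m) * \<psi> m)"

lemma eval_pm_superset:
  assumes "finite A" "keys p \<subseteq> A"
  shows "eval_pm p = (\<Sum>m\<in>A. \<phi> (lookup p m) * \<psi> m)"
  unfolding eval_pm_def by (rule sum.mono_neutral_left) (use assms in \<open>auto simp: in_keys_iff\<close>)

lemma eval_pm_zero [simp]: "eval_pm 0 = 0"
  by (simp add: eval_pm_def)

lemma eval_pm_single: "eval_pm (single m c) = \<phi> c * \<psi> m"
  using eval_pm_superset[of "{m}" "single m c"] by simp

lemma eval_pm_one [simp]: "eval_pm 1 = 1"
  using eval_pm_single[of 0 1] by simp

lemma eval_pm_add: "eval_pm (p + q) = eval_pm p + eval_pm q"
proof -
  let ?A = "keys p \<union> keys q"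
  have "keys (p + q) \<subseteq> ?A" by (rule Poly_Mapping.keys_add)
  then show ?thesis
    by (simp add: eval_pm_superset[of ?A] lookup_add \<phi>_add distrib_right sum.distrib)
qed

lemma eval_pm_sum: "eval_pm (\<Sum>i\<in>A. f i) = (\<Sum>i\<in>A. eval_pm (f i))"
  by (induction A rule: infinite_finite_induct) (auto simp: eval_pm_add)

lemma eval_pm_mult: "eval_pm (p * q) = eval_pm p * eval_pm q"
proof -
  have "p * q = (\<Sum>m\<in>keys p. \<Sum>k\<in>keys q.
      single (m + k) (lookup p m * lookup q k))"
    by (subst (1 2) sum_single_keys[symmetric]) (simp only: sum_product mult_single)
  then show ?thesis
    unfolding eval_pm_def[of p] eval_pm_def[of q] sum_product
    by (simp only: eval_pm_sum eval_pm_single \<phi>_mult \<psi>_add) (simp add: mult_ac)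
qed

lemma eval_pm_prod: "eval_pm (\<Prod>i\<in>A. f i) = (\<Prod>i\<in>A. eval_pm (f i))"
  by (induction A rule: infinite_finite_induct) (auto simp: eval_pm_mult)

lemma eval_pm_diff: "eval_pm (p - q) = eval_pm p - eval_pm q"
  using eval_pm_add[of "p - q" q] by simp

lemma eval_pm_of_int: "eval_pm (of_int k * p) = of_int k * eval_pm p"
proof -
  have "eval_pm (of_nat n * p) = of_nat n * eval_pm p" for n
    by (induction n) (auto simp: distrib_right eval_pm_add)
  moreover have "eval_pm (- p) = - eval_pm p" for p using eval_pm_diff[of 0 p] by simp
  ultimately show ?thesis by (cases k rule: int_cases2) auto
qed

lemma eval_pm_int: "eval_pm (of_int k) = of_int k"
  using eval_pm_of_int[of k 1] by simp

end

section \<open>Values of coefficients and of Laurent monomials\<close>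

definition rpow :: "(nat \<Rightarrow> real) \<Rightarrow> (nat \<Rightarrow>\<^sub>0 nat) \<Rightarrow> real" where
  "rpow \<rho> b = (\<Prod>k\<in>keys b. \<rho> k ^ lookup b k)"

lemma rpow_superset:
  assumes "finite A" "keys b \<subseteq> A"
  shows "rpow \<rho> b = (\<Prod>k\<in>A. \<rho> k ^ lookup b k)"
  unfolding rpow_def by (rule prod.mono_neutral_left) (use assms in \<open>auto simp: in_keys_iff\<close>)

lemma rpow_add: "rpow \<rho> (a + b) = rpow \<rho> a * rpow \<rho> b"
proof -
  let ?A = "keys a \<union> keys b"
  have "keys (a + b) \<subseteq> ?A" by (rule Poly_Mapping.keys_add)
  then show ?thesis
    by (simp add: rpow_superset[of ?A] lookup_add power_add prod.distrib)
qed

interpretation ceval: evaluation "of_int :: int \<Rightarrow> real" "rpow \<rho>" for \<rho>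
  by unfold_locales (auto simp: rpow_add rpow_def[of _ 0])

text \<open>\<open>l\<close> gives the logarithms of the values of the variables, so that monomials
  with negative exponents are defined, positive and analytic in \<open>l\<close> without side
  conditions.\<close>

definition mono_val :: "(var \<Rightarrow> real) \<Rightarrow> expo \<Rightarrow> real" where
  "mono_val l m = exp (\<Sum>v\<in>keys m. of_int (lu m v) * l v)"

lemma mono_val_superset:
  assumes "finite A" "keys m \<subseteq> A"
  shows "mono_val l m = exp (\<Sum>v\<in>A. of_int (lu m v) * l v)"
  unfolding mono_val_def
  by (rule arg_cong[of _ _ exp], rule sum.mono_neutral_left) (use assms in \<open>auto simp: in_keys_iff\<close>)

lemma mono_val_add: "mono_val l (a + b) = mono_val l a * mono_val l b"
proof -
  let ?A = "keys a \<union> keys b"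
  have "keys (a + b) \<subseteq> ?A" by (rule Poly_Mapping.keys_add)
  then show ?thesis
    by (simp add: mono_val_superset[of ?A] lookup_add distrib_right sum.distrib exp_add)
qed

lemma mono_val_zero: "mono_val l 0 = 1"
  by (simp add: mono_val_def)

lemma mono_val_single: "mono_val l (single v k) = exp (of_int k * l v)"
  using mono_val_superset[of "{v}" "single v k" l] by simp

lemma mono_val_pos: "0 < mono_val l m"
  by (simp add: mono_val_def)

interpretation leval: evaluation "ceval.eval_pm \<rho>" "mono_val l" for \<rho> l
  by unfold_locales (auto simp: ceval.eval_pm_add ceval.eval_pm_mult mono_val_zero mono_val_add)

abbreviation ceval :: "(nat \<Rightarrow> real) \<Rightarrow> coeff \<Rightarrow> real" where "ceval \<equiv> ceval.eval_pm"
abbreviation leval :: "(nat \<Rightarrow> real) \<Rightarrow> (var \<Rightarrow> real) \<Rightarrow> lpoly \<Rightarrow> real" where "leval \<equiv> leval.eval_pm"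

lemma ceval_Rvar: "ceval \<rho> (Rvar i) = \<rho> i"
  unfolding Rvar_def ceval.eval_pm_single using rpow_superset[of "{i}" "single i 1" \<rho>] by simp

lemma ceval_Delta: "ceval \<rho> (Delta i) = (\<Prod>k = 1..i. \<rho> k)"
  by (simp add: Delta_def ceval.eval_pm_prod ceval_Rvar)

lemma leval_const: "leval \<rho> l (const c) = ceval \<rho> c"
  by (simp add: const_def leval.eval_pm_single mono_val_zero)

lemma leval_monom: "leval \<rho> l (monom m) = mono_val l m"
  by (simp add: monom_def leval.eval_pm_single)

lemma leval_laurent_0:
  assumes "p \<in> laurent n 0"
  shows "leval \<rho> l p = leval \<rho> l' p"
proof -
  have "mono_val l m = mono_val l' m" if "m \<in> keys p" for m
    using assms that by (auto simp: laurent_def keys_eq_empty mono_val_zero)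
  then show ?thesis by (simp add: leval.eval_pm_def)
qed

text \<open>For \<open>l\<close> depending on \<open>x\<close>, the derivation \<open>\<partial>\<close> becomes \<open>x * d/dx\<close> as soon as the logarithms
  of the variables have the derivatives prescribed by \<open>\<partial>\<close>.\<close>

definition prescribed :: "nat \<Rightarrow> (nat \<Rightarrow> real) \<Rightarrow> (var \<Rightarrow> real) \<Rightarrow> var \<Rightarrow> real" where
  "prescribed n \<rho> l v = (case v of
      XVar j \<Rightarrow> if j \<in> {1..n} then (\<Prod>k = 1..j. \<rho> k) * mono_val l (ratio_expo j) else 0
    | YVar j \<Rightarrow> if j \<in> {1..n} then (\<Prod>k = 1..j. \<rho> k) * mono_val l (ratio_expo (Suc j)) else 0)"

text \<open>The logarithmic derivative of y_j carries the extra factor x_j / y_j compared with that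
  of x_j; this turns its ratio of index j into the one of index j + 1.\<close>

lemma ratio_expo_Suc:
  "1 \<le> j \<Longrightarrow> ratio_expo (Suc j) = ratio_expo j + eX j - eY j"
  by (simp add: ratio_expo_def)

lemma sum_keys_prescribed:
  "(\<Sum>v\<in>keys m. of_int (lu m v) * prescribed n \<rho> l v) =
    (\<Sum>j = 1..n. of_int (lu m (XVar j)) * prescribed n \<rho> l (XVar j) + of_int (lu m (YVar j)) * prescribed n \<rho> l (YVar j))"
proof -
  let ?B = "XVar ` {1..n} \<union> YVar ` {1..n}"
  have "(\<Sum>v\<in>keys m. of_int (lu m v) * prescribed n \<rho> l v) =
      (\<Sum>v\<in>keys m \<union> ?B. of_int (lu m v) * prescribed n \<rho> l v)"
    by (rule sum.mono_neutral_left) (auto simp: in_keys_iff)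
  also have "\<dots> = (\<Sum>v\<in>?B. of_int (lu m v) * prescribed n \<rho> l v)"
    by (rule sum.mono_neutral_right) (auto simp: prescribed_def split: var.splits)
  also have "\<dots> = (\<Sum>v\<in>XVar ` {1..n}. of_int (lu m v) * prescribed n \<rho> l v) +
      (\<Sum>v\<in>YVar ` {1..n}. of_int (lu m v) * prescribed n \<rho> l v)"
    by (rule sum.union_disjoint) auto
  finally show ?thesis by (simp add: sum.reindex inj_on_def sum.distrib)
qed

text \<open>A derivation acts on a monomial as multiplication by its logarithmic derivative.\<close>

lemma leval_deriv_op_single:
  "leval \<rho> l (deriv_op n (single m c)) =
     leval \<rho> l (single m c) * (\<Sum>v\<in>keys m. of_int (lu m v) * prescribed n \<rho> l v)"
proof -
  have "leval \<rho> l (deriv_op n (single m c)) = (\<Sum>j = 1..n.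
      of_int (lu m (XVar j)) * ceval \<rho> c * (\<Prod>k = 1..j. \<rho> k) * (mono_val l m * mono_val l (ratio_expo j)) +
      of_int (lu m (YVar j)) * ceval \<rho> c * (\<Prod>k = 1..j. \<rho> k) * (mono_val l m * mono_val l (ratio_expo (Suc j))))"
    unfolding deriv_op_single leval.eval_pm_sum
  proof (rule sum.cong[OF refl])
    fix j assume j: "j \<in> {1..n}"
    have e: "m - eY j + eX j + ratio_expo j = m + ratio_expo (Suc j)"
      using ratio_expo_Suc[of j] j by (simp add: algebra_simps)
    show "leval \<rho> l (single (m + ratio_expo j) (of_int (lu m (XVar j)) * c * Delta j) +
     single (m - eY j + eX j + ratio_expo j)
       (of_int (lu m (YVar j)) * c * Delta j)) =
      of_int (lu m (XVar j)) * ceval \<rho> c * (\<Prod>k = 1..j. \<rho> k) * (mono_val l m * mono_val l (ratio_expo j)) +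
      of_int (lu m (YVar j)) * ceval \<rho> c * (\<Prod>k = 1..j. \<rho> k) * (mono_val l m * mono_val l (ratio_expo (Suc j)))"
      unfolding e leval.eval_pm_add leval.eval_pm_single ceval.eval_pm_mult mult.assoc ceval.eval_pm_of_int
      by (simp add: ceval.eval_pm_int ceval.eval_pm_mult ceval_Delta mono_val_add)
  qed
  also have "\<dots> = leval \<rho> l (single m c) * (\<Sum>j = 1..n.
      of_int (lu m (XVar j)) * prescribed n \<rho> l (XVar j) + of_int (lu m (YVar j)) * prescribed n \<rho> l (YVar j))"
    unfolding leval.eval_pm_single sum_distrib_left
    by (rule sum.cong) (auto simp: prescribed_def algebra_simps)
  finally show ?thesis unfolding sum_keys_prescribed .
qed

lemma mono_val_derivative:
  assumes "\<And>v. ((\<lambda>x. l x v) has_real_derivative l' v) (at x)"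
  shows "((\<lambda>x. mono_val (l x) m) has_real_derivative
    mono_val (l x) m * (\<Sum>v\<in>keys m. of_int (lu m v) * l' v)) (at x)"
proof -
  have "((\<lambda>x. \<Sum>v\<in>keys m. of_int (lu m v) * l x v) has_real_derivative
      (\<Sum>v\<in>keys m. of_int (lu m v) * l' v)) (at x)"
    by (intro DERIV_sum DERIV_cmult assms)
  from DERIV_chain2[OF DERIV_exp this] show ?thesis by (simp add: mono_val_def)
qed

lemma leval_derivative:
  assumes l: "\<And>v. ((\<lambda>x. l x v) has_real_derivative prescribed n \<rho> (l x) v / x) (at x)"
  shows "((\<lambda>x. leval \<rho> (l x) p) has_real_derivative leval \<rho> (l x) (deriv_op n p) / x) (at x)"
proof -
  have "((\<lambda>x. \<Sum>m\<in>keys p. ceval \<rho> (lookup p m) * mono_val (l x) m) has_real_derivative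
    (\<Sum>m\<in>keys p. ceval \<rho> (lookup p m) *
       (mono_val (l x) m * (\<Sum>v\<in>keys m. of_int (lu m v) * (prescribed n \<rho> (l x) v / x))))) (at x)"
    by (intro DERIV_sum DERIV_cmult mono_val_derivative l)
  moreover have "(\<Sum>m\<in>keys p. ceval \<rho> (lookup p m) *
       (mono_val (l x) m * (\<Sum>v\<in>keys m. of_int (lu m v) * (prescribed n \<rho> (l x) v / x)))) =
     leval \<rho> (l x) (deriv_op n p) / x"
  proof -
    have "leval \<rho> (l x) (deriv_op n p) =
        (\<Sum>m\<in>keys p. leval \<rho> (l x) (deriv_op n (single m (lookup p m))))"
      by (subst sum_single_keys[of p, symmetric]) (simp only: deriv_op_sum leval.eval_pm_sum)
    then show ?thesis
      by (simp add: leval_deriv_op_single leval.eval_pm_single sum_divide_distrib sum_distrib_left mult.assoc)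
  qed
  ultimately show ?thesis by (simp add: leval.eval_pm_def[of _ _ p])
qed

lemma cext_ceval:
  assumes "\<And>i. cext (\<rho> i) z"
  shows "cext (\<lambda>z. ceval (\<lambda>i. \<rho> i z) c) z"
  unfolding ceval.eval_pm_def rpow_def by (intro cext_sum cext_mult cext_const cext_prod cext_power assms)

lemma cext_mono_val:
  assumes "\<And>v. cext (l v) z"
  shows "cext (\<lambda>z. mono_val (\<lambda>v. l v z) m) z"
  unfolding mono_val_def by (intro cext_exp cext_sum cext_mult cext_const assms)

lemma cext_leval:
  assumes "\<And>i. cext (\<rho> i) z" "\<And>v. cext (l v) z"
  shows "cext (\<lambda>z. leval (\<lambda>i. \<rho> i z) (\<lambda>v. l v z) p) z"
  unfolding leval.eval_pm_def by (intro cext_sum cext_mult cext_ceval cext_mono_val assms)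

text \<open>When \<open>dvar n\<close> evaluates to x times the derivative of g_n, the left side is
  x^2 phi''. In the logarithmic derivative of \<open>dvar n\<close> the y-part of index j has the
  ratio of index j + 1, so the terms combine to differences \<open>D j - D (j - 1)\<close>; the
  subtracted 1 supplies the term \<open>D 0 * E 1\<close>. The product of the y_i clears the
  denominators of the ratios and leads to \<open>dd_start n\<close>.\<close>

lemma leval_second_derivative:
  assumes "1 \<le> n"
  shows "leval \<rho> l (deriv_op n (dvar n)) - leval \<rho> l (dvar n) = leval \<rho> l (dd_start n) *
    mono_val l (eX n + ratio_expo n - (\<Sum>i = 1..<n. eY i))"
proof -
  define D where "D i = (\<Prod>k = 1..i. \<rho> k)" for i
  define E where "E j = mono_val l (ratio_expo j)" for j
  let ?m = "eX n + ratio_expo n"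
  let ?Y = "\<Sum>i = 1..<n. eY i"
  have E1: "E (Suc 0) = 1" by (simp add: E_def ratio_expo_def mono_val_zero)
  have dvar: "leval \<rho> l (dvar n) = D n * mono_val l ?m"
    by (simp add: dvar_eq leval.eval_pm_single ceval_Delta D_def)
  have "(\<Sum>v\<in>keys ?m. of_int (lu ?m v) * prescribed n \<rho> l v) =
      (\<Sum>j = 1..n. D j * E j - (if j < n then D j * E (Suc j) else 0))"
    unfolding sum_keys_prescribed
    by (rule sum.cong)
      (auto simp: lookup_add lookup_single when_def lookup_ratio_expo prescribed_def D_def E_def)
  also have "\<dots> = (\<Sum>j = 1..n. D j * E j) - (\<Sum>j = 1..<n. D j * E (Suc j))"
  proof -
    have "(\<Sum>j = 1..n. if j < n then D j * E (Suc j) else 0) = (\<Sum>j = 1..<n. D j * E (Suc j))"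
      by (rule sum.mono_neutral_cong_right) auto
    then show ?thesis by (simp add: sum_subtractf)
  qed
  also have "(\<Sum>j = 1..<n. D j * E (Suc j)) = (\<Sum>j = 1..n. D (j - 1) * E j) - 1"
  proof -
    have "(\<Sum>j = 1..n. D (j - 1) * E j) = (\<Sum>j = 0..<n. D j * E (Suc j))"
      by (rule sum.reindex_bij_witness[of _ Suc "\<lambda>j. j - 1"]) auto
    also have "\<dots> = D 0 * E (Suc 0) + (\<Sum>j = 1..<n. D j * E (Suc j))"
      using assms by (simp add: sum.atLeast_Suc_lessThan)
    finally show ?thesis by (simp add: D_def E1)
  qed
  finally have S: "(\<Sum>v\<in>keys ?m. of_int (lu ?m v) * prescribed n \<rho> l v) - 1 =
      (\<Sum>j = 1..n. (D j - D (j - 1)) * E j)"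
    by (simp add: sum_subtractf[symmetric] left_diff_distrib)
  have "leval \<rho> l (dd_start n) = D n * (\<Sum>j = 1..n. (D j - D (j - 1)) * (E j * mono_val l ?Y))"
  proof -
    have "leval \<rho> l (const (Delta j - Delta (j - 1)) * (\<Prod>i = 1..<j. varpow (XVar i) 1) * (\<Prod>i = j..<n. varpow (YVar i) 1)) =
        (D j - D (j - 1)) * (E j * mono_val l ?Y)" if j: "j \<in> {1..n}" for j
    proof -
      have "?Y = (\<Sum>i = 1..<j. eY i) + (\<Sum>i = j..<n. eY i)"
        using j by (simp add: sum.atLeastLessThan_concat)
      then have "(\<Sum>i = 1..<j. eX i) + (\<Sum>i = j..<n. eY i) = ratio_expo j + ?Y"
        by (simp add: ratio_expo_def sum_subtractf)
      then show ?thesis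
        unfolding varpow_def monom_prod leval.eval_pm_mult leval_const leval_monom ceval.eval_pm_diff ceval_Delta mult.assoc
          mono_val_add[symmetric] E_def D_def by simp
    qed
    then show ?thesis
      by (simp add: dd_start_def leval.eval_pm_mult leval.eval_pm_sum leval_const ceval_Delta D_def)
  qed
  then have R1: "leval \<rho> l (dd_start n) = D n * (\<Sum>j = 1..n. (D j - D (j - 1)) * E j) * mono_val l ?Y"
    by (simp only: sum_distrib_right mult.assoc)
  have R2: "mono_val l ?Y * mono_val l (?m - ?Y) = mono_val l ?m"
    unfolding mono_val_add[symmetric] by simp
  have R: "leval \<rho> l (dd_start n) * mono_val l (?m - ?Y) = D n * (\<Sum>j = 1..n. (D j - D (j - 1)) * E j) * mono_val l ?m"
    unfolding R1 by (subst mult.assoc) (simp only: R2)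
  have "leval \<rho> l (deriv_op n (dvar n)) - leval \<rho> l (dvar n) = leval \<rho> l (dvar n) *
      ((\<Sum>v\<in>keys ?m. of_int (lu ?m v) * prescribed n \<rho> l v) - 1)"
    unfolding dvar_eq leval_deriv_op_single by (simp add: right_diff_distrib)
  then show ?thesis unfolding S R dvar by (simp add: mult_ac)
qed

section \<open>Translated power compositions\<close>

type_synonym 'n point = "((real ^ 'n) \<times> (real ^ 'n)) \<times> real"

definition rcoef :: "(nat \<Rightarrow> 'n::finite) \<Rightarrow> (real ^ 'n) \<times> (real ^ 'n) \<Rightarrow> nat \<Rightarrow> real" where
  "rcoef e q i = snd q $ e i"

definition gval :: "(nat \<Rightarrow> 'n::finite) \<Rightarrow> nat \<Rightarrow> 'n point \<Rightarrow> real" where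
  "gval e i z = g_iter e (fst (fst z)) (snd (fst z)) (snd z) i"

text \<open>The value of x_j is g_(j-1) to the power r_j. This equals g_j - a_j, but its logarithm
  requires only g_(j-1) to be positive.\<close>

definition logs :: "(nat \<Rightarrow> 'n::finite) \<Rightarrow> 'n point \<Rightarrow> var \<Rightarrow> real" where
  "logs e z v = (case v of
      XVar j \<Rightarrow> if j \<in> {1..CARD('n)} then rcoef e (fst z) j * ln (gval e (j - 1) z) else 0
    | YVar j \<Rightarrow> if j \<in> {1..CARD('n)} then ln (gval e j z) else 0)"

definition pos_set :: "(nat \<Rightarrow> 'n::finite) \<Rightarrow> nat \<Rightarrow> 'n point set" where
  "pos_set e k = {z. \<forall>i\<le>k. 0 < gval e i z}"

definition rprod :: "(nat \<Rightarrow> 'n::finite) \<Rightarrow> nat \<Rightarrow> (real ^ 'n) \<times> (real ^ 'n) \<Rightarrow> real" where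
  "rprod e i q = (\<Prod>k = 1..i. rcoef e q k)"

lemma gval_0 [simp]: "gval e 0 = snd"
  by (simp add: gval_def fun_eq_iff)

lemma gval_Suc: "gval e (Suc i) z = fst (fst z) $ e (Suc i) + gval e i z powr rcoef e (fst z) (Suc i)"
  by (simp add: gval_def rcoef_def)

lemma pos_setD: "z \<in> pos_set e k \<Longrightarrow> i \<le> k \<Longrightarrow> 0 < gval e i z"
  by (simp add: pos_set_def)

lemma pos_set_mono: "j \<le> k \<Longrightarrow> pos_set e k \<subseteq> pos_set e j"
  by (auto simp: pos_set_def)

text \<open>The value of \<open>dvar (Suc i)\<close> over x. It is separated from
  \<open>gval_derivative\<close> because it asks for positivity only up to g_i, as
  \<open>is_interval_pos_set\<close> requires where the sign of the next iterate is still
  open.\<close>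

lemma gval_Suc_derivative:
  fixes e :: "nat \<Rightarrow> 'n::finite"
  assumes "(q, x) \<in> pos_set e i" "i < CARD('n)"
    and d: "((\<lambda>x. gval e i (q, x)) has_real_derivative
      gval e i (q, x) * rprod e i q * mono_val (logs e (q, x)) (ratio_expo (Suc i)) / x) (at x)"
  shows "((\<lambda>x. gval e (Suc i) (q, x)) has_real_derivative
      rprod e (Suc i) q * mono_val (logs e (q, x)) (eX (Suc i) + ratio_expo (Suc i)) / x) (at x)"
proof -
  let ?r = "rcoef e q (Suc i)" and ?E = "mono_val (logs e (q, x)) (ratio_expo (Suc i))"
  have g: "0 < gval e i (q, x)" using assms(1) pos_setD by blast
  have "((\<lambda>x. gval e i (q, x) powr ?r) has_real_derivative
      ?r * gval e i (q, x) powr (?r - of_nat 1) * (gval e i (q, x) * rprod e i q * ?E / x)) (at x)"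
    by (rule DERIV_fun_powr[OF d g])
  then have D: "((\<lambda>x. gval e (Suc i) (q, x)) has_real_derivative
      0 + ?r * gval e i (q, x) powr (?r - of_nat 1) * (gval e i (q, x) * rprod e i q * ?E / x)) (at x)"
    unfolding gval_Suc by (intro DERIV_add) simp_all
  have "gval e i (q, x) powr (?r - of_nat 1) * gval e i (q, x) = exp (logs e (q, x) (XVar (Suc i)))"
    using g assms(2) by (simp add: powr_diff logs_def) (simp add: powr_def)
  then have "?r * gval e i (q, x) powr (?r - of_nat 1) * (gval e i (q, x) * rprod e i q * ?E / x) =
      rprod e (Suc i) q * mono_val (logs e (q, x)) (eX (Suc i) + ratio_expo (Suc i)) / x"
    by (simp add: mono_val_add mono_val_single rprod_def)
  then show ?thesis by (intro DERIV_cong[OF D]) (simp only: add_0)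
qed

lemma gval_derivative:
  fixes e :: "nat \<Rightarrow> 'n::finite"
  assumes "(q, x) \<in> pos_set e i" "i \<le> CARD('n)"
  shows "((\<lambda>x. gval e i (q, x)) has_real_derivative
      gval e i (q, x) * rprod e i q * mono_val (logs e (q, x)) (ratio_expo (Suc i)) / x) (at x)"
  using assms
proof (induction i)
  case 0
  then show ?case
    using pos_setD[OF 0(1), of 0] by (simp add: rprod_def ratio_expo_def mono_val_zero)
next
  case (Suc i)
  have d: "((\<lambda>x. gval e (Suc i) (q, x)) has_real_derivative
      rprod e (Suc i) q * mono_val (logs e (q, x)) (eX (Suc i) + ratio_expo (Suc i)) / x) (at x)"
    using Suc pos_set_mono[of i "Suc i" e] by (intro gval_Suc_derivative) auto
  have "mono_val (logs e (q, x)) (eY (Suc i)) = gval e (Suc i) (q, x)"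
    using pos_setD[OF Suc.prems(1), of "Suc i"] Suc.prems(2) by (simp add: mono_val_single logs_def)
  moreover have "eX (Suc i) + ratio_expo (Suc i) =
      eY (Suc i) + ratio_expo (Suc (Suc i))"
    using ratio_expo_Suc[of "Suc i"] by simp
  ultimately show ?case using d by (simp only: mono_val_add mult_ac)
qed

lemma ln_gval_derivative:
  fixes e :: "nat \<Rightarrow> 'n::finite"
  assumes "(q, x) \<in> pos_set e CARD('n)" "i \<le> CARD('n)"
  shows "((\<lambda>x. ln (gval e i (q, x))) has_real_derivative
      rprod e i q * mono_val (logs e (q, x)) (ratio_expo (Suc i)) / x) (at x)"
proof -
  have p: "(q, x) \<in> pos_set e i" using assms pos_set_mono[OF assms(2)] by blast
  then have g: "0 < gval e i (q, x)" by (rule pos_setD) simp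
  show ?thesis
    by (rule DERIV_cong[OF DERIV_chain2[OF DERIV_ln[OF g] gval_derivative[OF p assms(2)]]])
      (use g in simp)
qed

lemma logs_derivative:
  fixes e :: "nat \<Rightarrow> 'n::finite"
  assumes "(q, x) \<in> pos_set e CARD('n)"
  shows "((\<lambda>x. logs e (q, x) v) has_real_derivative
    prescribed CARD('n) (rcoef e q) (logs e (q, x)) v / x) (at x)"
proof -
  note ln = ln_gval_derivative[OF assms]
  show ?thesis
  proof (cases v)
    case (XVar j)
    show ?thesis
    proof (cases "j \<in> {1..CARD('n)}")
      case True
      then obtain i where i: "j = Suc i" "i \<le> CARD('n)" by (cases j) auto
      have "((\<lambda>x. rcoef e q j * ln (gval e i (q, x))) has_real_derivative
          rcoef e q j * (rprod e i q * mono_val (logs e (q, x)) (ratio_expo (Suc i)) / x)) (at x)"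
        by (rule DERIV_cmult[OF ln[OF i(2)]])
      then show ?thesis
        using True i(1) by (simp add: XVar logs_def prescribed_def rprod_def mult_ac)
    next
      case False
      then have "logs e z v = 0" for z by (auto simp: XVar logs_def)
      then show ?thesis using False by (auto simp: XVar prescribed_def)
    qed
  next
    case (YVar j)
    show ?thesis
    proof (cases "j \<in> {1..CARD('n)}")
      case True
      then show ?thesis using ln[of j] by (simp add: YVar logs_def prescribed_def rprod_def)
    next
      case False
      then have "logs e z v = 0" for z by (auto simp: YVar logs_def)
      then show ?thesis using False by (auto simp: YVar prescribed_def)
    qed
  qed
qed

text \<open>The derivative of the next iterate is \<open>rprod e (Suc k) q\<close>, whose sign
  depends on r alone, times a nonnegative function. Hence that iterate is monotone on the previous
  interval, and it is positive on a subinterval.\<close>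

lemma is_interval_pos_set:
  fixes e :: "nat \<Rightarrow> 'n::finite"
  shows "k \<le> CARD('n) \<Longrightarrow> is_interval {x. (q, x) \<in> pos_set e k}"
proof (induction k)
  case 0
  then show ?case by (auto simp: pos_set_def is_interval_1)
next
  case (Suc k)
  let ?D = "{x. (q, x) \<in> pos_set e k}"
  have iv: "is_interval ?D" using Suc by simp
  define M where "M x = mono_val (logs e (q, x)) (eX (Suc k) + ratio_expo (Suc k)) / x" for x
  have d: "((\<lambda>x. gval e (Suc k) (q, x)) has_real_derivative rprod e (Suc k) q * M x) (at x)"
    if "x \<in> ?D" for x
    using gval_Suc_derivative[of q x e k] gval_derivative[of q x e k] that Suc.prems by (simp add: M_def)
  have M: "0 \<le> M x" if "x \<in> ?D" for x
    using pos_setD[of "(q, x)" e k 0] that mono_val_pos[of "logs e (q, x)"] by (simp add: M_def less_imp_le)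
  have "{x. (q, x) \<in> pos_set e (Suc k)} = {x\<in>?D. 0 < gval e (Suc k) (q, x)}"
    by (auto simp: pos_set_def le_Suc_eq)
  moreover have "is_interval {x\<in>?D. 0 < gval e (Suc k) (q, x)}"
    unfolding is_interval_1
  proof (intro ballI allI impI)
    fix u v w
    assume u: "u \<in> {x\<in>?D. 0 < gval e (Suc k) (q, x)}" and v: "v \<in> {x\<in>?D. 0 < gval e (Suc k) (q, x)}"
      and w: "u \<le> w \<and> w \<le> v"
    have D: "y \<in> ?D" if "u \<le> y" "y \<le> v" for y
      using iv u v that unfolding is_interval_1 by blast
    show "w \<in> {x\<in>?D. 0 < gval e (Suc k) (q, x)}"
    proof (cases "0 \<le> rprod e (Suc k) q")
      case True
      have "gval e (Suc k) (q, u) \<le> gval e (Suc k) (q, w)"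
      proof (rule DERIV_nonneg_imp_nondecreasing[where f = "\<lambda>x. gval e (Suc k) (q, x)"])
        fix y assume y: "u \<le> y" "y \<le> w"
        then have "y \<in> ?D" using D w by auto
        then show "\<exists>z. ((\<lambda>x. gval e (Suc k) (q, x)) has_real_derivative z) (at y) \<and> 0 \<le> z"
          using d M True by (intro exI[of _ "rprod e (Suc k) q * M y"]) auto
      qed (use w in simp)
      then show ?thesis using u D[of w] w by auto
    next
      case False
      have "gval e (Suc k) (q, v) \<le> gval e (Suc k) (q, w)"
      proof (rule DERIV_nonpos_imp_nonincreasing[where f = "\<lambda>x. gval e (Suc k) (q, x)"])
        fix y assume y: "w \<le> y" "y \<le> v"
        then have "y \<in> ?D" using D w by auto
        then show "\<exists>z. ((\<lambda>x. gval e (Suc k) (q, x)) has_real_derivative z) (at y) \<and> z \<le> 0"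
          using d M False by (intro exI[of _ "rprod e (Suc k) q * M y"]) (auto simp: mult_nonpos_nonneg)
      qed (use w in simp)
      then show ?thesis using v D[of w] w by auto
    qed
  qed
  ultimately show ?case by simp
qed

section \<open>Analytic dependence on (a, r, x)\<close>

lemma cext_coord_a: "cext (\<lambda>z::'n::finite point. fst (fst z) $ i) z"
  using cext_inner[of "((axis i 1, 0), 0)" z] by (simp add: inner_prod_def inner_axis)

lemma cext_coord_r: "cext (\<lambda>z::'n::finite point. snd (fst z) $ i) z"
  using cext_inner[of "((0, axis i 1), 0)" z] by (simp add: inner_prod_def inner_axis)

lemma cext_coord_x: "cext (\<lambda>z::'n::finite point. snd z) z"
  using cext_inner[of "((0, 0), 1)" z] by (simp add: inner_prod_def)

lemma cext_rcoef: "cext (\<lambda>z::'n::finite point. rcoef e (fst z) i) z"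
  unfolding rcoef_def by (rule cext_coord_r)

lemma cext_rprod: "cext (\<lambda>z::'n::finite point. rprod e i (fst z)) z"
  unfolding rprod_def by (intro cext_prod cext_rcoef)

lemma cext_gval: "z \<in> pos_set e k \<Longrightarrow> i \<le> Suc k \<Longrightarrow> cext (\<lambda>z. gval e i z) z"
proof (induction i)
  case (Suc i)
  then show ?case
    unfolding gval_Suc by (intro cext_add cext_coord_a cext_powr cext_rcoef) (auto intro: pos_setD)
qed (simp add: cext_coord_x)

lemma cext_logs:
  fixes e :: "nat \<Rightarrow> 'n::finite"
  assumes "z \<in> pos_set e CARD('n)"
  shows "cext (\<lambda>z. logs e z v) z"
proof (cases v)
  case (XVar j)
  show ?thesis
  proof (cases "j \<in> {1..CARD('n)}")
    case True
    then have "cext (\<lambda>z. rcoef e (fst z) j * ln (gval e (j - 1) z)) z"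
      by (intro cext_mult cext_rcoef cext_ln cext_gval[OF assms] pos_setD[OF assms]) auto
    then show ?thesis using True by (simp add: logs_def XVar)
  next
    case False
    then have "logs e z v = 0" for z by (auto simp: XVar logs_def)
    then show ?thesis by (simp add: cext_const)
  qed
next
  case (YVar j)
  show ?thesis
  proof (cases "j \<in> {1..CARD('n)}")
    case True
    then have "cext (\<lambda>z. ln (gval e j z)) z"
      by (intro cext_ln cext_gval[OF assms] pos_setD[OF assms]) auto
    then show ?thesis using True by (simp add: logs_def YVar)
  next
    case False
    then have "logs e z v = 0" for z by (auto simp: YVar logs_def)
    then show ?thesis by (simp add: cext_const)
  qed
qed

lemma open_pos_set:
  fixes e :: "nat \<Rightarrow> 'n::finite"
  shows "open (pos_set e k)"
proof (subst open_subopen, intro ballI)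
  fix z assume z: "z \<in> pos_set e k"
  have "\<forall>\<^sub>F w in nhds z. 0 < gval e i w" if "i \<in> {..k}" for i
    using order_tendstoD(1)[OF cext_continuous[OF cext_gval[OF z, of i]] pos_setD[OF z, of i]] that by simp
  then have "\<forall>\<^sub>F w in nhds z. \<forall>i\<in>{..k}. 0 < gval e i w" by (intro eventually_ball_finite) auto
  then have "\<forall>\<^sub>F w in nhds z. w \<in> pos_set e k" by (rule eventually_mono) (simp add: pos_set_def)
  then show "\<exists>T. open T \<and> z \<in> T \<and> T \<subseteq> pos_set e k" unfolding eventually_nhds by blast
qed

definition fibre :: "(nat \<Rightarrow> 'n::finite) \<Rightarrow> (real ^ 'n) \<times> (real ^ 'n) \<Rightarrow> real set" where
  "fibre e q = {x. (q, x) \<in> pos_set e CARD('n)}"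

text \<open>The derivative of ln g_i is \<open>rprod e i\<close> times a positive function, so the
  factor \<open>rprod e i\<close> makes its square appear and every summand nondecreasing, whatever
  the signs of r. The summand for 0 is ln x and makes the sum strictly increasing.\<close>

definition balance :: "(nat \<Rightarrow> 'n::finite) \<Rightarrow> 'n point \<Rightarrow> real" where
  "balance e z = (\<Sum>i\<le>CARD('n). rprod e i (fst z) * ln (gval e i z))"

lemma fibreD:
  fixes e :: "nat \<Rightarrow> 'n::finite"
  shows "x \<in> fibre e q \<Longrightarrow> (q, x) \<in> pos_set e CARD('n)"
  by (simp add: fibre_def)

lemma connected_fibre: "connected (fibre e q)"
  using is_interval_pos_set[of "CARD('n)" q e] is_interval_connected unfolding fibre_def by blast

lemma open_fibre: "open (fibre e q)"
  using open_vimage[OF open_pos_set, of "\<lambda>x. (q, x)" e] by (simp add: fibre_def vimage_def continuous_on_Pair)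

lemma fibre_pos: "x \<in> fibre e q \<Longrightarrow> 0 < x"
  using pos_setD[OF fibreD, of x e q 0] by simp

lemma mult_ln_gval_derivative:
  fixes e :: "nat \<Rightarrow> 'n::finite"
  assumes "x \<in> fibre e q" "i \<le> CARD('n)"
  shows "((\<lambda>x. rprod e i q * ln (gval e i (q, x))) has_real_derivative
      (rprod e i q)\<^sup>2 * mono_val (logs e (q, x)) (ratio_expo (Suc i)) / x) (at x)"
  by (rule DERIV_cong[OF DERIV_cmult[OF ln_gval_derivative[OF fibreD[OF assms(1)] assms(2)]]])
    (simp add: power2_eq_square)

lemma balance_derivative:
  fixes e :: "nat \<Rightarrow> 'n::finite"
  assumes "x \<in> fibre e q"
  shows "\<exists>D>0. ((\<lambda>x. balance e (q, x)) has_real_derivative D) (at x)"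
proof (intro exI conjI)
  let ?D = "\<lambda>i. (rprod e i q)\<^sup>2 * mono_val (logs e (q, x)) (ratio_expo (Suc i)) / x"
  show "((\<lambda>x. balance e (q, x)) has_real_derivative (\<Sum>i\<le>CARD('n). ?D i)) (at x)"
    unfolding balance_def fst_conv by (intro DERIV_sum mult_ln_gval_derivative assms) simp
  have "0 < ?D 0"
    using fibre_pos[OF assms] mono_val_pos[of "logs e (q, x)"] by (simp add: rprod_def)
  moreover have "0 \<le> ?D i" for i
    using fibre_pos[OF assms] mono_val_pos[of "logs e (q, x)" "ratio_expo (Suc i)"] by simp
  ultimately show "0 < (\<Sum>i\<le>CARD('n). ?D i)" by (intro sum_pos2[of _ 0]) auto
qed

lemma balance_term_mono:
  fixes e :: "nat \<Rightarrow> 'n::finite"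
  assumes "x \<in> fibre e q" "y \<in> fibre e q" "x \<le> y" "i \<le> CARD('n)"
  shows "rprod e i q * ln (gval e i (q, x)) \<le> rprod e i q * ln (gval e i (q, y))"
proof (rule DERIV_nonneg_imp_nondecreasing[OF assms(3), where f = "\<lambda>x. rprod e i q * ln (gval e i (q, x))"])
  fix t assume "x \<le> t" "t \<le> y"
  then have t: "t \<in> fibre e q" using connected_contains_Icc[OF connected_fibre assms(1,2)] by auto
  show "\<exists>d. ((\<lambda>x. rprod e i q * ln (gval e i (q, x))) has_real_derivative d) (at t) \<and> 0 \<le> d"
    using mult_ln_gval_derivative[OF t assms(4)] fibre_pos[OF t] mono_val_pos[of "logs e (q, t)" "ratio_expo (Suc i)"]
    by (intro exI[of _ "(rprod e i q)\<^sup>2 * mono_val (logs e (q, t)) (ratio_expo (Suc i)) / t"]) simp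
qed

lemma balance_strict_mono:
  assumes "x \<in> fibre e q" "y \<in> fibre e q" "x < y"
  shows "balance e (q, x) < balance e (q, y)"
proof (rule DERIV_pos_imp_increasing[OF assms(3), where f = "\<lambda>x. balance e (q, x)"])
  fix t assume "x \<le> t" "t \<le> y"
  then have "t \<in> fibre e q" using connected_contains_Icc[OF connected_fibre assms(1,2)] by auto
  then show "\<exists>d. ((\<lambda>x. balance e (q, x)) has_real_derivative d) (at t) \<and> 0 < d"
    using balance_derivative by blast
qed

text \<open>Covers the summands of \<open>balance\<close> with factor 0, which give no control over
  g_i.\<close>

lemma gval_const:
  fixes e :: "nat \<Rightarrow> 'n::finite"
  assumes "x \<in> fibre e q" "y \<in> fibre e q" "rprod e i q = 0" "i \<le> CARD('n)"
  shows "gval e i (q, x) = gval e i (q, y)"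
proof -
  have "((\<lambda>x. gval e i (q, x)) has_real_derivative 0) (at t)" if "t \<in> fibre e q" for t
    using gval_derivative[OF subsetD[OF pos_set_mono[OF assms(4)] fibreD[OF that]] assms(4)] assms(3) by simp
  then have "gval e i (q, x) - gval e i (q, y) = (\<lambda>_. 0::real) x - (\<lambda>_. 0) y"
    by (intro antiderivative_diff[OF connected_fibre _ _ assms(1,2), where f = "\<lambda>_. 0"]) auto
  then show ?thesis by simp
qed

text \<open>Sublevel sets of \<open>\<bar>balance\<bar>\<close> are compact: all summands of \<open>balance\<close> increase with \<open>x\<close>, hence
  a bound on the sum bounds each summand, and this keeps every \<open>g\<^sub>i\<close> away from 0 and \<open>x = g\<^sub>0\<close>
  away from infinity.\<close>

lemma compact_balance_sublevel:
  fixes e :: "nat \<Rightarrow> 'n::finite"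
  assumes y: "y \<in> fibre e q"
  shows "compact {x \<in> fibre e q. \<bar>balance e (q, x)\<bar> \<le> \<bar>balance e (q, y)\<bar>}" (is "compact ?L")
proof -
  let ?t = "\<lambda>i x. rprod e i q * ln (gval e i (q, x))" and ?c = "\<bar>balance e (q, y)\<bar>"
  define B where "B = 2 * ?c + (\<Sum>i\<le>CARD('n). \<bar>?t i y\<bar>)"
  have bal: "balance e (q, x) = (\<Sum>i\<le>CARD('n). ?t i x)" for x by (simp add: balance_def)
  \<comment> \<open>The increments of all summands between \<open>y\<close> and \<open>x\<close>
    have the same sign, so each is bounded by the total increment, which is at most
    \<open>2 * ?c\<close>.\<close>
  have tB: "\<bar>?t i x\<bar> \<le> B" if x: "x \<in> ?L" and i: "i \<le> CARD('n)" for i x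
  proof -
    have "\<bar>?t i x - ?t i y\<bar> \<le> \<bar>\<Sum>i\<le>CARD('n). ?t i x - ?t i y\<bar>"
    proof (cases "y \<le> x")
      case True
      then have nn: "0 \<le> ?t j x - ?t j y" if "j \<in> {..CARD('n)}" for j
        using balance_term_mono[OF y, of x j] x that by simp
      have "?t i x - ?t i y \<le> (\<Sum>i\<le>CARD('n). ?t i x - ?t i y)"
        by (rule member_le_sum) (use i nn in auto)
      then show ?thesis using nn[of i] i by simp
    next
      case False
      then have nn: "0 \<le> ?t j y - ?t j x" if "j \<in> {..CARD('n)}" for j
        using balance_term_mono[OF _ y, of x j] x that by simp
      have "?t i y - ?t i x \<le> (\<Sum>i\<le>CARD('n). ?t i y - ?t i x)"
        by (rule member_le_sum) (use i nn in auto)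
      moreover have "(\<Sum>i\<le>CARD('n). ?t i y - ?t i x) = - (\<Sum>i\<le>CARD('n). ?t i x - ?t i y)"
        by (simp add: sum_subtractf)
      ultimately show ?thesis using nn[of i] i by simp
    qed
    also have "\<dots> = \<bar>balance e (q, x) - balance e (q, y)\<bar>" by (simp add: bal sum_subtractf)
    also have "\<dots> \<le> 2 * ?c"
      using x abs_triangle_ineq4[of "balance e (q, x)" "balance e (q, y)"] by simp
    finally have "\<bar>?t i x\<bar> \<le> 2 * ?c + \<bar>?t i y\<bar>" by simp
    moreover have "\<bar>?t i y\<bar> \<le> (\<Sum>i\<le>CARD('n). \<bar>?t i y\<bar>)"
      by (rule member_le_sum) (use i in auto)
    ultimately show ?thesis by (simp add: B_def)
  qed
  define d where "d i = (if rprod e i q = 0 then gval e i (q, y) else exp (- (B / \<bar>rprod e i q\<bar>)))" for i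
  have d0: "0 < d i" if "i \<le> CARD('n)" for i
    using pos_setD[OF fibreD[OF y] that] by (simp add: d_def)
  have d: "d i \<le> gval e i (q, x)" if x: "x \<in> ?L" and i: "i \<le> CARD('n)" for i x
  proof (cases "rprod e i q = 0")
    case True
    then show ?thesis using gval_const[OF _ y True i, of x] x by (simp add: d_def)
  next
    case False
    have g: "0 < gval e i (q, x)" using pos_setD[OF fibreD i] x by auto
    have "\<bar>rprod e i q\<bar> * \<bar>ln (gval e i (q, x))\<bar> \<le> B" using tB[OF x i] by (simp add: abs_mult)
    then have "\<bar>ln (gval e i (q, x))\<bar> \<le> B / \<bar>rprod e i q\<bar>" using False by (simp add: field_simps)
    then have "- (B / \<bar>rprod e i q\<bar>) \<le> ln (gval e i (q, x))" by linarith
    then have "exp (- (B / \<bar>rprod e i q\<bar>)) \<le> exp (ln (gval e i (q, x)))" by (simp only: exp_le_cancel_iff)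
    then show ?thesis using False g by (simp add: d_def)
  qed
  have bnd: "\<bar>x\<bar> \<le> exp B" if x: "x \<in> ?L" for x
  proof -
    have x0: "0 < x" using fibre_pos x by blast
    have "\<bar>ln x\<bar> \<le> B" using tB[OF x, of 0] by (simp add: rprod_def)
    then have "exp (ln x) \<le> exp B" by (simp only: exp_le_cancel_iff)
    then show ?thesis using x0 by simp
  qed
  have "closed ?L"
    unfolding closed_sequential_limits
  proof (intro allI impI)
    fix u s assume u: "(\<forall>k. u k \<in> ?L) \<and> u \<longlonglongrightarrow> s"
    \<comment> \<open>Passing to the limit in the next power requires a nonzero limit of g_i;
      therefore the lower bound \<open>d i\<close> is carried through the induction.\<close>
    have lim: "(\<lambda>k. gval e i (q, u k)) \<longlonglongrightarrow> gval e i (q, s) \<and> d i \<le> gval e i (q, s)" if "i \<le> CARD('n)" for i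
      using that
    proof (induction i)
      case 0
      have "d 0 \<le> s" by (rule LIMSEQ_le_const[of u]) (use u d[of _ 0] in auto)
      then show ?case using u by simp
    next
      case (Suc i)
      then have IH: "(\<lambda>k. gval e i (q, u k)) \<longlonglongrightarrow> gval e i (q, s)" "d i \<le> gval e i (q, s)" by auto
      have nz: "gval e i (q, s) \<noteq> 0" using d0[of i] IH(2) Suc.prems by auto
      have l: "(\<lambda>k. gval e (Suc i) (q, u k)) \<longlonglongrightarrow> gval e (Suc i) (q, s)"
        unfolding gval_Suc fst_conv by (intro tendsto_add tendsto_const tendsto_powr IH(1) nz)
      moreover have "d (Suc i) \<le> gval e (Suc i) (q, s)"
        by (rule LIMSEQ_le_const[OF l]) (use u d[OF _ Suc.prems] in auto)
      ultimately show ?case by blast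
    qed
    have s: "s \<in> fibre e q"
      using lim d0 by (force simp: fibre_def pos_set_def)
    have "isCont (\<lambda>x. balance e (q, x)) s"
      using balance_derivative[OF s] DERIV_isCont by blast
    then have "(\<lambda>k. balance e (q, u k)) \<longlonglongrightarrow> balance e (q, s)"
      using u isCont_tendsto_compose by blast
    then have "(\<lambda>k. \<bar>balance e (q, u k)\<bar>) \<longlonglongrightarrow> \<bar>balance e (q, s)\<bar>" by (rule tendsto_rabs)
    then have "\<bar>balance e (q, s)\<bar> \<le> ?c" by (rule LIMSEQ_le_const2) (use u in auto)
    with s show "s \<in> ?L" by simp
  qed
  moreover have "bounded ?L" unfolding bounded_iff using bnd by (intro exI[of _ "exp B"]) simp
  ultimately show ?thesis by (simp add: compact_eq_bounded_closed)
qed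

text \<open>In place of limits at the endpoints: the square of \<open>balance\<close> attains its
  minimum on the compact sublevel set, hence on the open fibre. Its derivative there is
  \<open>2 * balance e (q, m) * D\<close> with \<open>D > 0\<close>, so \<open>balance\<close>
  vanishes.\<close>

lemma ex_balance_zero:
  assumes "fibre e q \<noteq> {}"
  shows "\<exists>x\<in>fibre e q. balance e (q, x) = 0"
proof -
  obtain y where y: "y \<in> fibre e q" using assms by blast
  let ?L = "{x \<in> fibre e q. \<bar>balance e (q, x)\<bar> \<le> \<bar>balance e (q, y)\<bar>}"
  have "isCont (\<lambda>x. balance e (q, x)) x" if "x \<in> fibre e q" for x
    using balance_derivative[OF that] DERIV_isCont by blast
  then have "continuous_on ?L (\<lambda>x. (balance e (q, x))\<^sup>2)"
    by (intro continuous_at_imp_continuous_on ballI continuous_intros) auto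
  moreover have "?L \<noteq> {}" using y by auto
  ultimately obtain m where m: "m \<in> ?L" "\<And>x. x \<in> ?L \<Longrightarrow> (balance e (q, m))\<^sup>2 \<le> (balance e (q, x))\<^sup>2"
    using continuous_attains_inf[OF compact_balance_sublevel[OF y]] by blast
  have min: "(balance e (q, m))\<^sup>2 \<le> (balance e (q, x))\<^sup>2" if "x \<in> fibre e q" for x
  proof (cases "x \<in> ?L")
    case False
    then have "\<bar>balance e (q, m)\<bar> \<le> \<bar>balance e (q, x)\<bar>" using m(1) that by auto
    then show ?thesis by (simp add: abs_le_square_iff)
  qed (rule m(2))
  have mf: "m \<in> fibre e q" using m by simp
  obtain D where D: "D > 0" "((\<lambda>x. balance e (q, x)) has_real_derivative D) (at m)"
    using balance_derivative[OF mf] by blast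
  obtain d where d: "d > 0" "ball m d \<subseteq> fibre e q" using open_fibre mf open_contains_ball by blast
  have "((\<lambda>x. (balance e (q, x))\<^sup>2) has_real_derivative 2 * balance e (q, m) * D) (at m)"
    using D(2) by (auto intro!: derivative_eq_intros)
  then have "2 * balance e (q, m) * D = 0"
    by (rule DERIV_local_min[OF _ d(1)]) (use min d(2) in \<open>auto simp: dist_real_def subset_iff\<close>)
  then show ?thesis using D(1) mf by auto
qed

definition base_point :: "(nat \<Rightarrow> 'n::finite) \<Rightarrow> (real ^ 'n) \<times> (real ^ 'n) \<Rightarrow> real" where
  "base_point e q = (SOME x. x \<in> fibre e q \<and> balance e (q, x) = 0)"

lemma base_point:
  assumes "fibre e q \<noteq> {}"
  shows "base_point e q \<in> fibre e q" "balance e (q, base_point e q) = 0"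
  using someI_ex[of "\<lambda>x. x \<in> fibre e q \<and> balance e (q, x) = 0"] ex_balance_zero[OF assms]
  unfolding base_point_def by blast+

lemma base_point_unique:
  assumes "x \<in> fibre e q" "balance e (q, x) = 0"
  shows "base_point e q = x"
proof -
  have "fibre e q \<noteq> {}" using assms by blast
  from base_point[OF this] show ?thesis
    using balance_strict_mono[of x e q "base_point e q"] balance_strict_mono[of "base_point e q" e q x] assms
    by (metis less_irrefl linorder_neqE_linordered_idom)
qed

lemma cext_balance:
  fixes e :: "nat \<Rightarrow> 'n::finite"
  assumes "z \<in> pos_set e CARD('n)"
  shows "cext (balance e) z"
proof -
  have "cext (\<lambda>z. \<Sum>i\<le>CARD('n). rprod e i (fst z) * ln (gval e i z)) z"
    by (intro cext_sum cext_mult cext_rprod cext_ln cext_gval[OF assms] pos_setD[OF assms]) auto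
  then show ?thesis by (simp add: balance_def[abs_def])
qed

text \<open>The implicit function theorem gives an analytic zero near \<open>q\<close>; by
  continuity it stays in the fibres, and uniqueness of the zero in each fibre identifies it with the
  chosen point.\<close>

lemma cext_base_point:
  fixes e :: "nat \<Rightarrow> 'n::finite"
  assumes "fibre e q \<noteq> {}"
  shows "cext (base_point e) q"
proof -
  let ?x = "base_point e q"
  note x = base_point[OF assms]
  obtain D where D: "D > 0" "((\<lambda>x. balance e (q, x)) has_real_derivative D) (at ?x)"
    using balance_derivative[OF x(1)] by blast
  obtain X where X: "cext X q" "X q = ?x" "\<forall>\<^sub>F p in nhds q. balance e (p, X p) = 0"
    using cext_implicit_function[OF cext_balance[OF fibreD[OF x(1)]] x(2) D(2)] D(1) by blast
  have "((\<lambda>p. (p, X p)) \<longlongrightarrow> (q, ?x)) (nhds q)"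
    using tendsto_Pair[OF filterlim_ident cext_continuous[OF X(1)]] X(2) by simp
  then have "\<forall>\<^sub>F p in nhds q. (p, X p) \<in> pos_set e CARD('n)"
    by (rule topological_tendstoD[OF _ open_pos_set fibreD[OF x(1)]])
  with X(3) have "\<forall>\<^sub>F p in nhds q. X p = base_point e p"
    by eventually_elim (rule base_point_unique[symmetric], auto simp: fibre_def)
  with X(1) show ?thesis by (rule cext_cong)
qed

text \<open>The factors split off at each differentiation: 1 from phi', a monomial over x^2 from
  phi'', then a regularization monomial over x, where 1/x converts the derivation into d/dx. Powers
  of x are written as exponentials, so every weight is positive at every point.\<close>

definition weight :: "(nat \<Rightarrow> 'n::finite) \<Rightarrow> nat \<Rightarrow> 'n point \<Rightarrow> real" where
  "weight e k z = (case k of 0 \<Rightarrow> 1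
    | Suc 0 \<Rightarrow> mono_val (logs e z) (eX CARD('n) + ratio_expo CARD('n) -
        (\<Sum>i = 1..<CARD('n). eY i)) * exp (- (2 * ln (snd z)))
    | Suc (Suc j) \<Rightarrow> mono_val (logs e z) (reg_expo CARD('n)
        (deriv_op CARD('n) (dd_seq CARD('n) (dd_start CARD('n)) j))) * exp (- ln (snd z)))"

text \<open>phi, then phi', then the derivation-division sequence. Index 1 is phi' because
  \<open>dvar n\<close> evaluates to x times the derivative of g_n.\<close>

definition chain :: "(nat \<Rightarrow> 'n::finite) \<Rightarrow> nat \<Rightarrow> 'n point \<Rightarrow> real" where
  "chain e k z = (case k of 0 \<Rightarrow> gval e CARD('n) z - snd z
    | Suc 0 \<Rightarrow> leval (rcoef e (fst z)) (logs e z) (dvar CARD('n)) * exp (- ln (snd z)) - 1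
    | Suc (Suc j) \<Rightarrow> leval (rcoef e (fst z)) (logs e z) (dd_seq CARD('n) (dd_start CARD('n)) j))"

lemma cext_weight:
  fixes e :: "nat \<Rightarrow> 'n::finite"
  assumes "z \<in> pos_set e CARD('n)"
  shows "cext (weight e k) z"
proof -
  have x: "cext (\<lambda>z. ln (snd z)) z"
    by (intro cext_ln cext_coord_x) (use pos_setD[OF assms, of 0] in simp)
  have m: "cext (\<lambda>z. - (2 * ln (snd z))) z" "cext (\<lambda>z. - ln (snd z)) z"
    using cext_mult[OF cext_const[of "-2"] x] cext_mult[OF cext_const[of "-1"] x] by simp_all
  consider "k = 0" | "k = Suc 0" | j where "k = Suc (Suc j)" by (metis old.nat.exhaust)
  then show ?thesis
    unfolding weight_def[abs_def]
    by cases (auto intro!: cext_mult cext_exp cext_mono_val cext_const cext_logs assms m)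
qed

lemma weight_pos: "0 < weight e k z"
  unfolding weight_def by (auto simp: mono_val_pos split: nat.split)

lemma cext_chain:
  fixes e :: "nat \<Rightarrow> 'n::finite"
  assumes "z \<in> pos_set e CARD('n)"
  shows "cext (chain e k) z"
proof -
  have x: "cext (\<lambda>z. ln (snd z)) z"
    by (intro cext_ln cext_coord_x) (use pos_setD[OF assms, of 0] in simp)
  have m: "cext (\<lambda>z. - ln (snd z)) z"
    using cext_mult[OF cext_const[of "-1"] x] by simp
  have l: "cext (\<lambda>z. leval (rcoef e (fst z)) (logs e z) p) z" for p
    using cext_leval[of "\<lambda>i z. rcoef e (fst z) i" z "\<lambda>v z. logs e z v" p] cext_rcoef cext_logs[OF assms] by blast
  consider "k = 0" | "k = Suc 0" | j where "k = Suc (Suc j)" by (metis old.nat.exhaust)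
  then show ?thesis
    unfolding chain_def[abs_def]
    by cases (auto intro!: cext_diff cext_mult cext_exp cext_const cext_coord_x cext_gval[OF assms] l m)
qed

lemma chain_derivative:
  fixes e :: "nat \<Rightarrow> 'n::finite"
  assumes x: "x \<in> fibre e q"
  shows "((\<lambda>x. chain e k (q, x)) has_real_derivative weight e k (q, x) * chain e (Suc k) (q, x)) (at x)"
proof -
  let ?n = "CARD('n)" and ?l = "leval (rcoef e q) (logs e (q, x))"
  have n: "1 \<le> ?n" by (simp add: Suc_leI)
  have x0: "0 < x" using fibre_pos[OF x] .
  have lev: "((\<lambda>x. leval (rcoef e q) (logs e (q, x)) p) has_real_derivative ?l (deriv_op ?n p) / x) (at x)" for p
    by (rule leval_derivative[where l = "\<lambda>x. logs e (q, x)"]) (rule logs_derivative[OF fibreD[OF x]])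
  have inv: "exp (- ln x) = 1 / x" "exp (- (2 * ln x)) = 1 / x\<^sup>2"
  proof -
    show "exp (- ln x) = 1 / x" using x0 by (simp add: exp_minus divide_inverse)
    have "exp (2 * ln x) = x\<^sup>2" using x0 by (simp only: exp_double exp_ln)
    then show "exp (- (2 * ln x)) = 1 / x\<^sup>2" by (simp add: exp_minus divide_inverse)
  qed
  consider "k = 0" | "k = Suc 0" | j where "k = Suc (Suc j)" by (metis old.nat.exhaust)
  then show ?thesis
  proof cases
    case 1
    have "mono_val (logs e (q, x)) (single (YVar ?n) 1) = gval e ?n (q, x)"
      using pos_setD[OF fibreD[OF x], of ?n] n by (simp add: mono_val_single logs_def)
    moreover have "single (XVar ?n) 1 + ratio_expo ?n = single (YVar ?n) 1 + ratio_expo (Suc ?n)"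
      using ratio_expo_Suc[OF n] by simp
    ultimately have "?l (dvar ?n) = gval e ?n (q, x) * rprod e ?n q * mono_val (logs e (q, x)) (ratio_expo (Suc ?n))"
      by (simp add: dvar_eq leval.eval_pm_single ceval_Delta rprod_def mono_val_add)
    then show ?thesis
      unfolding 1 weight_def chain_def
      by (simp only: nat.case prod.sel mult_1 inv(1))
        (intro DERIV_cong[OF DERIV_diff[OF gval_derivative[OF fibreD[OF x] order_refl] DERIV_ident]], simp)
  next
    case 2
    have d: "((\<lambda>x. leval (rcoef e q) (logs e (q, x)) (dvar ?n) * (1 / x) - 1) has_real_derivative
        (?l (deriv_op ?n (dvar ?n)) - ?l (dvar ?n)) / x\<^sup>2) (at x)"
      using lev[of "dvar ?n"] x0
      by (auto intro!: derivative_eq_intros simp: field_simps power2_eq_square)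
    have "((\<lambda>x. leval (rcoef e q) (logs e (q, x)) (dvar ?n) * exp (- ln x) - 1) has_real_derivative
        (?l (deriv_op ?n (dvar ?n)) - ?l (dvar ?n)) / x\<^sup>2) (at x)"
      by (rule has_field_derivative_transform_within_open[OF d, of "{0<..}"])
        (use x0 in \<open>auto simp: exp_minus divide_inverse\<close>)
    then show ?thesis
      unfolding 2 weight_def chain_def leval_second_derivative[OF n]
      by (simp only: nat.case prod.sel inv dd_seq.simps) (simp add: mult_ac)
  next
    case 3
    let ?p = "dd_seq ?n (dd_start ?n) j"
    \<comment> \<open>If the derivation gives 0, both sides vanish, whatever exponent
      \<open>reg_expo\<close> assigns to 0.\<close>
    have "?l (deriv_op ?n ?p) = mono_val (logs e (q, x)) (reg_expo ?n (deriv_op ?n ?p)) * ?l (dd_seq ?n (dd_start ?n) (Suc j))"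
    proof (cases "deriv_op ?n ?p = 0")
      case False
      have "div_reg ?n (deriv_op ?n ?p) * monom (reg_expo ?n (deriv_op ?n ?p)) = deriv_op ?n ?p"
        using div_reg_times_reg[of ?n "deriv_op ?n ?p"] by (simp add: reg_def)
      then have "?l (deriv_op ?n ?p) = ?l (div_reg ?n (deriv_op ?n ?p)) * mono_val (logs e (q, x)) (reg_expo ?n (deriv_op ?n ?p))"
        by (metis leval.eval_pm_mult leval_monom)
      then show ?thesis using False by simp
    qed simp
    then have "?l (deriv_op ?n ?p) / x = weight e k (q, x) * chain e (Suc k) (q, x)"
      unfolding 3 weight_def chain_def by (simp add: inv del: dd_seq.simps)
    then show ?thesis
      using lev[of ?p] unfolding 3 by (simp add: chain_def del: dd_seq.simps)
  qed
qed

section \<open>The bundle of the intervals I(a,r) over U\<close>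

lemma dom_I_fibre: "dom_I e a r = fibre e (a, r)"
  by (simp add: dom_I_def fibre_def pos_set_def gval_def)

lemma pos_set_V:
  fixes e :: "nat \<Rightarrow> 'n::finite"
  shows "pos_set e CARD('n) = {(q, x). q \<in> U_set e \<and> x \<in> fibre e q}"
  by (fastforce simp: fibre_def U_set_def dom_I_def pos_set_def gval_def)

lemma weighted_bundle_powers:
  fixes e :: "nat \<Rightarrow> 'n::finite"
  shows "weighted_bundle (U_set e) (fibre e) (base_point e) (weight e)"
proof
  fix q z
  show "open {(q, x). q \<in> U_set e \<and> x \<in> fibre e q}"
    using open_pos_set by (simp flip: pos_set_V)
  have "U_set e = fst ` pos_set e CARD('n)"
    unfolding pos_set_V by (force simp: U_set_def dom_I_fibre)
  then show "open (U_set e)" using open_image_fst[OF open_pos_set] by metis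
  show "connected (fibre e q)" by (rule connected_fibre)
  have ne: "fibre e q \<noteq> {}" if "q \<in> U_set e" using that by (auto simp: U_set_def dom_I_fibre)
  show "base_point e q \<in> fibre e q" if "q \<in> U_set e" using base_point(1)[OF ne[OF that]] .
  show "cext (base_point e) q" if "q \<in> U_set e" using cext_base_point[OF ne[OF that]] .
  show "cext (weight e k) z" if "z \<in> {(q, x). q \<in> U_set e \<and> x \<in> fibre e q}" for k
    using cext_weight that by (simp flip: pos_set_V)
  show "0 < weight e k z" for k by (rule weight_pos)
qed

text \<open>\<open>V_set\<close> consists of triples \<open>(a, r, x)\<close>, whereas the bundle
  works with \<open>((a, r), x)\<close>.\<close>

lemma cext_reassoc:
  fixes f :: "('a::euclidean_space \<times> 'b::euclidean_space) \<times> 'c::euclidean_space \<Rightarrow> real"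
  assumes "cext f ((a, r), x)"
  shows "cext (\<lambda>z. f ((fst z, fst (snd z)), snd (snd z))) (a, r, x)"
proof (rule cext_compose[where G = "\<lambda>z. ((fst z, fst (snd z)), snd (snd z))"])
  show "cext (\<lambda>z. ((fst z, fst (snd z)), snd (snd z)) \<bullet> b) (a, r, x)" for b :: "('a \<times> 'b) \<times> 'c"
    using cext_inner[of "(fst (fst b), snd (fst b), snd b)" "(a, r, x)"] by (simp add: inner_prod_def add.assoc)
qed (use assms in simp)

lemma cext_section:
  fixes f :: "'q::euclidean_space \<times> real \<Rightarrow> real"
  assumes "cext f (q, X q)" "cext X q"
  shows "cext (\<lambda>q. f (q, X q)) q"
proof (rule cext_compose[where G = "\<lambda>q. (q, X q)"])
  show "cext (\<lambda>q. (q, X q) \<bullet> b) q" for b :: "'q \<times> real"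
  proof -
    have "cext (\<lambda>q. q \<bullet> fst b + X q * snd b) q"
      by (intro cext_add cext_inner cext_mult cext_const assms)
    then show ?thesis by (simp add: inner_prod_def)
  qed
qed (use assms in simp)

theorem proposition5p2:
  fixes e :: "nat \<Rightarrow> 'n::finite" and n m :: nat
  assumes n: "n = CARD('n)"
    and e: "bij_betw e {1..n} UNIV"
    and m: "m = DD n + 3"
  shows "\<exists>\<omega> :: nat \<Rightarrow> (real ^ 'n) \<times> (real ^ 'n) \<times> real \<Rightarrow> real.
     (\<forall>k<m. \<omega> k real_analytic_on V_set e) \<and>
     (\<forall>(a, r) \<in> U_set e. chebyshev_system m (\<lambda>k x. \<omega> k (a, r, x)) (dom_I e a r)) \<and>
     (\<exists>coef :: nat \<Rightarrow> (real ^ 'n) \<times> (real ^ 'n) \<Rightarrow> real.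
        (\<forall>k<m. coef k real_analytic_on U_set e) \<and>
        (\<forall>(a, r) \<in> U_set e. \<forall>x \<in> dom_I e a r.
           phi e a r x = (\<Sum>k<m. coef k (a, r) * \<omega> k (a, r, x))))"
proof -
  interpret weighted_bundle "U_set e" "fibre e" "base_point e" "weight e"
    by (rule weighted_bundle_powers)
  define \<omega> where "\<omega> k = (\<lambda>z. iter_prim k 0 ((fst z, fst (snd z)), snd (snd z)))" for k
  \<comment> \<open>The generalized Taylor coefficients at the base point, hence functions of (a,r)
    alone.\<close>
  define coef where "coef k q = chain e k (q, base_point e q)" for k q
  have "\<omega> k real_analytic_on V_set e" for k
  proof (rule real_analytic_on_cext)
    fix z assume "z \<in> V_set e"
    then obtain a r x where z: "z = (a, r, x)" "((a, r), x) \<in> {(q, x). q \<in> U_set e \<and> x \<in> fibre e q}"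
      by (auto simp: V_set_def dom_I_fibre)
    show "cext (\<omega> k) z"
      unfolding \<omega>_def z(1) by (rule cext_reassoc[OF cext_iter_prim[OF z(2)]])
  qed
  moreover have "coef k real_analytic_on U_set e" for k
  proof (rule real_analytic_on_cext)
    fix q assume q: "q \<in> U_set e"
    have "cext (\<lambda>q. chain e k (q, base_point e q)) q"
      by (rule cext_section[OF cext_chain[OF fibreD[OF X0_in[OF q]]] cext_X0[OF q]])
    then show "cext (coef k) q" by (simp add: coef_def[abs_def])
  qed
  moreover have "chebyshev_system m (\<lambda>k x. \<omega> k (a, r, x)) (dom_I e a r)" if "(a, r) \<in> U_set e" for a r
    using chebyshev_iter_prim[OF that, of m 0] by (simp add: \<omega>_def dom_I_fibre)
  moreover have "phi e a r x = (\<Sum>k<m. coef k (a, r) * \<omega> k (a, r, x))"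
    if q: "(a, r) \<in> U_set e" and x: "x \<in> dom_I e a r" for a r x
  proof -
    \<comment> \<open>Two differentiations lead to the start of the sequence and \<open>DD n\<close>
      more to an element of R, whose value depends on r only; indices 0 to \<open>DD n + 2\<close>
      give the \<open>DD n + 3\<close> functions.\<close>
    have const: "chain e (0 + (DD n + 2)) ((a, r), y) = chain e (0 + (DD n + 2)) ((a, r), base_point e (a, r))"
      for y using leval_laurent_0[OF dd_seq_DD] by (simp add: chain_def n)
    have "chain e 0 ((a, r), x) = (\<Sum>k<Suc (DD n + 2). chain e (0 + k) ((a, r), base_point e (a, r)) * iter_prim k 0 ((a, r), x))"
      by (rule iter_prim_expansion[OF q chain_derivative const]) (use x in \<open>simp_all add: dom_I_fibre\<close>)
    moreover have "chain e 0 ((a, r), x) = phi e a r x"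
      by (simp add: chain_def phi_def gval_def)
    moreover have "m = Suc (DD n + 2)" using m by simp
    ultimately show ?thesis by (simp only: coef_def \<omega>_def fst_conv snd_conv add_0)
  qed
  ultimately show ?thesis
    by (intro exI[of _ \<omega>] conjI exI[of _ coef]) auto
qed

end
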